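(* Let $\ell \ge 2$ and let $\mathcal{R}$ be a merging $\ell$-vertex rule for which there exist functions $d_k:\mathbb{N}^\ell\to\mathbb{R}$ ($k\ge1$) such that, whenever $v_1,\dots,v_\ell$ all lie in different components of $G_{n,m}$, $\mathbb{E}(N_{n,k,m+1}-N_{n,k,m}\mid\mathcal{F}_{n,m},\mathbf{v}_{n,m+1})=d_k(c_1,\dots,c_\ell)$. Assume that for some $t^*\in[0,\infty)$ every solution $(\tilde\rho_k(t))_{k\ge1}$ on $[0,t^*]$ of the system (i) $0\le\rho_k(t)\le1$ and $0\le\sum_{k\ge1}\rho_k(t)\le1$; (ii') $\rho_k'(t)=\sum_{c_1,\dots,c_\ell\in\mathbb{N}}d_k(c_1,\dots,c_\ell)\prod_{j\in[\ell]}\rho_{c_j}(t)$ for all $k\ge1$ (right derivative at $t=0$); (iv) $\rho_1(0)=1$ and $\rho_k(0)=0$ for $k\ge2$, satisfies $\sum_{k\ge1}\tilde\rho_k(t^* )<1$. Then for any $t^*\le t<\infty$ and $\varepsilon>0$ there exist $\alpha,n_0>0$ such that $\Pr\bigl(L_1(G_{n,\lfloor tn\rfloor})\ge\alpha n\bigr)\ge1-\varepsilon$ for all $n\ge n_0$.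
   Context: Fix $\ell\ge 2$. An $\ell$-vertex rule $\mathcal{R}$ yields, for each $n$, a random sequence of graphs $(G_{n,m})_{m\ge 0}$ on $[n]$, defined on a probability space with a filtration $\mathcal{F}_{n,0}\subseteq\mathcal{F}_{n,1}\subseteq\cdots$: $G_{n,0}$ is empty; for each $m\ge0$ a tuple $\mathbf{v}_{n,m+1}=(v_1,\dots,v_\ell)$ is drawn from $[n]$ independently and uniformly at random, $\mathcal{F}_{n,m+1}$-measurable and independent of $\mathcal{F}_{n,m}$; and $G_{n,m+1}=G_{n,m}\cup E_{n,m+1}$ with $E_{n,m+1}$ an $\mathcal{F}_{n,m+1}$-measurable set of pairs among $v_1,\dots,v_\ell$, nonempty whenever the $v_j$ lie in $\ell$ distinct components of $G_{n,m}$. $c_j$ is the size of the component of $G_{n,m}$ containing $v_j$; $N_{n,k,m}$ is the number of vertices of $G_{n,m}$ in components of size exactly $k$; $L_1(G)$ is the number of vertices in a largest component of $G$. Merging: whenever $C,C'$ are distinct components of $G_{n,m}$ with $|C|,|C'|\ge\varepsilon n$, conditional on $\mathcal{F}_{n,m}$ they are joined in $G_{n,m+1}$ with probability at least $\varepsilon^\ell$. *)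

theory Defs
  imports "HOL-Probability.Probability"
begin

text \<open>Graphs on the vertex set [n] = {0..<n} are edge sets of ordered pairs;
  connectivity uses the symmetric reflexive-transitive closure.\<close>

definition comp :: "(nat \<times> nat) set \<Rightarrow> nat \<Rightarrow> nat set" where
  "comp G x = {y. (x, y) \<in> (G \<union> G\<inverse>)\<^sup>*}"

definition components :: "nat \<Rightarrow> (nat \<times> nat) set \<Rightarrow> nat set set" where
  "components n G = comp G ` {..<n}"

definition Nk :: "nat \<Rightarrow> nat \<Rightarrow> (nat \<times> nat) set \<Rightarrow> nat" where
  "Nk n k G = card {x \<in> {..<n}. card (comp G x) = k}"

definition L1 :: "nat \<Rightarrow> (nat \<times> nat) set \<Rightarrow> nat" where
  "L1 n G = Max ((\<lambda>x. card (comp G x)) ` {..<n})"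

definition tuples :: "nat \<Rightarrow> nat \<Rightarrow> nat list set" where
  "tuples l n = {vs. length vs = l \<and> set vs \<subseteq> {..<n}}"

definition graph_at :: "(nat \<Rightarrow> 'a \<Rightarrow> (nat \<times> nat) set) \<Rightarrow> nat \<Rightarrow> 'a \<Rightarrow> (nat \<times> nat) set" where
  "graph_at E m \<omega> = (\<Union>i\<in>{1..m}. E i \<omega>)"

definition rule_process ::
  "nat \<Rightarrow> nat \<Rightarrow> 'a measure \<Rightarrow> (nat \<Rightarrow> 'a measure) \<Rightarrow> (nat \<Rightarrow> 'a \<Rightarrow> nat list)
     \<Rightarrow> (nat \<Rightarrow> 'a \<Rightarrow> (nat \<times> nat) set) \<Rightarrow> bool" where
  "rule_process l n M F v E \<longleftrightarrow>
     prob_space M \<and>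
     (\<forall>m. subalgebra M (F m)) \<and>
     (\<forall>m. sets (F m) \<subseteq> sets (F (Suc m))) \<and>
     (\<forall>m. v (Suc m) \<in> measurable (F (Suc m)) (count_space UNIV)) \<and>
     (\<forall>m \<omega>. \<omega> \<in> space M \<longrightarrow> v (Suc m) \<omega> \<in> tuples l n) \<and>
     (\<forall>m A u. A \<in> sets (F m) \<longrightarrow> u \<in> tuples l n \<longrightarrow>
        measure M (A \<inter> {\<omega> \<in> space M. v (Suc m) \<omega> = u}) = measure M A / real n ^ l) \<and>
     (\<forall>m. E (Suc m) \<in> measurable (F (Suc m)) (count_space UNIV)) \<and>
     (\<forall>m \<omega>. \<omega> \<in> space M \<longrightarrow>
        E (Suc m) \<omega> \<subseteq> {(v (Suc m) \<omega> ! i, v (Suc m) \<omega> ! j) | i j. i < l \<and> j < l \<and> i \<noteq> j}) \<and>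
     (\<forall>m \<omega>. \<omega> \<in> space M \<longrightarrow> distinct (map (comp (graph_at E m \<omega>)) (v (Suc m) \<omega>))
        \<longrightarrow> E (Suc m) \<omega> \<noteq> {})"

definition merging ::
  "nat \<Rightarrow> nat \<Rightarrow> 'a measure \<Rightarrow> (nat \<Rightarrow> 'a measure) \<Rightarrow> (nat \<Rightarrow> 'a \<Rightarrow> (nat \<times> nat) set) \<Rightarrow> bool" where
  "merging l n M F E \<longleftrightarrow>
     (\<forall>\<epsilon>::real. \<epsilon> > 0 \<longrightarrow> (\<forall>m C C'. AE \<omega> in M.
        (C \<in> components n (graph_at E m \<omega>) \<and> C' \<in> components n (graph_at E m \<omega>) \<and> C \<noteq> C' \<and>
         real (card C) \<ge> \<epsilon> * real n \<and> real (card C') \<ge> \<epsilon> * real n) \<longrightarrow>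
        real_cond_exp M (F m)
          (indicator {\<omega>' \<in> space M. \<exists>x\<in>C. \<exists>y\<in>C'. y \<in> comp (graph_at E (Suc m) \<omega>') x}) \<omega>
          \<ge> \<epsilon> ^ l))"

definition drift_cond ::
  "nat \<Rightarrow> nat \<Rightarrow> 'a measure \<Rightarrow> (nat \<Rightarrow> 'a measure) \<Rightarrow> (nat \<Rightarrow> 'a \<Rightarrow> nat list)
     \<Rightarrow> (nat \<Rightarrow> 'a \<Rightarrow> (nat \<times> nat) set) \<Rightarrow> (nat \<Rightarrow> nat list \<Rightarrow> real) \<Rightarrow> bool" where
  "drift_cond l n M F v E d \<longleftrightarrow>
     (\<forall>m k. k \<ge> 1 \<longrightarrow> (AE \<omega> in M.
        distinct (map (comp (graph_at E m \<omega>)) (v (Suc m) \<omega>)) \<longrightarrow>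
        real_cond_exp M
          (sigma (space M) (sets (F m) \<union> {{\<omega>' \<in> space M. v (Suc m) \<omega>' = u} | u. True}))
          (\<lambda>\<omega>'. real (Nk n k (graph_at E (Suc m) \<omega>')) - real (Nk n k (graph_at E m \<omega>'))) \<omega>
        = d k (map (\<lambda>x. card (comp (graph_at E m \<omega>) x)) (v (Suc m) \<omega>))))"

definition ode_solution ::
  "nat \<Rightarrow> (nat \<Rightarrow> nat list \<Rightarrow> real) \<Rightarrow> real \<Rightarrow> (nat \<Rightarrow> real \<Rightarrow> real) \<Rightarrow> bool" where
  "ode_solution l d tstar \<rho> \<longleftrightarrow>
     (\<forall>t\<in>{0..tstar}.
        (\<forall>k\<ge>1. 0 \<le> \<rho> k t \<and> \<rho> k t \<le> 1) \<and>
        summable (\<lambda>k. \<rho> (Suc k) t) \<and> 0 \<le> (\<Sum>k. \<rho> (Suc k) t) \<and> (\<Sum>k. \<rho> (Suc k) t) \<le> 1 \<and>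
        (\<forall>k\<ge>1.
           (\<lambda>cs. d k cs * prod_list (map (\<lambda>c. \<rho> c t) cs))
              summable_on {cs. length cs = l \<and> (\<forall>c\<in>set cs. c \<ge> 1)} \<and>
           (\<rho> k has_real_derivative
              (\<Sum>\<^sub>\<infinity>cs\<in>{cs. length cs = l \<and> (\<forall>c\<in>set cs. c \<ge> 1)}.
                 d k cs * prod_list (map (\<lambda>c. \<rho> c t) cs)))
            (at t within {0..tstar}))) \<and>
     \<rho> 1 0 = 1 \<and> (\<forall>k\<ge>2. \<rho> k 0 = 0)"

end

theory Submission
  imports Defs "HOL-Complex_Analysis.Great_Picard"
begin

text \<open>
  If the conclusion fails, then for infinitely many $n$ the event $L_1(G_{n, t^* n}) = o(n)$ has probability
  bounded away from 0. By a maximal inequality for bounded martingale differences it contains an outcome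
  along which finitely many relevant counts follow their conditional expectations up to $o(n)$, and
  tuples hitting a component twice are negligible because all components have size $o(n)$. The
  rescaled counts $N_k / n$ along these outcomes are equi-Lipschitz, so a subsequence converges to
  functions $\rho_k$.

  The limit satisfies $\sum_k \rho_k(t^*) = 1$. First, if a fraction $x$ of the vertices lies in components of size at
  least $K$, then these merge among themselves at rate at least $x^\ell$, which can last only for time
  $x^{-\ell} / K$; this is measured by the potential $\sum_v 1 / \max(K, |C(v)|)$. Hence if mass $\delta$ were
  missing at $t^*$, then at time $t^* - A/K$ mass at most $\delta/2$ could be in components of size at least $K$,
  although at most $1 - 3\delta/4$ is in components of size less than $K/B$. A component of size less than $K$ is
  not touched during time $A/K$ with probability bounded below, so a fixed mass remains in
  the size range $[K/B, K)$ at time $t^*$, for every large $K$, which is absurd.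

  Since no mass is lost, the drift condition passes to the limit and $\rho$ solves the system of
  differential equations up to $t^*$, contradicting the hypothesis on its solutions.
\<close>

section \<open>Components and uniform tuples\<close>

text \<open>The functions \<open>d k\<close> are arbitrary, so nothing a priori bounds the infinite
  sum on the right of the differential equation or lets it commute with the limit. Two facts make up
  for this. One step changes a count \<open>Nk\<close> by at most \<open>l * k\<close>, so a size
  tuple c with |d_k(c)| > l k can occur only with negligible frequency; in the limit |d_k(c)| \<le>
  l k wherever the product of densities is positive. And the products over all size tuples sum to
  the l-th power of the total mass, which is 1 exactly when no mass escapes to large sizes. Hence
  conservation of mass has to precede the equation and must be derived from finite difference
  inequalities alone. The time x^(-l)/K arises so: the potential is at most n/K, and each step whose
  entries lie in large, pairwise distinct components lowers it by at least 1. Each probability space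
  is left once a good outcome is picked from it; all later estimates are deterministic. A diagonal
  choice ties the size cutoff to the error, J = j + 1 and e = 1/(j + 1). The case t* = 0 is
  separate: there the initial data already solve the system with total mass 1.\<close>

definition csize :: "(nat \<times> nat) set \<Rightarrow> nat \<Rightarrow> nat" where
  "csize G x = card (comp G x)"

lemma comp_refl [simp]: "x \<in> comp G x"
  by (simp add: comp_def)

lemma comp_sym: "y \<in> comp G x \<Longrightarrow> x \<in> comp G y"
  using symD[OF sym_rtrancl[OF sym_Un_converse[of G]]] by (auto simp: comp_def)

lemma comp_trans: "y \<in> comp G x \<Longrightarrow> z \<in> comp G y \<Longrightarrow> z \<in> comp G x"
  unfolding comp_def by auto

lemma comp_eq: "y \<in> comp G x \<Longrightarrow> comp G y = comp G x"
  by (meson comp_sym comp_trans subsetI subset_antisym)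

lemma comp_mono: "G \<subseteq> H \<Longrightarrow> comp G x \<subseteq> comp H x"
  unfolding comp_def using rtrancl_mono[of "G \<union> G\<inverse>" "H \<union> H\<inverse>"] by auto

lemma comp_edge: "(x, y) \<in> G \<Longrightarrow> y \<in> comp G x"
  unfolding comp_def by auto

lemma comp_subset:
  assumes "G \<subseteq> {..<n} \<times> {..<n}" "x < n"
  shows "comp G x \<subseteq> {..<n}"
proof
  fix y assume "y \<in> comp G x"
  then have "(x, y) \<in> (G \<union> G\<inverse>)\<^sup>*" by (simp add: comp_def)
  then show "y \<in> {..<n}" by (induction rule: rtrancl_induct) (use assms in auto)
qed

lemma finite_comp: "G \<subseteq> {..<n} \<times> {..<n} \<Longrightarrow> x < n \<Longrightarrow> finite (comp G x)"
  by (rule finite_subset[OF comp_subset]) auto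

lemma csize_pos: "G \<subseteq> {..<n} \<times> {..<n} \<Longrightarrow> x < n \<Longrightarrow> 1 \<le> csize G x"
  unfolding csize_def using finite_comp[of G n x] comp_refl[of x G]
  by (metis Suc_leI card_gt_0_iff empty_iff One_nat_def)

lemma csize_mono:
  assumes "G \<subseteq> H" "H \<subseteq> {..<n} \<times> {..<n}" "x < n"
  shows "csize G x \<le> csize H x"
  unfolding csize_def by (intro card_mono finite_comp[of _ n] comp_mono assms)

text \<open>A walk from \<open>x\<close> in the enlarged graph never meets \<open>U\<close>: while
  it stays in \<open>comp G x\<close> it avoids \<open>U\<close>, so its next edge comes from
  \<open>G\<close>.\<close>

lemma comp_Un_untouched:
  assumes e: "e \<subseteq> U \<times> U" and x: "\<And>u. u \<in> U \<Longrightarrow> x \<notin> comp G u"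
  shows "comp (G \<union> e) x = comp G x"
proof
  show "comp (G \<union> e) x \<subseteq> comp G x"
  proof
    fix y assume "y \<in> comp (G \<union> e) x"
    then have "(x, y) \<in> ((G \<union> e) \<union> (G \<union> e)\<inverse>)\<^sup>*" by (simp add: comp_def)
    then show "y \<in> comp G x"
    proof (induction rule: rtrancl_induct)
      case (step y z)
      have "y \<notin> U" using step.IH x comp_sym by blast
      then have "(y, z) \<in> G \<union> G\<inverse>" using step.hyps e by auto
      then have "z \<in> comp G y" by (auto simp: comp_def)
      then show ?case using step.IH comp_trans by blast
    qed simp
  qed
qed (rule comp_mono, simp)

lemma L1_ge:
  assumes "x < n" shows "csize G x \<le> L1 n G"
  unfolding L1_def csize_def by (rule Max_ge) (use assms in auto)

lemma L1_le_iff: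
  assumes "n > 0" shows "L1 n G \<le> b \<longleftrightarrow> (\<forall>x<n. csize G x \<le> b)"
  unfolding L1_def csize_def using assms by (subst Max_le_iff) auto

lemma L1_mono:
  assumes "n > 0" "G \<subseteq> H" "H \<subseteq> {..<n} \<times> {..<n}"
  shows "L1 n G \<le> L1 n H"
  unfolding L1_le_iff[OF assms(1)] using csize_mono[OF assms(2,3)] L1_ge[of _ n H] le_trans by blast

section \<open>Averages over a uniform tuple of vertices\<close>

lemma tuples_Suc: "tuples (Suc l) n = (\<lambda>(x, xs). x # xs) ` ({..<n} \<times> tuples l n)"
  unfolding tuples_def by (auto simp: image_iff length_Suc_conv)

lemma tuples_0: "tuples 0 n = {[]}"
  by (auto simp: tuples_def)

lemma finite_tuples [simp]: "finite (tuples l n)"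
  unfolding tuples_def using finite_lists_length_eq[of "{..<n}" l] by (simp add: conj_commute)

lemma card_tuples: "card (tuples l n) = n ^ l"
  unfolding tuples_def using card_lists_length_eq[of "{..<n}" l] by (simp add: conj_commute)

lemma sum_tuples_Suc:
  "(\<Sum>u\<in>tuples (Suc l) n. f u) = (\<Sum>x<n. \<Sum>xs\<in>tuples l n. f (x # xs))"
  unfolding tuples_Suc
  by (subst sum.reindex) (auto simp: inj_on_def sum.cartesian_product intro!: sum.cong)

text \<open>This is the conditional expectation of a function of the next tuple given the past. As a
  finite sum it makes sense along a single outcome, without a measure.\<close>

definition tuple_avg :: "nat \<Rightarrow> nat \<Rightarrow> (nat list \<Rightarrow> real) \<Rightarrow> real" where
  "tuple_avg l n f = (\<Sum>u\<in>tuples l n. f u) / real n ^ l"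

definition nondistinct :: "(nat \<times> nat) set \<Rightarrow> nat list \<Rightarrow> bool" where
  "nondistinct G u \<longleftrightarrow> \<not> distinct (map (comp G) u)"

definition sizes :: "(nat \<times> nat) set \<Rightarrow> nat list \<Rightarrow> nat list" where
  "sizes G u = map (csize G) u"

lemma tuple_avg_0: "tuple_avg 0 n f = f []"
  by (simp add: tuple_avg_def tuples_0)

lemma tuple_avg_Suc: "tuple_avg (Suc l) n f = (\<Sum>x<n. tuple_avg l n (\<lambda>xs. f (x # xs))) / real n"
  by (simp add: tuple_avg_def sum_tuples_Suc sum_divide_distrib mult.commute)

lemma tuple_avg_const: "n > 0 \<Longrightarrow> tuple_avg l n (\<lambda>_. c) = c"
  by (simp add: tuple_avg_def card_tuples)

lemma tuple_avg_mono: "(\<And>u. u \<in> tuples l n \<Longrightarrow> f u \<le> g u) \<Longrightarrow> tuple_avg l n f \<le> tuple_avg l n g"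
  unfolding tuple_avg_def by (intro divide_right_mono sum_mono) auto

lemma tuple_avg_add: "tuple_avg l n (\<lambda>u. f u + g u) = tuple_avg l n f + tuple_avg l n g"
  by (simp add: tuple_avg_def sum.distrib add_divide_distrib)

lemma tuple_avg_cmult: "tuple_avg l n (\<lambda>u. c * f u) = c * tuple_avg l n f"
  by (simp add: tuple_avg_def sum_distrib_left)

lemma sum_of_bool_Nk: "(\<Sum>x<n. of_bool (csize G x = k)) = real (Nk n k G)"
proof -
  have "(\<Sum>x<n. of_bool (csize G x = k)) = real (card ({..<n} \<inter> {x. csize G x = k}))"
    by (simp add: sum.If_cases of_bool_def)
  also have "{..<n} \<inter> {x. csize G x = k} = {x \<in> {..<n}. card (comp G x) = k}" by (auto simp: csize_def)
  finally show ?thesis by (simp add: Nk_def)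
qed

text \<open>The entries are independent, so the frequency of a size tuple is a product of densities;
  the products in the differential equations originate here.\<close>

lemma tuple_avg_sizes:
  assumes "n > 0" "length c = l"
  shows "tuple_avg l n (\<lambda>u. of_bool (sizes G u = c)) = prod_list (map (\<lambda>k. real (Nk n k G) / real n) c)"
  using assms(2)
proof (induction c arbitrary: l)
  case Nil
  then show ?case by (simp add: tuple_avg_0 sizes_def)
next
  case (Cons a c)
  then obtain l' where l: "l = Suc l'" "length c = l'" by auto
  have "tuple_avg l n (\<lambda>u. of_bool (sizes G u = a # c)) =
        (\<Sum>x<n. tuple_avg l' n (\<lambda>xs. of_bool (csize G x = a) * of_bool (sizes G xs = c))) / real n"
    unfolding l tuple_avg_Suc by (simp add: sizes_def of_bool_conj)
  also have "\<dots> = (\<Sum>x<n. of_bool (csize G x = a) * prod_list (map (\<lambda>k. real (Nk n k G) / real n) c)) / real n"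
    unfolding tuple_avg_cmult Cons.IH[OF l(2)] ..
  also have "\<dots> = real (Nk n a G) * prod_list (map (\<lambda>k. real (Nk n k G) / real n) c) / real n"
    unfolding sum_distrib_right[symmetric] sum_of_bool_Nk ..
  finally show ?case by simp
qed

text \<open>The mass below a threshold can only decrease as edges are added, whereas a single
  \<open>Nk\<close> can move both ways. Monotonicity in time is therefore always argued through
  \<open>Nless\<close>.\<close>

definition Nless :: "nat \<Rightarrow> nat \<Rightarrow> (nat \<times> nat) set \<Rightarrow> nat" where
  "Nless n K G = card {x \<in> {..<n}. csize G x < K}"

lemma Nless_eq_sum:
  assumes "G \<subseteq> {..<n} \<times> {..<n}"
  shows "Nless n K G = (\<Sum>k\<in>{1..<K}. Nk n k G)"
proof -
  have "{x \<in> {..<n}. csize G x < K} = (\<Union>k\<in>{1..<K}. {x \<in> {..<n}. csize G x = k})"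
    using csize_pos[OF assms] by auto
  then show ?thesis unfolding Nless_def Nk_def csize_def[symmetric]
    by (simp only:) (subst card_UN_disjoint, auto)
qed

lemma tuple_avg_all_ge:
  assumes "n > 0"
  shows "tuple_avg l n (\<lambda>u. of_bool (\<forall>x\<in>set u. K \<le> csize G x)) = (1 - real (Nless n K G) / real n) ^ l"
proof -
  have 1: "(\<Sum>x<n. of_bool (K \<le> csize G x)) = real n - real (Nless n K G)"
  proof -
    have "(\<Sum>x<n. of_bool (K \<le> csize G x)) = (\<Sum>x<n. 1 - of_bool (csize G x < K) :: real)"
      by (intro sum.cong) auto
    also have "\<dots> = real n - real (card ({..<n} \<inter> {x. csize G x < K}))"
      by (simp add: sum_subtractf sum.If_cases of_bool_def)
    also have "{..<n} \<inter> {x. csize G x < K} = {x \<in> {..<n}. csize G x < K}" by auto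
    finally show ?thesis by (simp add: Nless_def)
  qed
  show ?thesis
  proof (induction l)
    case 0 then show ?case by (simp add: tuple_avg_0)
  next
    case (Suc l)
    have "tuple_avg (Suc l) n (\<lambda>u. of_bool (\<forall>x\<in>set u. K \<le> csize G x)) =
      (\<Sum>x<n. tuple_avg l n (\<lambda>u. of_bool (K \<le> csize G x) * of_bool (\<forall>x\<in>set u. K \<le> csize G x))) / real n"
      unfolding tuple_avg_Suc by (simp add: of_bool_conj)
    also have "\<dots> = (real n - real (Nless n K G)) * (1 - real (Nless n K G) / real n) ^ l / real n"
      unfolding tuple_avg_cmult Suc sum_distrib_right[symmetric] 1 ..
    also have "\<dots> = (1 - real (Nless n K G) / real n) ^ Suc l" using assms by (simp add: field_simps)
    finally show ?case .
  qed
qed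

text \<open>Union bound over the entries; the factor \<open>l\<close> becomes part of the decay rate
  of a size class.\<close>

lemma tuple_avg_ex_size:
  assumes "n > 0"
  shows "tuple_avg l n (\<lambda>u. of_bool (\<exists>x\<in>set u. csize G x = k)) \<le> real l * real (Nk n k G) / real n"
proof (induction l)
  case 0 then show ?case by (simp add: tuple_avg_0)
next
  case (Suc l)
  have "tuple_avg (Suc l) n (\<lambda>u. of_bool (\<exists>x\<in>set u. csize G x = k)) \<le>
      (\<Sum>x<n. tuple_avg l n (\<lambda>u. of_bool (csize G x = k) + of_bool (\<exists>x\<in>set u. csize G x = k))) / real n"
    unfolding tuple_avg_Suc by (intro divide_right_mono sum_mono tuple_avg_mono) auto
  also have "\<dots> = (real (Nk n k G) + real n * tuple_avg l n (\<lambda>u. of_bool (\<exists>x\<in>set u. csize G x = k))) / real n"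
    unfolding tuple_avg_add tuple_avg_const[OF assms] sum.distrib sum_of_bool_Nk by simp
  also have "\<dots> \<le> (real (Nk n k G) + real n * (real l * real (Nk n k G) / real n)) / real n"
    using Suc by (intro divide_right_mono add_left_mono mult_left_mono) auto
  also have "\<dots> = real (Suc l) * real (Nk n k G) / real n" using assms by (simp add: field_simps)
  finally show ?case .
qed

text \<open>Induction on the length: the new entry has to fall into one of at most \<open>l\<close>
  components already hit, each with at most \<open>L1 n G\<close> vertices. Adding up over the
  entries gives the quadratic factor.\<close>

lemma tuple_avg_nondistinct:
  assumes n: "n > 0" and G: "G \<subseteq> {..<n} \<times> {..<n}"
  shows "tuple_avg l n (\<lambda>u. of_bool (nondistinct G u)) \<le> (real l)\<^sup>2 * real (L1 n G) / real n"
proof (induction l)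
  case 0 then show ?case by (simp add: tuple_avg_0 nondistinct_def)
next
  case (Suc l)
  define b where "b = real (L1 n G)"
  have hit: "(\<Sum>x<n. of_bool (comp G x \<in> comp G ` set u)) \<le> real l * b" if u: "u \<in> tuples l n" for u
  proof -
    have ul: "length u = l" "set u \<subseteq> {..<n}" using u by (auto simp: tuples_def)
    have "(\<Sum>x<n. of_bool (comp G x \<in> comp G ` set u)) = real (card ({..<n} \<inter> {x. comp G x \<in> comp G ` set u}))"
      by (simp add: sum.If_cases of_bool_def)
    also have "card ({..<n} \<inter> {x. comp G x \<in> comp G ` set u}) \<le> card (\<Union>y\<in>set u. comp G y)"
    proof (rule card_mono)
      show "finite (\<Union>y\<in>set u. comp G y)" using ul finite_comp[OF G] by auto
      show "{..<n} \<inter> {x. comp G x \<in> comp G ` set u} \<subseteq> (\<Union>y\<in>set u. comp G y)"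
        using comp_refl by blast
    qed
    also have "\<dots> \<le> (\<Sum>y\<in>set u. card (comp G y))" by (rule card_UN_le) simp
    also have "\<dots> \<le> (\<Sum>y\<in>set u. L1 n G)" using ul L1_ge[of _ n G] by (intro sum_mono) (auto simp: csize_def)
    also have "\<dots> \<le> l * L1 n G" using card_length[of u] ul by simp
    finally show ?thesis by (simp add: b_def flip: of_nat_mult)
  qed
  have "tuple_avg (Suc l) n (\<lambda>u. of_bool (nondistinct G u)) \<le>
      (\<Sum>x<n. tuple_avg l n (\<lambda>u. of_bool (comp G x \<in> comp G ` set u) + of_bool (nondistinct G u))) / real n"
    unfolding tuple_avg_Suc by (intro divide_right_mono sum_mono tuple_avg_mono) (auto simp: nondistinct_def)
  also have "\<dots> = (tuple_avg l n (\<lambda>u. \<Sum>x<n. of_bool (comp G x \<in> comp G ` set u)) + real n * tuple_avg l n (\<lambda>u. of_bool (nondistinct G u))) / real n"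
    unfolding tuple_avg_add sum.distrib
    by (simp add: tuple_avg_def sum_divide_distrib[symmetric] sum.swap[of _ "{..<n}"] del: sum_of_bool_eq)
  also have "\<dots> \<le> (tuple_avg l n (\<lambda>u. real l * b) + real n * ((real l)\<^sup>2 * b / real n)) / real n"
    using Suc hit by (intro divide_right_mono add_mono mult_left_mono tuple_avg_mono) (auto simp: b_def)
  also have "\<dots> = (real l + (real l)\<^sup>2) * b / real n" using n by (simp add: tuple_avg_const field_simps)
  also have "\<dots> \<le> (real (Suc l))\<^sup>2 * b / real n"
    by (intro divide_right_mono mult_right_mono) (auto simp: b_def power2_eq_square algebra_simps)
  finally show ?case by (simp add: b_def)
qed

section \<open>One step of the process\<close>

text \<open>The predicate \<open>P\<close> selects the entries that count. The bound serves in both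
  directions: components of the old graph control the vertices leaving a size class, those of the
  new graph the vertices entering it.\<close>

lemma card_touched:
  assumes G: "G \<subseteq> {..<n} \<times> {..<n}" and u: "u \<in> tuples l n"
    and b: "\<And>y. y \<in> set u \<Longrightarrow> P y \<Longrightarrow> csize G y \<le> b"
  shows "card (\<Union>y\<in>{y\<in>set u. P y}. comp G y) \<le> l * b"
proof -
  have ul: "length u = l" "set u \<subseteq> {..<n}" using u by (auto simp: tuples_def)
  have "card (\<Union>y\<in>{y\<in>set u. P y}. comp G y) \<le> (\<Sum>y\<in>{y\<in>set u. P y}. card (comp G y))"
    by (rule card_UN_le) simp
  also have "\<dots> \<le> (\<Sum>y\<in>{y\<in>set u. P y}. b)" using b by (intro sum_mono) (auto simp: csize_def)
  also have "\<dots> \<le> l * b"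
    using card_length[of u] card_mono[of "set u" "{y\<in>set u. P y}"] ul by auto
  finally show ?thesis .
qed

lemma finite_touched:
  assumes G: "G \<subseteq> {..<n} \<times> {..<n}" and u: "u \<in> tuples l n"
  shows "finite (\<Union>y\<in>{y\<in>set u. P y}. comp G y)"
  using finite_comp[OF G] u by (auto simp: tuples_def)

context
  fixes l n :: nat and G e :: "(nat \<times> nat) set" and u :: "nat list"
  assumes G: "G \<subseteq> {..<n} \<times> {..<n}" and u: "u \<in> tuples l n" and e: "e \<subseteq> set u \<times> set u"
begin

lemma Un_edges_subset: "G \<union> e \<subseteq> {..<n} \<times> {..<n}"
  using G u e unfolding tuples_def by blast

lemma csize_Un_untouched: "(\<And>y. y \<in> set u \<Longrightarrow> x \<notin> comp G y) \<Longrightarrow> csize (G \<union> e) x = csize G x"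
  unfolding csize_def using comp_Un_untouched[OF e] by simp

lemma csize_le_Un: "x < n \<Longrightarrow> csize G x \<le> csize (G \<union> e) x"
  by (rule csize_mono[OF _ Un_edges_subset]) auto

lemma csize_comp_eq: "y \<in> comp G x \<Longrightarrow> csize G y = csize G x"
  unfolding csize_def by (simp add: comp_eq)

text \<open>Only components of size exactly \<open>k\<close> that the tuple hits can leave the
  class. The indicator records this; it makes the loss proportional to the density of size
  \<open>k\<close> and thereby yields exponential decay.\<close>

lemma Nk_step_lower: "Nk n k G \<le> Nk n k (G \<union> e) + l * k * of_bool (\<exists>x\<in>set u. csize G x = k)"
proof -
  let ?T = "\<Union>y\<in>{y\<in>set u. csize G y = k}. comp G y"
  have "Nk n k G \<le> card ({x \<in> {..<n}. card (comp (G \<union> e) x) = k} \<union> ?T)"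
    unfolding Nk_def
  proof (rule card_mono)
    show "finite ({x \<in> {..<n}. card (comp (G \<union> e) x) = k} \<union> ?T)" using finite_touched[OF G u] by simp
    show "{x \<in> {..<n}. card (comp G x) = k} \<subseteq> {x \<in> {..<n}. card (comp (G \<union> e) x) = k} \<union> ?T"
    proof
      fix x assume x: "x \<in> {x \<in> {..<n}. card (comp G x) = k}"
      show "x \<in> {x \<in> {..<n}. card (comp (G \<union> e) x) = k} \<union> ?T"
      proof (cases "\<exists>y\<in>set u. x \<in> comp G y")
        case True
        then show ?thesis using x csize_comp_eq unfolding csize_def by fastforce
      next
        case False
        then show ?thesis using x csize_Un_untouched[of x] unfolding csize_def by auto
      qed
    qed
  qed
  also have "\<dots> \<le> Nk n k (G \<union> e) + card ?T" unfolding Nk_def by (rule card_Un_le)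
  also have "card ?T \<le> l * k * of_bool (\<exists>x\<in>set u. csize G x = k)"
  proof (cases "\<exists>x\<in>set u. csize G x = k")
    case True
    then show ?thesis using card_touched[OF G u, of "\<lambda>y. csize G y = k" k] by simp
  next
    case False
    then have "{y\<in>set u. csize G y = k} = {}" by auto
    then show ?thesis by (simp only:) simp
  qed
  finally show ?thesis by simp
qed

text \<open>A component of size \<open>k\<close> can be formed from smaller ones, so the gain
  carries no indicator. The touched vertices are counted in the enlarged graph.\<close>

lemma Nk_step_upper: "Nk n k (G \<union> e) \<le> Nk n k G + l * k"
proof -
  let ?H = "G \<union> e"
  let ?T = "\<Union>y\<in>{y\<in>set u. csize ?H y = k}. comp ?H y"
  have "Nk n k ?H \<le> card ({x \<in> {..<n}. card (comp G x) = k} \<union> ?T)"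
    unfolding Nk_def
  proof (rule card_mono)
    show "finite ({x \<in> {..<n}. card (comp G x) = k} \<union> ?T)" using finite_touched[OF Un_edges_subset u] by simp
    show "{x \<in> {..<n}. card (comp ?H x) = k} \<subseteq> {x \<in> {..<n}. card (comp G x) = k} \<union> ?T"
    proof
      fix x assume x: "x \<in> {x \<in> {..<n}. card (comp ?H x) = k}"
      show "x \<in> {x \<in> {..<n}. card (comp G x) = k} \<union> ?T"
      proof (cases "\<exists>y\<in>set u. x \<in> comp G y")
        case True
        then obtain y where y: "y \<in> set u" "x \<in> comp ?H y" using comp_mono[of G ?H] by blast
        then have "csize ?H y = k" using x comp_eq[of x ?H y] by (auto simp: csize_def)
        then show ?thesis using y by blast
      next
        case False
        then show ?thesis using x csize_Un_untouched[of x] unfolding csize_def by auto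
      qed
    qed
  qed
  also have "\<dots> \<le> Nk n k G + card ?T" unfolding Nk_def by (rule card_Un_le)
  also have "card ?T \<le> l * k" by (rule card_touched[OF Un_edges_subset u]) auto
  finally show ?thesis by simp
qed

lemma Nless_step_mono: "Nless n K (G \<union> e) \<le> Nless n K G"
  unfolding Nless_def using csize_le_Un by (intro card_mono) (auto intro: le_less_trans)

lemma Nless_step_lower: "Nless n K G \<le> Nless n K (G \<union> e) + l * K"
proof -
  let ?T = "\<Union>y\<in>{y\<in>set u. csize G y < K}. comp G y"
  have "Nless n K G \<le> card ({x \<in> {..<n}. csize (G \<union> e) x < K} \<union> ?T)"
    unfolding Nless_def
  proof (rule card_mono)
    show "finite ({x \<in> {..<n}. csize (G \<union> e) x < K} \<union> ?T)" using finite_touched[OF G u] by simp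
    show "{x \<in> {..<n}. csize G x < K} \<subseteq> {x \<in> {..<n}. csize (G \<union> e) x < K} \<union> ?T"
    proof
      fix x assume x: "x \<in> {x \<in> {..<n}. csize G x < K}"
      show "x \<in> {x \<in> {..<n}. csize (G \<union> e) x < K} \<union> ?T"
      proof (cases "\<exists>y\<in>set u. x \<in> comp G y")
        case True
        then show ?thesis using x csize_comp_eq by fastforce
      next
        case False
        then show ?thesis using x csize_Un_untouched[of x] by auto
      qed
    qed
  qed
  also have "\<dots> \<le> Nless n K (G \<union> e) + card ?T" unfolding Nless_def by (rule card_Un_le)
  also have "card ?T \<le> l * K" by (rule card_touched[OF G u]) auto
  finally show ?thesis by simp
qed

end

text \<open>Each component of size at least \<open>K\<close> contributes exactly 1 and every other
  vertex 1/K. So this is a count of the large components, corrected for the small ones so that it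
  never increases and starts at n/K at most.\<close>

definition potential :: "nat \<Rightarrow> nat \<Rightarrow> (nat \<times> nat) set \<Rightarrow> real" where
  "potential n K G = (\<Sum>x<n. 1 / real (max K (csize G x)))"

lemma potential_nonneg: "0 \<le> potential n K G"
  unfolding potential_def by (intro sum_nonneg) auto

lemma potential_le: 
  assumes "K > 0" shows "potential n K G \<le> real n / real K"
proof -
  have "potential n K G \<le> (\<Sum>x<n. 1 / real K)"
    unfolding potential_def using assms by (intro sum_mono divide_left_mono) auto
  then show ?thesis by simp
qed

lemma inverse_max_csize_mono:
  assumes "K > 0" "G \<subseteq> H" "H \<subseteq> {..<n} \<times> {..<n}" "x < n"
  shows "1 / real (max K (csize H x)) \<le> 1 / real (max K (csize G x))"
  using assms(1) csize_mono[OF assms(2-4)] by (intro divide_left_mono) auto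

lemma potential_mono:
  assumes "K > 0" "G \<subseteq> H" "H \<subseteq> {..<n} \<times> {..<n}"
  shows "potential n K H \<le> potential n K G"
  unfolding potential_def using inverse_max_csize_mono[OF assms] by (intro sum_mono) auto

text \<open>The two components contribute 1 each before the merger and together at most 1
  afterwards, because their union lies in one component; no other vertex raises its
  contribution.\<close>

lemma potential_merge:
  assumes K: "K > 0" and GH: "G \<subseteq> H" and H: "H \<subseteq> {..<n} \<times> {..<n}" and xy: "x < n" "y < n"
    and ne: "comp G x \<noteq> comp G y" and big: "K \<le> csize G x" "K \<le> csize G y" and m: "y \<in> comp H x"
  shows "potential n K H + 1 \<le> potential n K G"
proof -
  let ?A = "comp G x \<union> comp G y"
  have G: "G \<subseteq> {..<n} \<times> {..<n}" using GH H by auto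
  have fin: "finite (comp G x)" "finite (comp G y)" using finite_comp[OF G] xy by auto
  have disj: "comp G x \<inter> comp G y = {}" using ne comp_eq by blast
  have sub: "?A \<subseteq> {..<n}" using comp_subset[OF G] xy by auto
  have pos: "csize G x > 0" "csize G y > 0" using csize_pos[OF G] xy by (auto simp: Suc_le_eq)
  have 1: "(\<Sum>z\<in>?A. 1 / real (max K (csize G z))) = 2"
  proof -
    have "(\<Sum>z\<in>?A. 1 / real (max K (csize G z))) =
       (\<Sum>z\<in>comp G x. 1 / real (max K (csize G z))) + (\<Sum>z\<in>comp G y. 1 / real (max K (csize G z)))"
      by (rule sum.union_disjoint[OF fin disj])
    also have "(\<Sum>z\<in>comp G x. 1 / real (max K (csize G z))) = (\<Sum>z\<in>comp G x. 1 / real (csize G x))"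
      using comp_eq big by (intro sum.cong) (auto simp: csize_def max_def)
    also have "\<dots> = 1" using pos by (simp add: csize_def)
    also have "(\<Sum>z\<in>comp G y. 1 / real (max K (csize G z))) = (\<Sum>z\<in>comp G y. 1 / real (csize G y))"
      using comp_eq big by (intro sum.cong) (auto simp: csize_def max_def)
    also have "\<dots> = 1" using pos by (simp add: csize_def)
    finally show ?thesis by simp
  qed
  have AH: "?A \<subseteq> comp H x" using comp_mono[OF GH] comp_eq[OF m] by blast
  have cA: "card ?A \<le> csize H x" unfolding csize_def by (rule card_mono[OF finite_comp[OF H xy(1)] AH])
  have cA0: "card ?A > 0" using fin comp_refl[of x G] card_gt_0_iff by blast
  \<comment> \<open>The new component may be larger than \<open>?A\<close>, so the share of
    \<open>?A\<close> is only bounded by 1.\<close>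
  have 2: "(\<Sum>z\<in>?A. 1 / real (max K (csize H z))) \<le> 1"
  proof -
    have "(\<Sum>z\<in>?A. 1 / real (max K (csize H z))) \<le> (\<Sum>z\<in>?A. 1 / real (card ?A))"
    proof (rule sum_mono)
      fix z assume "z \<in> ?A"
      then have "csize H z = csize H x" using AH comp_eq by (auto simp: csize_def)
      then show "1 / real (max K (csize H z)) \<le> 1 / real (card ?A)"
        using cA cA0 by (intro divide_left_mono) auto
    qed
    also have "\<dots> = 1" using cA0 by simp
    finally show ?thesis .
  qed
  have split: "potential n K J = (\<Sum>z\<in>?A. 1 / real (max K (csize J z))) + (\<Sum>z\<in>{..<n} - ?A. 1 / real (max K (csize J z)))" for J
    unfolding potential_def using sum.subset_diff[OF sub, of "\<lambda>z. 1 / real (max K (csize J z))"] by simp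
  have "(\<Sum>z\<in>{..<n} - ?A. 1 / real (max K (csize H z))) \<le> (\<Sum>z\<in>{..<n} - ?A. 1 / real (max K (csize G z)))"
    using inverse_max_csize_mono[OF K GH H] by (intro sum_mono) auto
  then show ?thesis unfolding split 1 using 2 by simp
qed

text \<open>One fixed outcome of the process. The tuple \<open>w i\<close> takes \<open>G i\<close>
  to \<open>G (Suc i)\<close>, so it stands for the tuple with index \<open>Suc i\<close> of the
  process.\<close>

locale rule_path =
  fixes l n :: nat and G :: "nat \<Rightarrow> (nat \<times> nat) set" and w :: "nat \<Rightarrow> nat list" 
  assumes n_pos: "n > 0"
    and G_0: "G 0 = {}"
    and w_tuples: "w i \<in> tuples l n"
    and G_step: "\<exists>e. G (Suc i) = G i \<union> e \<and> e \<subseteq> {(w i ! p, w i ! q) | p q. p < l \<and> q < l \<and> p \<noteq> q} \<and>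
        (\<not> nondistinct (G i) (w i) \<longrightarrow> e \<noteq> {})"
begin

lemma G_stepE:
  obtains e where "G (Suc i) = G i \<union> e" "e \<subseteq> set (w i) \<times> set (w i)"
    "\<not> nondistinct (G i) (w i) \<Longrightarrow> \<exists>p q. p < l \<and> q < l \<and> p \<noteq> q \<and> (w i ! p, w i ! q) \<in> e"
proof -
  obtain e where e: "G (Suc i) = G i \<union> e" "e \<subseteq> {(w i ! p, w i ! q) | p q. p < l \<and> q < l \<and> p \<noteq> q}"
    "\<not> nondistinct (G i) (w i) \<longrightarrow> e \<noteq> {}" using G_step[of i] by (elim exE conjE)
  have "e \<subseteq> set (w i) \<times> set (w i)" using e(2) w_tuples[of i] by (auto simp: tuples_def)
  moreover have "\<exists>p q. p < l \<and> q < l \<and> p \<noteq> q \<and> (w i ! p, w i ! q) \<in> e" if nd: "\<not> nondistinct (G i) (w i)"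
  proof -
    obtain z where "z \<in> e" using e(3) nd by auto
    moreover then obtain p q where "z = (w i ! p, w i ! q)" "p < l" "q < l" "p \<noteq> q" using e(2) by auto
    ultimately show ?thesis by auto
  qed
  ultimately show ?thesis using that e(1) by simp
qed

lemma G_sub: "G i \<subseteq> {..<n} \<times> {..<n}"
proof (induction i)
  case (Suc i)
  then show ?case using Un_edges_subset[OF Suc w_tuples] G_stepE[of i] by metis
qed (simp add: G_0)

lemma G_mono: "i \<le> j \<Longrightarrow> G i \<subseteq> G j"
  by (rule lift_Suc_mono_le[of G]) (rule G_stepE, auto)

lemma Nk_increment:
  "- real (l * k) * of_bool (\<exists>x\<in>set (w i). csize (G i) x = k) \<le> real (Nk n k (G (Suc i))) - real (Nk n k (G i))"
  "\<bar>real (Nk n k (G (Suc i))) - real (Nk n k (G i))\<bar> \<le> real (l * k)"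
proof -
  obtain e where e: "G (Suc i) = G i \<union> e" "e \<subseteq> set (w i) \<times> set (w i)" by (rule G_stepE)
  have 1: "real (Nk n k (G i)) \<le> real (Nk n k (G (Suc i)) + l * k * of_bool (\<exists>x\<in>set (w i). csize (G i) x = k))"
    unfolding e(1) of_nat_le_iff by (rule Nk_step_lower[OF G_sub w_tuples e(2)])
  have 2: "real (Nk n k (G (Suc i))) \<le> real (Nk n k (G i) + l * k)"
    unfolding e(1) of_nat_le_iff by (rule Nk_step_upper[OF G_sub w_tuples e(2)])
  have 3: "real (l * k * of_bool (\<exists>x\<in>set (w i). csize (G i) x = k)) = real (l * k) * of_bool (\<exists>x\<in>set (w i). csize (G i) x = k)" by simp
  have 4: "real (l * k) * of_bool (\<exists>x\<in>set (w i). csize (G i) x = k) \<le> real (l * k)" by simp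
  show "- real (l * k) * of_bool (\<exists>x\<in>set (w i). csize (G i) x = k) \<le> real (Nk n k (G (Suc i))) - real (Nk n k (G i))"
    using 1 3 by linarith
  show "\<bar>real (Nk n k (G (Suc i))) - real (Nk n k (G i))\<bar> \<le> real (l * k)"
    using 1 2 3 4 by linarith
qed

lemma Nk_diff_sum: "m1 \<le> m2 \<Longrightarrow>
  real (Nk n k (G m2)) - real (Nk n k (G m1)) = (\<Sum>i\<in>{m1..<m2}. real (Nk n k (G (Suc i))) - real (Nk n k (G i)))"
  using sum_Suc_diff'[of m1 m2 "\<lambda>i. real (Nk n k (G i))"] by simp

lemma Nk_lipschitz: "m1 \<le> m2 \<Longrightarrow> \<bar>real (Nk n k (G m2)) - real (Nk n k (G m1))\<bar> \<le> real (l * k) * real (m2 - m1)"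
proof -
  assume m: "m1 \<le> m2"
  have "\<bar>\<Sum>i\<in>{m1..<m2}. real (Nk n k (G (Suc i))) - real (Nk n k (G i))\<bar> \<le> (\<Sum>i\<in>{m1..<m2}. real (l * k))"
    by (rule order_trans[OF sum_abs sum_mono]) (rule Nk_increment(2))
  then show ?thesis unfolding Nk_diff_sum[OF m] by (simp add: mult.commute)
qed

lemma Nless_Suc: "Nless n K (G (Suc i)) \<le> Nless n K (G i)" "Nless n K (G i) \<le> Nless n K (G (Suc i)) + l * K"
proof -
  obtain e where e: "G (Suc i) = G i \<union> e" "e \<subseteq> set (w i) \<times> set (w i)" by (rule G_stepE)
  show "Nless n K (G (Suc i)) \<le> Nless n K (G i)" "Nless n K (G i) \<le> Nless n K (G (Suc i)) + l * K"
    unfolding e(1) by (rule Nless_step_mono[OF G_sub w_tuples e(2)] Nless_step_lower[OF G_sub w_tuples e(2)])+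
qed

lemma Nless_antimono: "m1 \<le> m2 \<Longrightarrow> Nless n K (G m2) \<le> Nless n K (G m1)"
  by (rule lift_Suc_antimono_le[of "\<lambda>i. Nless n K (G i)"]) (rule Nless_Suc)

lemma Nless_lipschitz:
  assumes "m1 \<le> m2" shows "Nless n K (G m1) \<le> Nless n K (G m2) + l * K * (m2 - m1)"
  using assms
proof (induction m2 rule: dec_induct)
  case (step m)
  then show ?case using Nless_Suc(2)[of K m] by (simp add: Suc_diff_le)
qed simp

text \<open>If all entries lie in large and pairwise different components, the rule must add an edge
  between two of them, and the potential drops by at least 1. In every other case the left side is
  at most 0. Summed over time, the right side telescopes and bounds the number of such
  steps.\<close>

lemma potential_step:
  assumes "K > 0"
  shows "of_bool (\<forall>x\<in>set (w i). K \<le> csize (G i) x) - of_bool (nondistinct (G i) (w i))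
     \<le> potential n K (G i) - potential n K (G (Suc i))"
proof -
  have mono: "potential n K (G (Suc i)) \<le> potential n K (G i)"
    by (rule potential_mono[OF assms G_mono G_sub]) simp
  show ?thesis
  proof (cases "(\<forall>x\<in>set (w i). K \<le> csize (G i) x) \<and> \<not> nondistinct (G i) (w i)")
    case True
    then obtain e p q where e: "G (Suc i) = G i \<union> e" and pq: "p < l" "q < l" "p \<noteq> q" "(w i ! p, w i ! q) \<in> e"
      by (metis G_stepE)
    have w: "length (w i) = l" "set (w i) \<subseteq> {..<n}" using w_tuples[of i] by (auto simp: tuples_def)
    then have mem: "w i ! p \<in> set (w i)" "w i ! q \<in> set (w i)" using pq by auto
    have lt: "w i ! p < n" "w i ! q < n" using mem w(2) by auto
    have "comp (G i) (w i ! p) \<noteq> comp (G i) (w i ! q)"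
      using True pq w by (auto simp: nondistinct_def distinct_conv_nth)
    then have "potential n K (G (Suc i)) + 1 \<le> potential n K (G i)"
      using mem lt True pq
      by (intro potential_merge[OF assms G_mono G_sub, of _ _ "w i ! p" "w i ! q"]) (simp_all add: e comp_edge)
    then show ?thesis using True by simp
  qed (use mono in auto)
qed

end

section \<open>Bounded martingale differences\<close>

text \<open>For fixed \<open>n\<close> only finitely many tuples and graphs occur, so the variables
  built from the process are simple and their integrability is automatic.\<close>

lemma (in prob_space) simple_function_integrable:
  fixes f :: "'a \<Rightarrow> real"
  assumes "simple_function M f" shows "integrable M f"
proof -
  have fin: "finite (f ` space M)" using assms by (simp add: simple_functionD)
  show ?thesis
  proof (rule integrable_const_bound[of _ "Max (abs ` f ` space M)"])
    show "AE x in M. norm (f x) \<le> Max (abs ` f ` space M)" using fin by (intro AE_I2) auto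
    show "f \<in> borel_measurable M" using assms by (rule borel_measurable_simple_function)
  qed
qed

lemma simple_function_Collect:
  assumes "simple_function M f" shows "{x \<in> space M. P (f x)} \<in> sets M"
proof -
  have "f -` Collect P \<inter> space M = {x \<in> space M. P (f x)}" by auto
  then show ?thesis using simple_functionD(2)[OF assms, of "Collect P"] by simp
qed

locale filtered_prob = prob_space M for M :: "'a measure" +
  fixes F :: "nat \<Rightarrow> 'a measure"
  assumes subalg: "subalgebra M (F m)"
    and F_Suc: "sets (F m) \<subseteq> sets (F (Suc m))"
begin

lemma space_F [simp]: "space (F m) = space M"
  using subalg by (simp add: subalgebra_def)

lemma sets_F_mono: "i \<le> j \<Longrightarrow> sets (F i) \<subseteq> sets (F j)"
  by (rule lift_Suc_mono_le[of "\<lambda>i. sets (F i)"]) (rule F_Suc)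

lemma sets_F_M: "sets (F m) \<subseteq> sets M"
  using subalg by (simp add: subalgebra_def)

lemma simple_F_mono: "simple_function (F i) f \<Longrightarrow> i \<le> j \<Longrightarrow> simple_function (F j) f"
  using sets_F_mono[of i j] unfolding simple_function_def by auto

lemma simple_F_M: "simple_function (F i) f \<Longrightarrow> simple_function M f"
  using sets_F_M[of i] unfolding simple_function_def by auto

text \<open>The martingale difference property is stated through integrals over past events instead
  of conditional expectations. The index is shifted: \<open>D i\<close> is revealed at time
  \<open>Suc i\<close> and centred given time \<open>i\<close>.\<close>

definition mds :: "(nat \<Rightarrow> 'a \<Rightarrow> real) \<Rightarrow> real \<Rightarrow> bool" where
  "mds D C \<longleftrightarrow> (\<forall>i. simple_function (F (Suc i)) (D i)) \<and>
     (\<forall>i. \<forall>\<omega>\<in>space M. \<bar>D i \<omega>\<bar> \<le> C) \<and>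
     (\<forall>i. \<forall>A\<in>sets (F i). (\<integral>\<omega>. indicator A \<omega> * D i \<omega> \<partial>M) = 0)"

text \<open>A simple variable of the past is a finite combination of indicators of its level sets,
  and each of these integrates to 0 against \<open>D\<close>.\<close>

lemma integral_simple_mult_eq_0:
  assumes Z: "simple_function (F i) Z" and D: "simple_function M D"
    and z: "\<And>A. A \<in> sets (F i) \<Longrightarrow> (\<integral>\<omega>. indicator A \<omega> * D \<omega> \<partial>M) = 0"
  shows "(\<integral>\<omega>. Z \<omega> * D \<omega> \<partial>M) = (0::real)"
proof -
  have fin: "finite (Z ` space M)" using Z by (simp add: simple_function_def)
  have A: "Z -` {z} \<inter> space M \<in> sets (F i)" for z
    using simple_functionD(2)[OF Z, of "{z}"] by simp
  have AM: "Z -` {z} \<inter> space M \<in> sets M" for z using A sets_F_M by blast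
  have "(\<integral>\<omega>. Z \<omega> * D \<omega> \<partial>M) = (\<integral>\<omega>. (\<Sum>z\<in>Z ` space M. z * (indicator (Z -` {z} \<inter> space M) \<omega> * D \<omega>)) \<partial>M)"
  proof (rule Bochner_Integration.integral_cong[OF refl])
    fix \<omega> assume w: "\<omega> \<in> space M"
    have "(\<Sum>z\<in>Z ` space M. z * (indicator (Z -` {z} \<inter> space M) \<omega> * D \<omega>)) = (\<Sum>z\<in>Z ` space M. if z = Z \<omega> then z * D \<omega> else 0)"
      using w by (intro sum.cong) auto
    also have "\<dots> = Z \<omega> * D \<omega>" using fin w by (simp add: sum.delta)
    finally show "Z \<omega> * D \<omega> = (\<Sum>z\<in>Z ` space M. z * (indicator (Z -` {z} \<inter> space M) \<omega> * D \<omega>))" by simp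
  qed
  also have "\<dots> = (\<Sum>z\<in>Z ` space M. z * (\<integral>\<omega>. indicator (Z -` {z} \<inter> space M) \<omega> * D \<omega> \<partial>M))"
    by (subst Bochner_Integration.integral_sum)
       (auto intro!: simple_function_integrable simple_function_compose2[where h="(*)"] simple_function_indicator AM D simp: simple_function_mult)
  also have "\<dots> = 0" by (simp add: z[OF A])
  finally show ?thesis .
qed

lemma mds_simple_sum:
  assumes "mds D C" shows "simple_function (F m) (\<lambda>\<omega>. \<Sum>i<m. D i \<omega>)"
proof (rule simple_function_sum)
  fix i assume "i \<in> {..<m}"
  then show "simple_function (F m) (D i)" using assms simple_F_mono[of "Suc i" "D i" m] by (auto simp: mds_def)
qed

text \<open>Orthogonality: the partial sum up to \<open>m\<close> belongs to the past of
  \<open>D m\<close>, so the cross term vanishes and the second moments add.\<close>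

lemma mds_second_moment:
  assumes D: "mds D C"
  shows "(\<integral>\<omega>. (\<Sum>i<m. D i \<omega>)\<^sup>2 \<partial>M) \<le> real m * C\<^sup>2"
proof (induction m)
  case (Suc m)
  let ?S = "\<lambda>\<omega>. \<Sum>i<m. D i \<omega>"
  have S: "simple_function (F m) ?S" by (rule mds_simple_sum[OF D])
  have SM: "simple_function M ?S" by (rule simple_F_M[OF S])
  have DM: "simple_function M (D m)" using D by (auto simp: mds_def intro: simple_F_M)
  have i1: "integrable M (\<lambda>\<omega>. (?S \<omega>)\<^sup>2)"
    by (intro simple_function_integrable simple_function_compose1[OF SM])
  have i2: "integrable M (\<lambda>\<omega>. ?S \<omega> * D m \<omega>)"
    by (intro simple_function_integrable simple_function_mult SM DM)
  have i3: "integrable M (\<lambda>\<omega>. (D m \<omega>)\<^sup>2)"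
    by (intro simple_function_integrable simple_function_compose1[OF DM])
  have "(\<integral>\<omega>. (\<Sum>i<Suc m. D i \<omega>)\<^sup>2 \<partial>M) = (\<integral>\<omega>. (?S \<omega>)\<^sup>2 + (2 * (?S \<omega> * D m \<omega>) + (D m \<omega>)\<^sup>2) \<partial>M)"
    by (intro Bochner_Integration.integral_cong) (simp_all add: power2_eq_square algebra_simps)
  also have "\<dots> = (\<integral>\<omega>. (?S \<omega>)\<^sup>2 \<partial>M) + (2 * (\<integral>\<omega>. ?S \<omega> * D m \<omega> \<partial>M) + (\<integral>\<omega>. (D m \<omega>)\<^sup>2 \<partial>M))"
    using i1 i2 i3 by (simp add: Bochner_Integration.integral_add)
  also have "(\<integral>\<omega>. ?S \<omega> * D m \<omega> \<partial>M) = 0"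
    by (rule integral_simple_mult_eq_0[OF S DM]) (use D in \<open>auto simp: mds_def\<close>)
  also have "(\<integral>\<omega>. (D m \<omega>)\<^sup>2 \<partial>M) \<le> (\<integral>\<omega>. C\<^sup>2 \<partial>M)"
    using D by (intro integral_mono i3) (auto simp: mds_def abs_le_square_iff[symmetric] intro: order_trans[OF _ abs_ge_self])
  finally show ?case using Suc by (simp add: prob_space algebra_simps)
qed simp

lemma mds_chebyshev:
  assumes D: "mds D C" and lam: "lam > 0"
  shows "prob {\<omega> \<in> space M. lam \<le> \<bar>\<Sum>i<m. D i \<omega>\<bar>} \<le> real m * C\<^sup>2 / lam\<^sup>2"
proof -
  have S: "simple_function M (\<lambda>\<omega>. \<Sum>i<m. D i \<omega>)" by (rule simple_F_M[OF mds_simple_sum[OF D]])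
  have "prob {\<omega> \<in> space M. lam \<le> \<bar>\<Sum>i<m. D i \<omega>\<bar>} = prob {\<omega> \<in> space M. lam\<^sup>2 \<le> (\<Sum>i<m. D i \<omega>)\<^sup>2}"
    using lam by (intro arg_cong[where f = prob] Collect_cong) (auto simp: abs_le_square_iff[symmetric])
  also have "\<dots> \<le> (\<integral>\<omega>. (\<Sum>i<m. D i \<omega>)\<^sup>2 \<partial>M) / lam\<^sup>2"
    using lam by (intro integral_Markov_inequality_measure[where A = "{}"] simple_function_integrable simple_function_compose1[OF S]) auto
  also have "\<dots> \<le> real m * C\<^sup>2 / lam\<^sup>2"
    by (intro divide_right_mono mds_second_moment D) simp
  finally show ?thesis .
qed

text \<open>Stopping the martingale when it first leaves $(-\lambda, \lambda)$ reduces the maximal inequality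
  to the inequality at the final time.\<close>

lemma mds_maximal:
  assumes D: "mds D C" and lam: "lam > 0"
  shows "prob {\<omega> \<in> space M. \<exists>m\<le>T. lam \<le> \<bar>\<Sum>i<m. D i \<omega>\<bar>} \<le> real T * C\<^sup>2 / lam\<^sup>2"
proof -
  \<comment> \<open>\<open>B i\<close> says that no partial sum up to index \<open>i\<close> has
    left the interval. It belongs to \<open>F i\<close>, so multiplying by its indicator keeps the
    martingale difference property.\<close>
  define B where "B i = {\<omega> \<in> space M. \<forall>r\<in>{..i}. \<bar>\<Sum>s<r. D s \<omega>\<bar> < lam}" for i
  define D' where "D' i \<omega> = indicator (B i) \<omega> * D i \<omega>" for i \<omega>
  have lev: "{\<omega> \<in> space M. \<bar>\<Sum>s<r. D s \<omega>\<bar> < lam} \<in> sets (F i)" if "r \<le> i" for r i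
    using simple_function_Collect[OF simple_F_mono[OF mds_simple_sum[OF D] that]] by simp
  have B: "B i \<in> sets (F i)" for i
  proof -
    have "{\<omega> \<in> space (F i). \<forall>r\<in>{..i}. \<bar>\<Sum>s<r. D s \<omega>\<bar> < lam} \<in> sets (F i)"
      using lev by (intro sets.sets_Collect_finite_All) auto
    then show ?thesis by (simp add: B_def)
  qed
  have simp': "simple_function (F (Suc i)) (D' i)" for i
    unfolding D'_def using B[of i] F_Suc[of i] D by (intro simple_function_mult simple_function_indicator) (auto simp: mds_def)
  have C: "0 \<le> C" using D not_empty by (force simp: mds_def)
  have mds': "mds D' C"
    unfolding mds_def
  proof (intro conjI allI ballI simp')
    fix i \<omega> assume "\<omega> \<in> space M"
    then show "\<bar>D' i \<omega>\<bar> \<le> C" using D C by (auto simp: D'_def indicator_def mds_def)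
  next
    fix i A assume A: "A \<in> sets (F i)"
    have "(\<integral>\<omega>. indicator A \<omega> * D' i \<omega> \<partial>M) = (\<integral>\<omega>. indicator (A \<inter> B i) \<omega> * D i \<omega> \<partial>M)"
      by (simp add: D'_def indicator_inter_arith mult.assoc)
    also have "\<dots> = 0" using D A B by (auto simp: mds_def)
    finally show "(\<integral>\<omega>. indicator A \<omega> * D' i \<omega> \<partial>M) = 0" .
  qed
  have "{\<omega> \<in> space M. \<exists>m\<le>T. lam \<le> \<bar>\<Sum>i<m. D i \<omega>\<bar>} \<subseteq> {\<omega> \<in> space M. lam \<le> \<bar>\<Sum>i<T. D' i \<omega>\<bar>}"
  proof safe
    fix \<omega> m assume w: "\<omega> \<in> space M" and m: "m \<le> T" "lam \<le> \<bar>\<Sum>i<m. D i \<omega>\<bar>"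
    \<comment> \<open>From the first exit index on all stopped increments vanish, so the stopped sum
      at \<open>T\<close> is still the exit value.\<close>
    define m0 where "m0 = (LEAST m. lam \<le> \<bar>\<Sum>i<m. D i \<omega>\<bar>)"
    have m0: "lam \<le> \<bar>\<Sum>i<m0. D i \<omega>\<bar>" unfolding m0_def by (rule LeastI[of _ m]) (rule m)
    have m0T: "m0 \<le> T" unfolding m0_def using Least_le[of _ m] m by (metis (mono_tags, lifting) order_trans)
    have lt: "\<bar>\<Sum>i<r. D i \<omega>\<bar> < lam" if "r < m0" for r
      using not_less_Least[of r "\<lambda>m. lam \<le> \<bar>\<Sum>i<m. D i \<omega>\<bar>"] that by (simp add: m0_def not_le)
    have "(\<Sum>i<T. D' i \<omega>) = (\<Sum>i<m0. D' i \<omega>) + (\<Sum>i\<in>{m0..<T}. D' i \<omega>)"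
      by (simp add: lessThan_atLeast0 sum.atLeastLessThan_concat m0T)
    also have "(\<Sum>i<m0. D' i \<omega>) = (\<Sum>i<m0. D i \<omega>)"
      using lt w by (intro sum.cong) (auto simp: D'_def B_def indicator_def)
    also have "(\<Sum>i\<in>{m0..<T}. D' i \<omega>) = 0"
    proof (rule sum.neutral, rule ballI)
      fix i assume "i \<in> {m0..<T}"
      then have "\<omega> \<notin> B i" using m0 by (force simp: B_def)
      then show "D' i \<omega> = 0" by (simp add: D'_def)
    qed
    finally show "lam \<le> \<bar>\<Sum>i<T. D' i \<omega>\<bar>" using m0 by simp
  qed
  moreover have "{\<omega> \<in> space M. lam \<le> \<bar>\<Sum>i<T. D' i \<omega>\<bar>} \<in> sets M"
    by (rule simple_function_Collect[OF simple_F_M[OF mds_simple_sum[OF mds']]])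
  ultimately have "prob {\<omega> \<in> space M. \<exists>m\<le>T. lam \<le> \<bar>\<Sum>i<m. D i \<omega>\<bar>} \<le> prob {\<omega> \<in> space M. lam \<le> \<bar>\<Sum>i<T. D' i \<omega>\<bar>}"
    by (rule finite_measure_mono)
  also have "\<dots> \<le> real T * C\<^sup>2 / lam\<^sup>2" by (rule mds_chebyshev[OF mds' lam])
  finally show ?thesis .
qed

lemma mds_exceed_sets:
  assumes D: "mds D C"
  shows "{\<omega> \<in> space M. \<exists>m\<le>T. lam \<le> \<bar>\<Sum>i<m. D i \<omega>\<bar>} \<in> sets M"
proof -
  have 1: "{\<omega> \<in> space M. lam \<le> \<bar>\<Sum>i<m. D i \<omega>\<bar>} \<in> sets M" for m
    by (rule simple_function_Collect[OF simple_F_M[OF mds_simple_sum[OF D]]])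
  have eq: "{\<omega> \<in> space M. \<exists>m\<le>T. lam \<le> \<bar>\<Sum>i<m. D i \<omega>\<bar>} = (\<Union>m\<in>{..T}. {\<omega> \<in> space M. lam \<le> \<bar>\<Sum>i<m. D i \<omega>\<bar>})"
    by blast
  show ?thesis unfolding eq by (rule sets.finite_UN) (simp, rule 1)
qed

text \<open>Union bound: the outcomes where some sum reaches \<open>lam\<close> have smaller
  probability than \<open>A\<close>, so they cannot cover \<open>A\<close>. This turns a probability
  estimate into one deterministic path.\<close>

lemma exists_good_outcome:
  assumes fin: "finite I" and D: "\<And>a. a \<in> I \<Longrightarrow> mds (D a) C" and lam: "lam > 0"
    and A: "A \<in> sets M" "real (card I) * (real T * C\<^sup>2 / lam\<^sup>2) < prob A"
  shows "\<exists>\<omega>\<in>A. \<forall>a\<in>I. \<forall>m\<le>T. \<bar>\<Sum>i<m. D a i \<omega>\<bar> \<le> lam"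
proof -
  define Q where "Q a = {\<omega> \<in> space M. \<exists>m\<le>T. lam \<le> \<bar>\<Sum>i<m. D a i \<omega>\<bar>}" for a
  have Qs: "Q a \<in> sets M" if "a \<in> I" for a unfolding Q_def by (rule mds_exceed_sets[OF D[OF that]])
  have "prob (\<Union>a\<in>I. Q a) \<le> (\<Sum>a\<in>I. prob (Q a))"
    by (rule finite_measure_subadditive_finite) (use fin Qs in auto)
  also have "\<dots> \<le> (\<Sum>a\<in>I. real T * C\<^sup>2 / lam\<^sup>2)"
    unfolding Q_def by (intro sum_mono mds_maximal D lam)
  also have "\<dots> < prob A" using A(2) by simp
  finally have lt: "prob (\<Union>a\<in>I. Q a) < prob A" .
  have "\<not> A \<subseteq> (\<Union>a\<in>I. Q a)"
  proof
    assume "A \<subseteq> (\<Union>a\<in>I. Q a)"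
    then have "prob A \<le> prob (\<Union>a\<in>I. Q a)" using fin Qs by (intro finite_measure_mono) auto
    with lt show False by simp
  qed
  then obtain \<omega> where w: "\<omega> \<in> A" "\<forall>a\<in>I. \<omega> \<notin> Q a" by auto
  then have "\<omega> \<in> space M" using A(1) sets.sets_into_space by blast
  with w show ?thesis by (force simp: Q_def)
qed

end

section \<open>Martingales of an $\ell$-vertex rule\<close>

text \<open>The sizes are cut off at \<open>J\<close> because the union bound needs a finite family;
  the cutoff tends to infinity with \<open>n\<close>.\<close>

definition size_tuples :: "nat \<Rightarrow> nat \<Rightarrow> nat list set" where
  "size_tuples l J = {c. length c = l \<and> set c \<subseteq> {1..J}}"

lemma finite_size_tuples [simp]: "finite (size_tuples l J)"
  unfolding size_tuples_def using finite_lists_length_eq[of "{1..J}" l] by (simp add: conj_commute)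

text \<open>Predicates of a graph and a tuple, so that one martingale lemma covers all of them. The
  four families serve in turn to discard repeated components, to bound the drop of the potential, to
  bound the decay of a size class, and to find the frequency of a size tuple.\<close>

definition test_events :: "nat \<Rightarrow> nat \<Rightarrow> ((nat \<times> nat) set \<Rightarrow> nat list \<Rightarrow> bool) set" where
  "test_events l J = {nondistinct} \<union> (\<lambda>K G u. \<forall>x\<in>set u. K \<le> csize G x) ` {..J} \<union>
     (\<lambda>k G u. \<exists>x\<in>set u. csize G x = k) ` {..J} \<union> (\<lambda>c G u. sizes G u = c) ` size_tuples l J"

lemma finite_test_events [simp]: "finite (test_events l J)"
  by (simp add: test_events_def)

text \<open>Deviations are controlled for all prefixes up to \<open>T\<close>, so an arbitrary time
  interval costs only twice the error. In \<open>drift_dev\<close> the tuple has to hit distinct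
  components, since only then is the drift prescribed.\<close>

locale good_path = rule_path +
  fixes d :: "nat \<Rightarrow> nat list \<Rightarrow> real" and T J :: nat and e :: real
  assumes L1_small: "real (L1 n (G T)) \<le> e * real n"
    and test_dev: "P \<in> test_events l J \<Longrightarrow> m \<le> T \<Longrightarrow>
      \<bar>\<Sum>i<m. of_bool (P (G i) (w i)) - tuple_avg l n (\<lambda>u. of_bool (P (G i) u))\<bar> \<le> e * real n"
    and drift_dev: "k \<in> {1..J} \<Longrightarrow> c \<in> size_tuples l J \<Longrightarrow> m \<le> T \<Longrightarrow>
      \<bar>\<Sum>i<m. of_bool (\<not> nondistinct (G i) (w i) \<and> sizes (G i) (w i) = c) *
         (real (Nk n k (G (Suc i))) - real (Nk n k (G i)) - d k c)\<bar> \<le> e * real n"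

lemma graph_at_Suc: "graph_at E (Suc m) \<omega> = graph_at E m \<omega> \<union> E (Suc m) \<omega>"
  by (auto simp: graph_at_def atLeastAtMostSuc_conv)

lemma simple_function_finite_count_space:
  assumes "f \<in> measurable M (count_space UNIV)" "f ` space M \<subseteq> B" "finite B"
  shows "simple_function M f"
  unfolding simple_function_def using assms finite_subset measurable_sets[OF assms(1)] by auto

locale rule_proc = filtered_prob M F for M :: "'a measure" and F +
  fixes l n :: nat and v :: "nat \<Rightarrow> 'a \<Rightarrow> nat list" and E :: "nat \<Rightarrow> 'a \<Rightarrow> (nat \<times> nat) set"
  assumes proc: "rule_process l n M F v E" and n_pos: "n > 0"
begin

abbreviation "GG \<equiv> graph_at E"

lemma v_tuples: "\<omega> \<in> space M \<Longrightarrow> v (Suc m) \<omega> \<in> tuples l n"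
  using proc unfolding rule_process_def by blast

lemma E_sub: "\<omega> \<in> space M \<Longrightarrow>
  E (Suc m) \<omega> \<subseteq> {(v (Suc m) \<omega> ! p, v (Suc m) \<omega> ! q) | p q. p < l \<and> q < l \<and> p \<noteq> q}"
  using proc unfolding rule_process_def by simp

lemma E_sub_square: "\<omega> \<in> space M \<Longrightarrow> E (Suc m) \<omega> \<subseteq> {..<n} \<times> {..<n}"
proof -
  assume w: "\<omega> \<in> space M"
  have "E (Suc m) \<omega> \<subseteq> set (v (Suc m) \<omega>) \<times> set (v (Suc m) \<omega>)"
    using E_sub[OF w, of m] v_tuples[OF w, of m] by (auto simp: tuples_def)
  also have "\<dots> \<subseteq> {..<n} \<times> {..<n}" using v_tuples[OF w, of m] unfolding tuples_def by blast
  finally show ?thesis .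
qed

lemma rule_path: "\<omega> \<in> space M \<Longrightarrow> rule_path l n (\<lambda>i. GG i \<omega>) (\<lambda>i. v (Suc i) \<omega>)"
proof (unfold_locales)
  fix i assume w: "\<omega> \<in> space M"
  have "distinct (map (comp (GG i \<omega>)) (v (Suc i) \<omega>)) \<longrightarrow> E (Suc i) \<omega> \<noteq> {}"
    using proc w unfolding rule_process_def by blast
  then show "\<exists>e. GG (Suc i) \<omega> = GG i \<omega> \<union> e \<and>
      e \<subseteq> {(v (Suc i) \<omega> ! p, v (Suc i) \<omega> ! q) |p q. p < l \<and> q < l \<and> p \<noteq> q} \<and>
      (\<not> nondistinct (GG i \<omega>) (v (Suc i) \<omega>) \<longrightarrow> e \<noteq> {})"
    using E_sub[OF w, of i] by (intro exI[of _ "E (Suc i) \<omega>"]) (simp add: graph_at_Suc nondistinct_def)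
qed (auto simp: n_pos v_tuples graph_at_def)

lemma simple_v: "simple_function (F (Suc m)) (v (Suc m))"
proof (rule simple_function_finite_count_space[where B = "tuples l n"])
  show "v (Suc m) \<in> F (Suc m) \<rightarrow>\<^sub>M count_space UNIV" using proc unfolding rule_process_def by blast
qed (auto simp: v_tuples)

lemma simple_E: "simple_function (F (Suc m)) (E (Suc m))"
proof (rule simple_function_finite_count_space[where B = "Pow ({..<n} \<times> {..<n})"])
  show "E (Suc m) \<in> F (Suc m) \<rightarrow>\<^sub>M count_space UNIV" using proc unfolding rule_process_def by blast
qed (use E_sub_square in auto)

lemma simple_G: "simple_function (F m) (GG m)"
proof (induction m)
  case 0
  then show ?case by (simp add: graph_at_def)
next
  case (Suc m)
  have "simple_function (F (Suc m)) (\<lambda>\<omega>. GG m \<omega> \<union> E (Suc m) \<omega>)"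
    by (rule simple_function_compose2[OF simple_F_mono[OF Suc] simple_E]) simp
  then show ?case by (simp add: graph_at_Suc[abs_def])
qed

lemma simple_GS: "simple_function (F (Suc m)) (GG m)"
  by (rule simple_F_mono[OF simple_G]) simp

lemma mds_mono: "mds D C \<Longrightarrow> C \<le> C' \<Longrightarrow> mds D C'"
  unfolding mds_def by (meson order_trans)

text \<open>The tuple is uniform and independent of the past, hence its centred indicators integrate
  to 0 over every past event.\<close>

lemma indep_v:
  assumes A: "A \<in> sets (F i)" and u: "u \<in> tuples l n"
  shows "(\<integral>\<omega>. indicator A \<omega> * (of_bool (v (Suc i) \<omega> = u) - 1 / real n ^ l) \<partial>M) = 0"
proof -
  let ?B = "{\<omega> \<in> space M. v (Suc i) \<omega> = u}"
  have AM: "A \<in> sets M" using A sets_F_M by blast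
  have BM: "?B \<in> sets M" by (rule simple_function_Collect[OF simple_F_M[OF simple_v]])
  have "(\<integral>\<omega>. indicator A \<omega> * (of_bool (v (Suc i) \<omega> = u) - 1 / real n ^ l) \<partial>M) =
     (\<integral>\<omega>. indicator (A \<inter> ?B) \<omega> - indicator A \<omega> / real n ^ l \<partial>M)"
    by (intro Bochner_Integration.integral_cong) (auto simp: indicator_def)
  also have "\<dots> = prob (A \<inter> ?B) - prob A / real n ^ l"
    using AM BM by (subst Bochner_Integration.integral_diff) (auto simp: Int_absorb2 sets.sets_into_space integrable_indicator_iff emeasure_eq_measure)
  also have "\<dots> = 0" using proc A u unfolding rule_process_def by simp
  finally show ?thesis .
qed

text \<open>The difference is a sum over tuples \<open>u\<close> of a past factor, the truth of
  \<open>P\<close> at \<open>u\<close>, times the centred indicator of drawing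
  \<open>u\<close>.\<close>

lemma mds_test:
  fixes P :: "(nat \<times> nat) set \<Rightarrow> nat list \<Rightarrow> bool"
  shows "mds (\<lambda>i \<omega>. of_bool (P (GG i \<omega>) (v (Suc i) \<omega>)) - tuple_avg l n (\<lambda>u. of_bool (P (GG i \<omega>) u))) 1"
  unfolding mds_def
proof (intro conjI allI ballI)
  fix i
  show "simple_function (F (Suc i)) (\<lambda>\<omega>. of_bool (P (GG i \<omega>) (v (Suc i) \<omega>)) - tuple_avg l n (\<lambda>u. of_bool (P (GG i \<omega>) u)) :: real)"
    by (rule simple_function_compose2[OF simple_GS simple_v, where h = "\<lambda>g x. of_bool (P g x) - tuple_avg l n (\<lambda>u. of_bool (P g u)) :: real"])
next
  fix i \<omega> 
  have "tuple_avg l n (\<lambda>_. 0) \<le> tuple_avg l n (\<lambda>u. of_bool (P (GG i \<omega>) u))" by (rule tuple_avg_mono) simp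
  moreover have "tuple_avg l n (\<lambda>u. of_bool (P (GG i \<omega>) u)) \<le> tuple_avg l n (\<lambda>_. 1)" by (rule tuple_avg_mono) simp
  ultimately show "\<bar>of_bool (P (GG i \<omega>) (v (Suc i) \<omega>)) - tuple_avg l n (\<lambda>u. of_bool (P (GG i \<omega>) u))\<bar> \<le> 1"
    using n_pos by (auto simp: tuple_avg_const)
next
  fix i A assume A: "A \<in> sets (F i)"
  have sA: "simple_function (F i) (indicator A :: 'a \<Rightarrow> real)" using A by (rule simple_function_indicator)
  have sZ: "simple_function (F i) (\<lambda>\<omega>. indicator A \<omega> * of_bool (P (GG i \<omega>) u) :: real)" for u
    by (intro simple_function_mult sA simple_function_compose1[OF simple_G, where g = "\<lambda>g. of_bool (P g u)"])
  have sD: "simple_function M (\<lambda>\<omega>. of_bool (v (Suc i) \<omega> = u) - 1 / real n ^ l :: real)" for u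
    by (rule simple_function_compose1[OF simple_F_M[OF simple_v], where g = "\<lambda>x. of_bool (x = u) - 1 / real n ^ l"])
  have "(\<integral>\<omega>. indicator A \<omega> * (of_bool (P (GG i \<omega>) (v (Suc i) \<omega>)) - tuple_avg l n (\<lambda>u. of_bool (P (GG i \<omega>) u))) \<partial>M) =
    (\<integral>\<omega>. (\<Sum>u\<in>tuples l n. (indicator A \<omega> * of_bool (P (GG i \<omega>) u)) * (of_bool (v (Suc i) \<omega> = u) - 1 / real n ^ l)) \<partial>M)"
  proof (rule Bochner_Integration.integral_cong[OF refl])
    fix \<omega> assume w: "\<omega> \<in> space M"
    have "(\<Sum>u\<in>tuples l n. of_bool (P (GG i \<omega>) u) * of_bool (v (Suc i) \<omega> = u)) =
        (\<Sum>u\<in>tuples l n. if u = v (Suc i) \<omega> then of_bool (P (GG i \<omega>) u) else 0 :: real)"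
      by (intro sum.cong) auto
    also have "\<dots> = of_bool (P (GG i \<omega>) (v (Suc i) \<omega>))" using v_tuples[OF w, of i] by (simp add: sum.delta)
    finally have 1: "of_bool (P (GG i \<omega>) (v (Suc i) \<omega>)) = (\<Sum>u\<in>tuples l n. of_bool (P (GG i \<omega>) u) * of_bool (v (Suc i) \<omega> = u) :: real)" by simp
    show "indicator A \<omega> * (of_bool (P (GG i \<omega>) (v (Suc i) \<omega>)) - tuple_avg l n (\<lambda>u. of_bool (P (GG i \<omega>) u))) =
      (\<Sum>u\<in>tuples l n. (indicator A \<omega> * of_bool (P (GG i \<omega>) u)) * (of_bool (v (Suc i) \<omega> = u) - 1 / real n ^ l))"
      unfolding 1 tuple_avg_def sum_divide_distrib sum_subtractf[symmetric] sum_distrib_left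
      by (intro sum.cong) (auto simp: algebra_simps)
  qed
  also have "\<dots> = (\<Sum>u\<in>tuples l n. \<integral>\<omega>. (indicator A \<omega> * of_bool (P (GG i \<omega>) u)) * (of_bool (v (Suc i) \<omega> = u) - 1 / real n ^ l) \<partial>M)"
    by (rule Bochner_Integration.integral_sum) (intro simple_function_integrable simple_function_mult simple_F_M[OF sZ] sD)
  also have "\<dots> = 0"
    by (intro sum.neutral ballI integral_simple_mult_eq_0[OF sZ sD] indep_v)
  finally show "(\<integral>\<omega>. indicator A \<omega> * (of_bool (P (GG i \<omega>) (v (Suc i) \<omega>)) - tuple_avg l n (\<lambda>u. of_bool (P (GG i \<omega>) u))) \<partial>M) = 0" .
qed

text \<open>The prescribed drift is conditional on the past and the tuple. Whether the tuple has
  distinct components and sizes \<open>c\<close> is known at that moment, and if so the conditional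
  expectation is the constant \<open>d k c\<close>; integrating over this event gives 0.\<close>

lemma mds_drift:
  assumes drift: "drift_cond l n M F v E d" and k: "k \<ge> 1"
  shows "mds (\<lambda>i \<omega>. of_bool (\<not> nondistinct (GG i \<omega>) (v (Suc i) \<omega>) \<and> sizes (GG i \<omega>) (v (Suc i) \<omega>) = c) *
         (real (Nk n k (GG (Suc i) \<omega>)) - real (Nk n k (GG i \<omega>)) - d k c)) (real (l * k) + \<bar>d k c\<bar>)"
  unfolding mds_def
proof (intro conjI allI ballI)
  fix i
  show "simple_function (F (Suc i)) (\<lambda>\<omega>. of_bool (\<not> nondistinct (GG i \<omega>) (v (Suc i) \<omega>) \<and> sizes (GG i \<omega>) (v (Suc i) \<omega>) = c) *
         (real (Nk n k (GG (Suc i) \<omega>)) - real (Nk n k (GG i \<omega>)) - d k c))"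
    by (intro simple_function_mult simple_function_diff
       simple_function_compose2[OF simple_GS simple_v, where h = "\<lambda>g x. of_bool (\<not> nondistinct g x \<and> sizes g x = c)"]
       simple_function_compose1[OF simple_G, where g = "\<lambda>g. real (Nk n k g)"]
       simple_function_compose1[OF simple_GS, where g = "\<lambda>g. real (Nk n k g)"] simple_function_const)
next
  fix i \<omega> assume w: "\<omega> \<in> space M"
  interpret p: rule_path l n "\<lambda>i. GG i \<omega>" "\<lambda>i. v (Suc i) \<omega>" by (rule rule_path[OF w])
  show "\<bar>of_bool (\<not> nondistinct (GG i \<omega>) (v (Suc i) \<omega>) \<and> sizes (GG i \<omega>) (v (Suc i) \<omega>) = c) *
         (real (Nk n k (GG (Suc i) \<omega>)) - real (Nk n k (GG i \<omega>)) - d k c)\<bar> \<le> real (l * k) + \<bar>d k c\<bar>"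
    using p.Nk_increment(2)[of k i] unfolding of_bool_def by (auto simp: abs_mult)
next
  fix i A assume A: "A \<in> sets (F i)"
  define X where "X \<omega> = real (Nk n k (GG (Suc i) \<omega>)) - real (Nk n k (GG i \<omega>))" for \<omega>
  define H where "H = sigma (space M) (sets (F i) \<union> {{\<omega>' \<in> space M. v (Suc i) \<omega>' = u} | u. True})"
  \<comment> \<open>The event \<open>B\<close> is cut by the value of the tuple: the level sets of
    the tuple are generators of \<open>H\<close>, and for fixed \<open>u\<close> the remaining
    condition belongs to \<open>F i\<close>.\<close>
  define W where "W u = A \<inter> {\<omega> \<in> space M. \<not> nondistinct (GG i \<omega>) u \<and> sizes (GG i \<omega>) u = c} \<inter> {\<omega> \<in> space M. v (Suc i) \<omega> = u}" for u
  define B where "B = (\<Union>u\<in>tuples l n. W u)"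
  have gen: "sets (F i) \<union> {{\<omega>' \<in> space M. v (Suc i) \<omega>' = u} | u. True} \<subseteq> Pow (space M)"
    using sets.sets_into_space[of _ "F i"] by auto
  have spH: "space H = space M" unfolding H_def by (rule space_measure_of[OF gen])
  have setsH: "sets H = sigma_sets (space M) (sets (F i) \<union> {{\<omega>' \<in> space M. v (Suc i) \<omega>' = u} | u. True})"
    unfolding H_def by (rule sets_measure_of[OF gen])
  have HM: "subalgebra M H" unfolding subalgebra_def
  proof
    show "sets H \<subseteq> sets M" unfolding setsH
    proof (rule sets.sigma_sets_subset)
      show "sets (F i) \<union> {{\<omega>' \<in> space M. v (Suc i) \<omega>' = u} | u. True} \<subseteq> sets M"
        using sets_F_M simple_function_Collect[OF simple_F_M[OF simple_v]] by auto
    qed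
  qed (rule spH)
  interpret H: finite_measure_subalgebra M H by unfold_locales (rule HM)
  have FH: "a \<in> sets H" if "a \<in> sets (F i)" for a using that unfolding setsH by (intro sigma_sets.Basic) auto
  have WH: "W u \<in> sets H" for u
  proof -
    have "{\<omega> \<in> space M. \<not> nondistinct (GG i \<omega>) u \<and> sizes (GG i \<omega>) u = c} \<in> sets (F i)"
      using simple_function_Collect[OF simple_G[of i], of "\<lambda>g. \<not> nondistinct g u \<and> sizes g u = c"] by simp
    moreover have "{\<omega> \<in> space M. v (Suc i) \<omega> = u} \<in> sets H" unfolding setsH by (intro sigma_sets.Basic) auto
    ultimately show ?thesis unfolding W_def using FH A by blast
  qed
  have BH: "B \<in> sets H" unfolding B_def by (intro sets.finite_UN WH) simp
  have BM: "B \<in> sets M" using BH HM by (auto simp: subalgebra_def)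
  have Asub: "A \<subseteq> space M" using sets.sets_into_space[OF A] by simp
  have Bmem: "\<omega> \<in> B \<longleftrightarrow> \<omega> \<in> A \<and> \<not> nondistinct (GG i \<omega>) (v (Suc i) \<omega>) \<and> sizes (GG i \<omega>) (v (Suc i) \<omega>) = c" for \<omega>
    unfolding B_def W_def using Asub v_tuples[of \<omega> i] by auto
  have sX: "simple_function M X" unfolding X_def
    by (intro simple_function_diff
       simple_F_M[OF simple_function_compose1[OF simple_G, where g = "\<lambda>g. real (Nk n k g)"]])
  have iX: "integrable M X" by (rule simple_function_integrable[OF sX])
  have ae: "AE \<omega> in M. indicator B \<omega> * real_cond_exp M H X \<omega> = indicator B \<omega> * d k c"
  proof -
    have "AE \<omega> in M. distinct (map (comp (graph_at E i \<omega>)) (v (Suc i) \<omega>)) \<longrightarrow>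
        real_cond_exp M H X \<omega> = d k (map (\<lambda>x. card (comp (graph_at E i \<omega>) x)) (v (Suc i) \<omega>))"
      using drift k unfolding drift_cond_def H_def X_def by blast
    then show ?thesis
    proof (rule AE_mp, intro AE_I2 impI)
      fix \<omega> assume *: "distinct (map (comp (graph_at E i \<omega>)) (v (Suc i) \<omega>)) \<longrightarrow>
        real_cond_exp M H X \<omega> = d k (map (\<lambda>x. card (comp (graph_at E i \<omega>) x)) (v (Suc i) \<omega>))"
      show "indicator B \<omega> * real_cond_exp M H X \<omega> = indicator B \<omega> * d k c"
      proof (cases "\<omega> \<in> B")
        case True
        then show ?thesis using * Bmem[of \<omega>] unfolding nondistinct_def sizes_def csize_def by simp
      qed simp
    qed
  qed
  have iBX: "integrable M (\<lambda>\<omega>. indicator B \<omega> * X \<omega>)"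
    by (intro simple_function_integrable simple_function_mult sX simple_function_indicator BM)
  have iBd: "integrable M (\<lambda>\<omega>. indicator B \<omega> * d k c)"
    by (intro simple_function_integrable simple_function_mult simple_function_const simple_function_indicator BM)
  have bm: "indicator B \<in> borel_measurable H" using BH by simp
  have Xm: "X \<in> borel_measurable M" using iX by simp
  have "(\<integral>\<omega>. indicator B \<omega> * X \<omega> \<partial>M) = (\<integral>\<omega>. indicator B \<omega> * real_cond_exp M H X \<omega> \<partial>M)"
    using H.real_cond_exp_intg(2)[OF iBX bm Xm] by simp
  also have "\<dots> = (\<integral>\<omega>. indicator B \<omega> * d k c \<partial>M)"
    by (rule integral_cong_AE[OF _ _ ae])
       (use H.real_cond_exp_intg(1)[OF iBX bm Xm] iBd in auto)
  finally have eq: "(\<integral>\<omega>. indicator B \<omega> * X \<omega> \<partial>M) = (\<integral>\<omega>. indicator B \<omega> * d k c \<partial>M)" .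
  have "(\<integral>\<omega>. indicator A \<omega> *
             (of_bool (\<not> nondistinct (GG i \<omega>) (v (Suc i) \<omega>) \<and> sizes (GG i \<omega>) (v (Suc i) \<omega>) = c) *
              (real (Nk n k (GG (Suc i) \<omega>)) - real (Nk n k (GG i \<omega>)) - d k c)) \<partial>M) =
     (\<integral>\<omega>. indicator B \<omega> * X \<omega> - indicator B \<omega> * d k c \<partial>M)"
    unfolding X_def[symmetric]
    by (intro Bochner_Integration.integral_cong refl) (auto simp: indicator_def Bmem)
  also have "\<dots> = 0" using eq iBX iBd by (simp only: Bochner_Integration.integral_diff)
  finally show "(\<integral>\<omega>. indicator A \<omega> *
             (of_bool (\<not> nondistinct (GG i \<omega>) (v (Suc i) \<omega>) \<and> sizes (GG i \<omega>) (v (Suc i) \<omega>) = c) *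
              (real (Nk n k (GG (Suc i) \<omega>)) - real (Nk n k (GG i \<omega>)) - d k c)) \<partial>M) = 0" .
qed

text \<open>Test events and drifts are joined in one disjoint sum so that a single union bound
  applies; \<open>C\<close> dominates the increments of both kinds.\<close>

lemma exists_good_path:
  fixes C :: real
  assumes drift: "drift_cond l n M F v E d" and e: "e > 0"
    and C: "1 \<le> C" "\<And>k c. k \<in> {1..J} \<Longrightarrow> c \<in> size_tuples l J \<Longrightarrow> real (l * k) + \<bar>d k c\<bar> \<le> C"
    and A: "real (card (test_events l J <+> {1..J} \<times> size_tuples l J)) * (real T * C\<^sup>2 / (e * real n)\<^sup>2)
       < prob {\<omega> \<in> space M. real (L1 n (GG T \<omega>)) \<le> e * real n}"
  shows "\<exists>G w. good_path l n G w d T J e"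
proof -
  define D where "D a = (case a of
      Inl P \<Rightarrow> (\<lambda>i \<omega>. of_bool (P (GG i \<omega>) (v (Suc i) \<omega>)) - tuple_avg l n (\<lambda>u. of_bool (P (GG i \<omega>) u)))
    | Inr kc \<Rightarrow> (\<lambda>i \<omega>. of_bool (\<not> nondistinct (GG i \<omega>) (v (Suc i) \<omega>) \<and> sizes (GG i \<omega>) (v (Suc i) \<omega>) = snd kc) *
         (real (Nk n (fst kc) (GG (Suc i) \<omega>)) - real (Nk n (fst kc) (GG i \<omega>)) - d (fst kc) (snd kc))))" for a
  have "\<exists>\<omega>\<in>{\<omega> \<in> space M. real (L1 n (GG T \<omega>)) \<le> e * real n}.
     \<forall>a\<in>test_events l J <+> {1..J} \<times> size_tuples l J. \<forall>m\<le>T. \<bar>\<Sum>i<m. D a i \<omega>\<bar> \<le> e * real n"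
  proof (rule exists_good_outcome[where C = C])
    fix a assume "a \<in> test_events l J <+> {1..J} \<times> size_tuples l J"
    then show "mds (D a) C"
    proof (rule PlusE)
      fix P assume "a = Inl P"
      then show ?thesis unfolding D_def using mds_mono[OF mds_test C(1)] by simp
    next
      fix kc assume a: "a = Inr kc" "kc \<in> {1..J} \<times> size_tuples l J"
      then have kc: "fst kc \<in> {1..J}" "snd kc \<in> size_tuples l J" by auto
      then have "1 \<le> fst kc" by simp
      show ?thesis unfolding D_def a(1) sum.case by (rule mds_mono[OF mds_drift[OF drift \<open>1 \<le> fst kc\<close>] C(2)[OF kc]])
    qed
  next
    show "{\<omega> \<in> space M. real (L1 n (GG T \<omega>)) \<le> e * real n} \<in> sets M"
      by (rule simple_function_Collect[OF simple_F_M[OF simple_G], where P = "\<lambda>g. real (L1 n g) \<le> e * real n"])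
  qed (use e n_pos A in auto)
  then obtain \<omega> where w: "\<omega> \<in> space M" "real (L1 n (GG T \<omega>)) \<le> e * real n"
    and dev: "\<And>a m. a \<in> test_events l J <+> {1..J} \<times> size_tuples l J \<Longrightarrow> m \<le> T \<Longrightarrow> \<bar>\<Sum>i<m. D a i \<omega>\<bar> \<le> e * real n"
    by auto
  interpret p: rule_path l n "\<lambda>i. GG i \<omega>" "\<lambda>i. v (Suc i) \<omega>" by (rule rule_path[OF w(1)])
  have "good_path l n (\<lambda>i. GG i \<omega>) (\<lambda>i. v (Suc i) \<omega>) d T J e"
  proof unfold_locales
    fix P m assume "P \<in> test_events l J" "m \<le> T"
    then show "\<bar>\<Sum>i<m. of_bool (P (GG i \<omega>) (v (Suc i) \<omega>)) - tuple_avg l n (\<lambda>u. of_bool (P (GG i \<omega>) u))\<bar> \<le> e * real n"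
      using dev[of "Inl P" m] by (simp add: D_def InlI)
  next
    fix k c m assume "k \<in> {1..J}" "c \<in> size_tuples l J" "m \<le> T"
    then show "\<bar>\<Sum>i<m. of_bool (\<not> nondistinct (GG i \<omega>) (v (Suc i) \<omega>) \<and> sizes (GG i \<omega>) (v (Suc i) \<omega>) = c) *
         (real (Nk n k (GG (Suc i) \<omega>)) - real (Nk n k (GG i \<omega>)) - d k c)\<bar> \<le> e * real n"
      using dev[of "Inr (k, c)" m] unfolding D_def by (simp add: InrI)
  qed (use w in auto)
  then show ?thesis by blast
qed

end

section \<open>Estimates along a typical path\<close>

lemma prod_list_unit:
  fixes xs :: "real list"
  assumes "\<And>x. x \<in> set xs \<Longrightarrow> 0 \<le> x \<and> x \<le> 1"
  shows "0 \<le> prod_list xs \<and> prod_list xs \<le> 1"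
  using assms by (induction xs) (auto intro: mult_le_one)

lemma prod_list_diff_le:
  fixes f g :: "'b \<Rightarrow> real"
  assumes "\<And>x. x \<in> set xs \<Longrightarrow> 0 \<le> f x \<and> f x \<le> 1" "\<And>x. x \<in> set xs \<Longrightarrow> 0 \<le> g x \<and> g x \<le> 1"
    "\<And>x. x \<in> set xs \<Longrightarrow> \<bar>f x - g x\<bar> \<le> b"
  shows "\<bar>prod_list (map f xs) - prod_list (map g xs)\<bar> \<le> real (length xs) * b"
  using assms
proof (induction xs)
  case (Cons a xs)
  let ?F = "prod_list (map f xs)" and ?H = "prod_list (map g xs)"
  have IH: "\<bar>?F - ?H\<bar> \<le> real (length xs) * b" using Cons by auto
  have F: "0 \<le> ?F" "?F \<le> 1" using prod_list_unit[of "map f xs"] Cons.prems by auto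
  have "f a * ?F - g a * ?H = (f a - g a) * ?F + g a * (?F - ?H)" by (simp add: algebra_simps)
  then have "\<bar>f a * ?F - g a * ?H\<bar> \<le> \<bar>f a - g a\<bar> * \<bar>?F\<bar> + \<bar>g a\<bar> * \<bar>?F - ?H\<bar>"
    by (metis abs_mult abs_triangle_ineq)
  also have "\<dots> \<le> b * 1 + 1 * (real (length xs) * b)"
    using Cons.prems[of a] F IH by (intro add_mono mult_mono) auto
  finally show ?case by (simp add: algebra_simps)
qed simp

lemma interval_sum_dev:
  fixes f :: "nat \<Rightarrow> real"
  assumes "\<And>m. m \<le> T \<Longrightarrow> \<bar>\<Sum>i<m. f i\<bar> \<le> b" "m1 \<le> m2" "m2 \<le> T"
  shows "\<bar>\<Sum>i\<in>{m1..<m2}. f i\<bar> \<le> 2 * b"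
proof -
  have "(\<Sum>i<m2. f i) = (\<Sum>i<m1. f i) + (\<Sum>i\<in>{m1..<m2}. f i)"
    using assms(2) by (simp add: lessThan_atLeast0 sum.atLeastLessThan_concat)
  then show ?thesis using assms(1)[of m1] assms(1)[of m2] assms(2,3) by linarith
qed

context good_path
begin

definition dens :: "nat \<Rightarrow> nat \<Rightarrow> real" where "dens k i = real (Nk n k (G i)) / real n"
definition dens_prod :: "nat list \<Rightarrow> nat \<Rightarrow> real" where "dens_prod c i = prod_list (map (\<lambda>k. dens k i) c)"
text \<open>A bound on the number of steps with a repeated component, divided by \<open>n\<close>:
  the averages contribute at most l^2 e for each of \<open>T\<close> steps, and the deviation adds
  \<open>e\<close>.\<close>

definition nderr :: real where "nderr = real T / real n * (real l)\<^sup>2 * e + e"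

lemma n_real: "real n > 0" using n_pos by simp

lemma dens_bounds: "0 \<le> dens k i" "dens k i \<le> 1"
proof -
  have "Nk n k (G i) \<le> card {..<n}" unfolding Nk_def by (rule card_mono) auto
  then show "0 \<le> dens k i" "dens k i \<le> 1" using n_pos by (auto simp: dens_def)
qed

lemma dens_lipschitz: "m1 \<le> m2 \<Longrightarrow> \<bar>dens k m2 - dens k m1\<bar> \<le> real l * real k * (real (m2 - m1) / real n)"
  using Nk_lipschitz[of m1 m2 k] n_pos
  by (simp add: dens_def diff_divide_distrib[symmetric] field_simps)

lemma dens_lipschitz': "i \<in> {m1..m2} \<Longrightarrow> s \<in> {m1..m2} \<Longrightarrow> \<bar>dens k i - dens k s\<bar> \<le> real l * real k * (real (m2 - m1) / real n)"
proof -
  assume range: "i \<in> {m1..m2}" "s \<in> {m1..m2}"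
  have *: "real l * real k * (real b / real n) \<le> real l * real k * (real (m2 - m1) / real n)" if "b \<le> m2 - m1" for b
    using that by (intro mult_left_mono divide_right_mono) auto
  show ?thesis
  proof (cases "i \<le> s")
    case True
    have "s - i \<le> m2 - m1" using range by auto
    from *[OF this] dens_lipschitz[OF True, of k] show ?thesis unfolding abs_minus_commute[of "dens k i"] by (rule order_trans[rotated])
  next
    case False
    have "i - s \<le> m2 - m1" using range by auto
    from *[OF this] dens_lipschitz[of s i k] False show ?thesis by (meson nat_le_linear order_trans)
  qed
qed

text \<open>The largest component only grows, so its bound at time \<open>T\<close> controls the
  average at every earlier step.\<close>

lemma nondistinct_count: "(\<Sum>i<T. of_bool (nondistinct (G i) (w i))) \<le> nderr * real n"
proof -
  have "\<bar>\<Sum>i<T. of_bool (nondistinct (G i) (w i)) - tuple_avg l n (\<lambda>u. of_bool (nondistinct (G i) u))\<bar> \<le> e * real n"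
    by (rule test_dev) (auto simp: test_events_def)
  then have "(\<Sum>i<T. of_bool (nondistinct (G i) (w i))) \<le> (\<Sum>i<T. tuple_avg l n (\<lambda>u. of_bool (nondistinct (G i) u))) + e * real n"
    by (simp add: sum_subtractf abs_le_iff)
  also have "(\<Sum>i<T. tuple_avg l n (\<lambda>u. of_bool (nondistinct (G i) u))) \<le> (\<Sum>i<T. (real l)\<^sup>2 * e)"
  proof (rule sum_mono)
    fix i assume "i \<in> {..<T}"
    then have "L1 n (G i) \<le> L1 n (G T)" by (intro L1_mono n_pos G_mono G_sub) auto
    then have L: "real (L1 n (G i)) / real n \<le> e" using L1_small n_real by (simp add: field_simps)
    have "tuple_avg l n (\<lambda>u. of_bool (nondistinct (G i) u)) \<le> (real l)\<^sup>2 * real (L1 n (G i)) / real n"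
      by (rule tuple_avg_nondistinct[OF n_pos G_sub])
    also have "\<dots> = (real l)\<^sup>2 * (real (L1 n (G i)) / real n)" by simp
    also have "\<dots> \<le> (real l)\<^sup>2 * e" using L by (intro mult_left_mono) auto
    finally show "tuple_avg l n (\<lambda>u. of_bool (nondistinct (G i) u)) \<le> (real l)\<^sup>2 * e" .
  qed
  also have "(\<Sum>i<T. (real l)\<^sup>2 * e) + e * real n = nderr * real n" using n_real by (simp add: nderr_def field_simps)
  finally show ?thesis by simp
qed

lemma nondistinct_interval:
  assumes "m2 \<le> T" shows "(\<Sum>i\<in>{m1..<m2}. of_bool (nondistinct (G i) (w i))) \<le> nderr * real n"
  by (rule order_trans[OF sum_mono2 nondistinct_count]) (use assms in auto)

lemma test_interval:
  assumes "P \<in> test_events l J" "m1 \<le> m2" "m2 \<le> T"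
  shows "\<bar>(\<Sum>i\<in>{m1..<m2}. of_bool (P (G i) (w i))) - (\<Sum>i\<in>{m1..<m2}. tuple_avg l n (\<lambda>u. of_bool (P (G i) u)))\<bar> \<le> 2 * e * real n"
  using interval_sum_dev[where T = T, OF test_dev[OF assms(1)] assms(2,3)] by (simp add: sum_subtractf)

text \<open>A step lowers the class only if the tuple hits a component of size \<open>k\<close>;
  this happens at rate at most \<open>l\<close> times the density and then costs at most
  \<open>l * k\<close> vertices. The density is frozen at the left end of the interval, with a
  Lipschitz error.\<close>

lemma decay_path:
  assumes k: "k \<le> J" and m: "m1 \<le> m2" "m2 \<le> T"
  defines "h \<equiv> real (m2 - m1) / real n"
  shows "dens k m2 \<ge> dens k m1 - real l * real k * (real l * h * (dens k m1 + real l * real k * h) + 2 * e)"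
proof -
  let ?B = "\<lambda>i. of_bool (\<exists>y\<in>set (w i). csize (G i) y = k) :: real"
  have avg: "(\<Sum>i\<in>{m1..<m2}. tuple_avg l n (\<lambda>u. of_bool (\<exists>y\<in>set u. csize (G i) y = k))) \<le> (\<Sum>i\<in>{m1..<m2}. real l * (dens k m1 + real l * real k * h))"
  proof (rule sum_mono)
    fix i assume i: "i \<in> {m1..<m2}"
    have "tuple_avg l n (\<lambda>u. of_bool (\<exists>y\<in>set u. csize (G i) y = k)) \<le> real l * real (Nk n k (G i)) / real n"
      by (rule tuple_avg_ex_size[OF n_pos])
    also have "\<dots> = real l * dens k i" by (simp add: dens_def)
    also have "\<dots> \<le> real l * (dens k m1 + real l * real k * h)"
      using dens_lipschitz'[of i m1 m2 m1 k] i by (intro mult_left_mono) (auto simp: h_def)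
    finally show "tuple_avg l n (\<lambda>u. of_bool (\<exists>y\<in>set u. csize (G i) y = k)) \<le> real l * (dens k m1 + real l * real k * h)" .
  qed
  have "(\<Sum>i\<in>{m1..<m2}. ?B i) \<le> (\<Sum>i\<in>{m1..<m2}. tuple_avg l n (\<lambda>u. of_bool (\<exists>y\<in>set u. csize (G i) y = k))) + 2 * e * real n"
  proof -
    have "(\<lambda>G u. \<exists>y\<in>set u. csize G y = k) \<in> test_events l J" using k by (auto simp: test_events_def)
    from test_interval[OF this m] show ?thesis by simp
  qed
  also note avg
  also have "(\<Sum>i\<in>{m1..<m2}. real l * (dens k m1 + real l * real k * h)) = real n * (h * (real l * (dens k m1 + real l * real k * h)))"
    using n_real m by (simp add: h_def of_nat_diff)
  also have "\<dots> + 2 * e * real n = real n * (real l * h * (dens k m1 + real l * real k * h) + 2 * e)"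
    by (simp add: algebra_simps)
  finally have B: "(\<Sum>i\<in>{m1..<m2}. ?B i) \<le> real n * (real l * h * (dens k m1 + real l * real k * h) + 2 * e)" by simp
  have "- real (l * k) * (\<Sum>i\<in>{m1..<m2}. ?B i) \<le> real (Nk n k (G m2)) - real (Nk n k (G m1))"
    unfolding Nk_diff_sum[OF m(1)] sum_distrib_left by (intro sum_mono Nk_increment(1))
  moreover have "real (l * k) * (\<Sum>i\<in>{m1..<m2}. ?B i) \<le> real (l * k) * (real n * (real l * h * (dens k m1 + real l * real k * h) + 2 * e))"
    by (intro mult_left_mono B) simp
  ultimately have "real (Nk n k (G m1)) - real n * (real l * real k * (real l * h * (dens k m1 + real l * real k * h) + 2 * e)) \<le> real (Nk n k (G m2))"
    by (simp add: mult_ac)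
  then have "(real (Nk n k (G m1)) - real n * (real l * real k * (real l * h * (dens k m1 + real l * real k * h) + 2 * e))) / real n \<le> dens k m2"
    unfolding dens_def by (intro divide_right_mono) auto
  moreover have "(real (Nk n k (G m1)) - real n * a) / real n = dens k m1 - a" for a
    using n_real by (simp add: dens_def field_simps)
  ultimately show ?thesis by simp
qed

lemma Nless_dens: "real (Nless n K (G i)) / real n = (\<Sum>k\<in>{1..<K}. dens k i)"
  unfolding Nless_eq_sum[OF G_sub] dens_def by (simp add: sum_divide_distrib)

lemma sum_dens_antimono: "m1 \<le> m2 \<Longrightarrow> (\<Sum>k\<in>{1..<K}. dens k m2) \<le> (\<Sum>k\<in>{1..<K}. dens k m1)"
  unfolding Nless_dens[symmetric] using Nless_antimono[of m1 m2 K] by (intro divide_right_mono) auto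

lemma sum_dens_lipschitz: "m1 \<le> m2 \<Longrightarrow> (\<Sum>k\<in>{1..<K}. dens k m1) \<le> (\<Sum>k\<in>{1..<K}. dens k m2) + real l * real K * (real (m2 - m1) / real n)"
proof -
  assume "m1 \<le> m2"
  then have "real (Nless n K (G m1)) \<le> real (Nless n K (G m2) + l * K * (m2 - m1))"
    unfolding of_nat_le_iff by (rule Nless_lipschitz)
  then have "real (Nless n K (G m1)) / real n \<le> (real (Nless n K (G m2)) + real l * real K * real (m2 - m1)) / real n"
    by (intro divide_right_mono) auto
  then show ?thesis unfolding Nless_dens[symmetric] by (simp add: add_divide_distrib)
qed

lemma sum_dens_le_1: "(\<Sum>k\<in>{1..<K}. dens k i) \<le> 1"
proof -
  have "Nless n K (G i) \<le> card {..<n}" unfolding Nless_def by (rule card_mono) auto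
  then show ?thesis unfolding Nless_dens[symmetric] using n_pos by simp
qed

text \<open>The powder keg argument: the mass in components of size at least \<open>K\<close> never
  shrinks, so the potential drops at a rate of at least the l-th power of the initial mass, up to
  steps with repeated components. Since it starts at n/K at most and stays nonnegative, this cannot
  last long.\<close>

lemma keg_path:
  assumes K: "K \<in> {1..J}" and m: "m1 \<le> m2" "m2 \<le> T"
  shows "real (m2 - m1) / real n * (1 - (\<Sum>k\<in>{1..<K}. dens k m1)) ^ l \<le> 1 / real K + nderr + 2 * e"
proof -
  let ?q = "1 - (\<Sum>k\<in>{1..<K}. dens k m1)"
  have "(\<Sum>i\<in>{m1..<m2}. ?q ^ l) \<le> (\<Sum>i\<in>{m1..<m2}. tuple_avg l n (\<lambda>u. of_bool (\<forall>y\<in>set u. K \<le> csize (G i) y)))"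
  proof (rule sum_mono)
    fix i assume i: "i \<in> {m1..<m2}"
    show "?q ^ l \<le> tuple_avg l n (\<lambda>u. of_bool (\<forall>y\<in>set u. K \<le> csize (G i) y))"
      unfolding tuple_avg_all_ge[OF n_pos] Nless_dens
      using sum_dens_antimono[of m1 i K] sum_dens_le_1[where K = K and i = m1] i by (intro power_mono) auto
  qed
  also have "\<dots> \<le> (\<Sum>i\<in>{m1..<m2}. of_bool (\<forall>y\<in>set (w i). K \<le> csize (G i) y)) + 2 * e * real n"
  proof -
    have "(\<lambda>G u. \<forall>y\<in>set u. K \<le> csize G y) \<in> test_events l J" using K by (auto simp: test_events_def)
    from test_interval[OF this m] show ?thesis by linarith
  qed
  also have "(\<Sum>i\<in>{m1..<m2}. of_bool (\<forall>y\<in>set (w i). K \<le> csize (G i) y)) \<le>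
    (\<Sum>i\<in>{m1..<m2}. of_bool (nondistinct (G i) (w i)) - (potential n K (G (Suc i)) - potential n K (G i)))"
  proof (rule sum_mono)
    fix i
    show "of_bool (\<forall>y\<in>set (w i). K \<le> csize (G i) y) \<le> of_bool (nondistinct (G i) (w i)) - (potential n K (G (Suc i)) - potential n K (G i))"
      using potential_step[of K i] K by simp
  qed
  also have "\<dots> = (\<Sum>i\<in>{m1..<m2}. of_bool (nondistinct (G i) (w i))) - (potential n K (G m2) - potential n K (G m1))"
    using sum_Suc_diff'[OF m(1), of "\<lambda>i. potential n K (G i)"] by (simp only: sum_subtractf)
  also have "\<dots> \<le> nderr * real n + real n / real K"
    using nondistinct_interval[OF m(2), of m1] potential_nonneg[of n K "G m2"] potential_le[of K n "G m1"] K by simp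
  finally have "real (m2 - m1) * ?q ^ l \<le> real n * (1 / real K + nderr + 2 * e)"
    by (simp add: algebra_simps)
  then show ?thesis using n_real by (simp add: field_simps)
qed

lemma dens_prod_lipschitz:
  assumes c: "c \<in> size_tuples l K" and range: "i \<in> {m1..m2}" "s \<in> {m1..m2}"
  shows "\<bar>dens_prod c i - dens_prod c s\<bar> \<le> (real l)\<^sup>2 * real K * (real (m2 - m1) / real n)"
proof -
  have "\<bar>dens_prod c i - dens_prod c s\<bar> \<le> real (length c) * (real l * real K * (real (m2 - m1) / real n))"
    unfolding dens_prod_def
  proof (rule prod_list_diff_le)
    fix k assume "k \<in> set c"
    then have "k \<le> K" using c by (auto simp: size_tuples_def)
    have "\<bar>dens k i - dens k s\<bar> \<le> real l * real k * (real (m2 - m1) / real n)" by (rule dens_lipschitz'[OF range])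
    also have "\<dots> \<le> real l * real K * (real (m2 - m1) / real n)"
      using \<open>k \<le> K\<close> by (intro mult_right_mono mult_left_mono) auto
    finally show "\<bar>dens k i - dens k s\<bar> \<le> real l * real K * (real (m2 - m1) / real n)" .
  qed (use dens_bounds in auto)
  then show ?thesis using c by (simp add: size_tuples_def power2_eq_square mult.assoc)
qed

definition cnt :: "nat list \<Rightarrow> nat \<Rightarrow> nat \<Rightarrow> real" where
  "cnt c m1 m2 = (\<Sum>i\<in>{m1..<m2}. of_bool (sizes (G i) (w i) = c))"
text \<open>Only draws from distinct components count here, because the drift is prescribed for
  these alone.\<close>

definition dcnt :: "nat list \<Rightarrow> nat \<Rightarrow> nat \<Rightarrow> real" where
  "dcnt c m1 m2 = (\<Sum>i\<in>{m1..<m2}. of_bool (\<not> nondistinct (G i) (w i) \<and> sizes (G i) (w i) = c))"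

definition elapsed :: "nat \<Rightarrow> nat \<Rightarrow> real" where "elapsed m1 m2 = real (m2 - m1) / real n"
definition incr :: "nat \<Rightarrow> nat \<Rightarrow> real" where "incr k i = real (Nk n k (G (Suc i))) - real (Nk n k (G i))"
definition incr_sum :: "nat \<Rightarrow> nat list \<Rightarrow> nat \<Rightarrow> nat \<Rightarrow> real" where
  "incr_sum k c m1 m2 = (\<Sum>i\<in>{m1..<m2}. of_bool (\<not> nondistinct (G i) (w i) \<and> sizes (G i) (w i) = c) * incr k i)"

section \<open>Frequencies of size tuples over a time interval, compared with a reference time in
  it\<close>

context
  fixes K m1 m2 s :: nat
  assumes K: "K \<le> J" and m: "m1 \<le> m2" "m2 \<le> T" and s: "s \<in> {m1..m2}"
begin

text \<open>The count follows its average, and the average is frozen at the reference time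
  \<open>s\<close>. As \<open>s\<close> may be any point of the interval, the estimate later serves
  left and right derivatives alike.\<close>

lemma cnt_approx:
  assumes c: "c \<in> size_tuples l K"
  shows "\<bar>cnt c m1 m2 / real n - elapsed m1 m2 * dens_prod c s\<bar> \<le> 2 * e + (real l)\<^sup>2 * real K * (elapsed m1 m2)\<^sup>2"
proof -
  have c': "c \<in> size_tuples l J" using c K unfolding size_tuples_def by fastforce
  have avg: "tuple_avg l n (\<lambda>u. of_bool (sizes (G i) u = c)) = dens_prod c i" for i
    using tuple_avg_sizes[OF n_pos, of c l "G i"] c by (simp add: size_tuples_def dens_prod_def dens_def)
  have "(\<lambda>G u. sizes G u = c) \<in> test_events l J" using c' by (auto simp: test_events_def)
  from test_interval[OF this m] have 1: "\<bar>cnt c m1 m2 - (\<Sum>i\<in>{m1..<m2}. dens_prod c i)\<bar> \<le> 2 * e * real n"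
    by (simp add: cnt_def avg)
  have "\<bar>(\<Sum>i\<in>{m1..<m2}. dens_prod c i - dens_prod c s)\<bar> \<le> (\<Sum>i\<in>{m1..<m2}. (real l)\<^sup>2 * real K * elapsed m1 m2)"
    by (rule order_trans[OF sum_abs sum_mono]) (use dens_prod_lipschitz[OF c _ s] in \<open>auto simp: elapsed_def\<close>)
  then have 2: "\<bar>(\<Sum>i\<in>{m1..<m2}. dens_prod c i) - real (m2 - m1) * dens_prod c s\<bar> \<le> real (m2 - m1) * ((real l)\<^sup>2 * real K * elapsed m1 m2)"
    by (simp add: sum_subtractf)
  have "\<bar>cnt c m1 m2 - real (m2 - m1) * dens_prod c s\<bar> \<le> 2 * e * real n + real (m2 - m1) * ((real l)\<^sup>2 * real K * elapsed m1 m2)"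
    using 1 2 by linarith
  then have "\<bar>cnt c m1 m2 - real (m2 - m1) * dens_prod c s\<bar> / real n \<le> (2 * e * real n + real (m2 - m1) * ((real l)\<^sup>2 * real K * elapsed m1 m2)) / real n"
    by (intro divide_right_mono) auto
  moreover have "\<bar>cnt c m1 m2 - real (m2 - m1) * dens_prod c s\<bar> / real n = \<bar>cnt c m1 m2 / real n - elapsed m1 m2 * dens_prod c s\<bar>"
    using abs_divide[of "cnt c m1 m2 - real (m2 - m1) * dens_prod c s" "real n"] by (simp add: elapsed_def diff_divide_distrib)
  moreover have "(2 * e * real n + real (m2 - m1) * ((real l)\<^sup>2 * real K * elapsed m1 m2)) / real n = 2 * e + (real l)\<^sup>2 * real K * (elapsed m1 m2)\<^sup>2"
    using n_real by (simp add: elapsed_def field_simps power2_eq_square)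
  ultimately show ?thesis by simp
qed

lemma dcnt_cnt: "dcnt c m1 m2 \<le> cnt c m1 m2" "cnt c m1 m2 \<le> dcnt c m1 m2 + nderr * real n"
proof -
  show "dcnt c m1 m2 \<le> cnt c m1 m2" unfolding cnt_def dcnt_def by (rule sum_mono) auto
  have "cnt c m1 m2 \<le> (\<Sum>i\<in>{m1..<m2}. of_bool (\<not> nondistinct (G i) (w i) \<and> sizes (G i) (w i) = c) + of_bool (nondistinct (G i) (w i)))"
    unfolding cnt_def by (rule sum_mono) auto
  also have "\<dots> = dcnt c m1 m2 + (\<Sum>i\<in>{m1..<m2}. of_bool (nondistinct (G i) (w i)))"
    by (simp only: sum.distrib dcnt_def)
  finally show "cnt c m1 m2 \<le> dcnt c m1 m2 + nderr * real n" using nondistinct_interval[OF m(2), of m1] by linarith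
qed

lemma dcnt_approx:
  assumes c: "c \<in> size_tuples l K"
  shows "\<bar>dcnt c m1 m2 / real n - elapsed m1 m2 * dens_prod c s\<bar> \<le> 2 * e + (real l)\<^sup>2 * real K * (elapsed m1 m2)\<^sup>2 + nderr"
proof -
  have "\<bar>dcnt c m1 m2 - cnt c m1 m2\<bar> \<le> nderr * real n" using dcnt_cnt[of c] by simp
  then have "\<bar>dcnt c m1 m2 / real n - cnt c m1 m2 / real n\<bar> \<le> nderr"
    using n_real by (simp add: diff_divide_distrib[symmetric] field_simps)
  then show ?thesis using cnt_approx[OF c] by linarith
qed

lemma incr_sum_approx:
  assumes c: "c \<in> size_tuples l K" and k: "k \<in> {1..J}"
  shows "\<bar>incr_sum k c m1 m2 - d k c * dcnt c m1 m2\<bar> \<le> 2 * e * real n"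
proof -
  have c': "c \<in> size_tuples l J" using c K unfolding size_tuples_def by fastforce
  have "\<bar>\<Sum>i\<in>{m1..<m2}. of_bool (\<not> nondistinct (G i) (w i) \<and> sizes (G i) (w i) = c) *
         (real (Nk n k (G (Suc i))) - real (Nk n k (G i)) - d k c)\<bar> \<le> 2 * (e * real n)"
    by (rule interval_sum_dev[where T = T, OF drift_dev[OF k c'] m])
  moreover have "(\<Sum>i\<in>{m1..<m2}. of_bool (\<not> nondistinct (G i) (w i) \<and> sizes (G i) (w i) = c) *
         (real (Nk n k (G (Suc i))) - real (Nk n k (G i)) - d k c)) = incr_sum k c m1 m2 - d k c * dcnt c m1 m2"
    unfolding incr_sum_def dcnt_def incr_def sum_distrib_left sum_subtractf[symmetric] by (intro sum.cong) (auto simp: algebra_simps)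
  ultimately show ?thesis by simp
qed

lemma abs_incr_le: "\<bar>incr k i\<bar> \<le> real l * real k"
  using Nk_increment(2)[of k i] by (simp add: incr_def)

text \<open>A step moves at most \<open>l * k\<close> vertices, so a drift beyond this can be
  matched by the actual increments only if tuples with sizes \<open>c\<close> are rare.\<close>

lemma abs_drift_path:
  assumes c: "c \<in> size_tuples l K" and k: "k \<in> {1..J}" and big: "real l * real k \<le> \<bar>d k c\<bar>"
  shows "(\<bar>d k c\<bar> - real l * real k) * (elapsed m1 m2 * dens_prod c s - (2 * e + (real l)\<^sup>2 * real K * (elapsed m1 m2)\<^sup>2 + nderr)) \<le> 2 * e"
proof -
  have d0: "0 \<le> dcnt c m1 m2" unfolding dcnt_def by (intro sum_nonneg) auto
  have "\<bar>incr_sum k c m1 m2\<bar> \<le> (\<Sum>i\<in>{m1..<m2}. real l * real k * of_bool (\<not> nondistinct (G i) (w i) \<and> sizes (G i) (w i) = c))"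
    unfolding incr_sum_def by (rule order_trans[OF sum_abs sum_mono]) (use abs_incr_le[of k] in \<open>auto simp: abs_mult\<close>)
  also have "\<dots> = real l * real k * dcnt c m1 m2" by (simp only: dcnt_def sum_distrib_left)
  finally have "\<bar>incr_sum k c m1 m2\<bar> \<le> real l * real k * dcnt c m1 m2" .
  then have "\<bar>d k c * dcnt c m1 m2\<bar> \<le> real l * real k * dcnt c m1 m2 + 2 * e * real n"
    using incr_sum_approx[OF c k] by linarith
  then have "(\<bar>d k c\<bar> - real l * real k) * dcnt c m1 m2 \<le> 2 * e * real n"
    using d0 by (simp add: abs_mult algebra_simps)
  then have "((\<bar>d k c\<bar> - real l * real k) * dcnt c m1 m2) / real n \<le> 2 * e"
    using n_real by (simp add: field_simps)
  then have "(\<bar>d k c\<bar> - real l * real k) * (dcnt c m1 m2 / real n) \<le> 2 * e" by simp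
  moreover have "(\<bar>d k c\<bar> - real l * real k) * (elapsed m1 m2 * dens_prod c s - (2 * e + (real l)\<^sup>2 * real K * (elapsed m1 m2)\<^sup>2 + nderr)) \<le> (\<bar>d k c\<bar> - real l * real k) * (dcnt c m1 m2 / real n)"
    using big dcnt_approx[OF c] by (intro mult_left_mono) auto
  ultimately show ?thesis by linarith
qed

text \<open>The increments are sorted by size tuple. Those in \<open>S\<close> follow the prescribed
  drift; the others, with repeated components or a size above \<open>K\<close>, are bounded by
  \<open>l * k\<close> each. In the error, 1 minus the sum of products is the share of tuples with a
  size above \<open>K\<close>.\<close>

lemma drift_path:
  assumes k: "k \<in> {1..J}"
  defines "S \<equiv> size_tuples l K"
  shows "\<bar>dens k m2 - dens k m1 - elapsed m1 m2 * (\<Sum>c\<in>S. d k c * dens_prod c s)\<bar> \<le>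
     (\<Sum>c\<in>S. 2 * e + \<bar>d k c\<bar> * (2 * e + (real l)\<^sup>2 * real K * (elapsed m1 m2)\<^sup>2 + nderr)) +
     real l * real k * (nderr + (elapsed m1 m2 * (1 - (\<Sum>c\<in>S. dens_prod c s)) + real (card S) * (2 * e + (real l)\<^sup>2 * real K * (elapsed m1 m2)\<^sup>2)))"
proof -
  have fS: "finite S" by (simp add: S_def)
  define r where "r = 2 * e + (real l)\<^sup>2 * real K * (elapsed m1 m2)\<^sup>2"
  define Y where "Y i = of_bool (nondistinct (G i) (w i) \<or> sizes (G i) (w i) \<notin> S) * incr k i" for i
  have split: "incr k i = (\<Sum>c\<in>S. of_bool (\<not> nondistinct (G i) (w i) \<and> sizes (G i) (w i) = c) * incr k i) + Y i" for i
  proof -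
    have "(\<Sum>c\<in>S. of_bool (\<not> nondistinct (G i) (w i) \<and> sizes (G i) (w i) = c) * incr k i) =
      (\<Sum>c\<in>S. if c = sizes (G i) (w i) then of_bool (\<not> nondistinct (G i) (w i)) * incr k i else 0)"
      by (intro sum.cong) auto
    also have "\<dots> = (if sizes (G i) (w i) \<in> S then of_bool (\<not> nondistinct (G i) (w i)) * incr k i else 0)"
      using fS by (simp add: sum.delta)
    finally show ?thesis by (auto simp: Y_def)
  qed
  have "real (Nk n k (G m2)) - real (Nk n k (G m1)) = (\<Sum>i\<in>{m1..<m2}. incr k i)"
    unfolding incr_def by (rule Nk_diff_sum[OF m(1)])
  also have "\<dots> = (\<Sum>i\<in>{m1..<m2}. (\<Sum>c\<in>S. of_bool (\<not> nondistinct (G i) (w i) \<and> sizes (G i) (w i) = c) * incr k i) + Y i)"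
    by (rule sum.cong[OF refl split])
  also have "\<dots> = (\<Sum>c\<in>S. incr_sum k c m1 m2) + (\<Sum>i\<in>{m1..<m2}. Y i)"
    unfolding sum.distrib incr_sum_def by (subst sum.swap) simp
  finally have tot: "dens k m2 - dens k m1 = ((\<Sum>c\<in>S. incr_sum k c m1 m2) + (\<Sum>i\<in>{m1..<m2}. Y i)) / real n"
    by (simp add: dens_def diff_divide_distrib[symmetric])
  have one: "\<bar>incr_sum k c m1 m2 / real n - elapsed m1 m2 * (d k c * dens_prod c s)\<bar> \<le> 2 * e + \<bar>d k c\<bar> * (r + nderr)" if c: "c \<in> S" for c
  proof -
    have "\<bar>incr_sum k c m1 m2 - d k c * dcnt c m1 m2\<bar> / real n \<le> 2 * e"
      using incr_sum_approx[OF c[unfolded S_def] k] n_real by (simp add: field_simps)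
    then have 1: "\<bar>incr_sum k c m1 m2 / real n - d k c * (dcnt c m1 m2 / real n)\<bar> \<le> 2 * e"
      using abs_divide[of "incr_sum k c m1 m2 - d k c * dcnt c m1 m2" "real n"] by (simp add: diff_divide_distrib)
    have "d k c * (dcnt c m1 m2 / real n) - elapsed m1 m2 * (d k c * dens_prod c s) = d k c * (dcnt c m1 m2 / real n - elapsed m1 m2 * dens_prod c s)"
      by (simp add: algebra_simps)
    then have "\<bar>d k c * (dcnt c m1 m2 / real n) - elapsed m1 m2 * (d k c * dens_prod c s)\<bar> = \<bar>d k c\<bar> * \<bar>dcnt c m1 m2 / real n - elapsed m1 m2 * dens_prod c s\<bar>"
      by (simp only: abs_mult)
    also have "\<dots> \<le> \<bar>d k c\<bar> * (r + nderr)"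
      using dcnt_approx[OF c[unfolded S_def]] by (intro mult_left_mono) (auto simp: r_def)
    finally show ?thesis using 1 by linarith
  qed
  have A: "\<bar>(\<Sum>c\<in>S. incr_sum k c m1 m2) / real n - elapsed m1 m2 * (\<Sum>c\<in>S. d k c * dens_prod c s)\<bar> \<le> (\<Sum>c\<in>S. 2 * e + \<bar>d k c\<bar> * (r + nderr))"
    unfolding sum_divide_distrib sum_distrib_left sum_subtractf[symmetric]
    by (rule order_trans[OF sum_abs sum_mono]) (rule one)
  \<comment> \<open>Tuples outside \<open>S\<close> are counted as all steps minus those in
    \<open>S\<close>, so lower bounds for finitely many frequencies suffice.\<close>
  have out: "(\<Sum>i\<in>{m1..<m2}. of_bool (sizes (G i) (w i) \<notin> S)) = real (m2 - m1) - (\<Sum>c\<in>S. cnt c m1 m2)"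
  proof -
    have "(\<Sum>c\<in>S. of_bool (sizes (G i) (w i) = c)) = (of_bool (sizes (G i) (w i) \<in> S) :: real)" for i
    proof -
      have "(\<Sum>c\<in>S. of_bool (sizes (G i) (w i) = c)) = (\<Sum>c\<in>S. if c = sizes (G i) (w i) then 1 else 0 :: real)"
        by (intro sum.cong) auto
      then show ?thesis using fS by (simp add: sum.delta)
    qed
    then have "(\<Sum>c\<in>S. cnt c m1 m2) = (\<Sum>i\<in>{m1..<m2}. of_bool (sizes (G i) (w i) \<in> S))"
      unfolding cnt_def by (subst sum.swap) simp
    moreover have "(\<Sum>i\<in>{m1..<m2}. of_bool (sizes (G i) (w i) \<notin> S)) = (\<Sum>i\<in>{m1..<m2}. 1 - of_bool (sizes (G i) (w i) \<in> S) :: real)"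
      by (intro sum.cong) auto
    ultimately show ?thesis by (simp only: sum_subtractf) simp
  qed
  have "\<bar>\<Sum>i\<in>{m1..<m2}. Y i\<bar> \<le> (\<Sum>i\<in>{m1..<m2}. real l * real k * (of_bool (nondistinct (G i) (w i)) + of_bool (sizes (G i) (w i) \<notin> S)))"
  proof (rule order_trans[OF sum_abs sum_mono])
    fix i
    show "\<bar>Y i\<bar> \<le> real l * real k * (of_bool (nondistinct (G i) (w i)) + of_bool (sizes (G i) (w i) \<notin> S))"
      using abs_incr_le[of k i] by (cases "nondistinct (G i) (w i)"; cases "sizes (G i) (w i) \<in> S") (simp_all add: Y_def)
  qed
  also have "\<dots> = real l * real k * ((\<Sum>i\<in>{m1..<m2}. of_bool (nondistinct (G i) (w i))) + (real (m2 - m1) - (\<Sum>c\<in>S. cnt c m1 m2)))"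
    by (simp only: sum_distrib_left[symmetric] sum.distrib out)
  also have "\<dots> \<le> real l * real k * (nderr * real n + (real (m2 - m1) - (\<Sum>c\<in>S. cnt c m1 m2)))"
    by (intro mult_left_mono add_right_mono nondistinct_interval m) auto
  finally have "\<bar>\<Sum>i\<in>{m1..<m2}. Y i\<bar> / real n \<le> real l * real k * (nderr * real n + (real (m2 - m1) - (\<Sum>c\<in>S. cnt c m1 m2))) / real n"
    by (intro divide_right_mono) auto
  also have "\<dots> = real l * real k * (nderr + (elapsed m1 m2 - (\<Sum>c\<in>S. cnt c m1 m2 / real n)))"
    using n_real by (simp add: elapsed_def sum_divide_distrib[symmetric] field_simps)
  also have "\<dots> \<le> real l * real k * (nderr + (elapsed m1 m2 * (1 - (\<Sum>c\<in>S. dens_prod c s)) + real (card S) * r))"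
  proof -
    have "(\<Sum>c\<in>S. elapsed m1 m2 * dens_prod c s - r) \<le> (\<Sum>c\<in>S. cnt c m1 m2 / real n)"
    proof (rule sum_mono)
      fix c assume "c \<in> S"
      then show "elapsed m1 m2 * dens_prod c s - r \<le> cnt c m1 m2 / real n"
        using cnt_approx[of c] by (simp add: S_def r_def abs_le_iff)
    qed
    then have "elapsed m1 m2 - (\<Sum>c\<in>S. cnt c m1 m2 / real n) \<le> elapsed m1 m2 * (1 - (\<Sum>c\<in>S. dens_prod c s)) + real (card S) * r"
      by (simp add: sum_subtractf sum_distrib_left[symmetric] algebra_simps)
    then show ?thesis by (intro mult_left_mono add_left_mono) auto
  qed
  finally have B: "\<bar>(\<Sum>i\<in>{m1..<m2}. Y i) / real n\<bar> \<le> real l * real k * (nderr + (elapsed m1 m2 * (1 - (\<Sum>c\<in>S. dens_prod c s)) + real (card S) * r))"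
    by simp
  show ?thesis using A B unfolding tot add_divide_distrib r_def[symmetric] by linarith
qed

end

end

section \<open>Limit systems\<close>

text \<open>Euler's scheme: each of N steps of length h multiplies the value by 1 - c h, up to an
  error r h^2. The product of the factors tends to the exponential, and the errors sum to at most r
  (b - a)^2 / N.\<close>

lemma exp_decay_lower_bound:
  fixes g :: "real \<Rightarrow> real"
  assumes ab: "a \<le> b" and c: "0 \<le> c" and r: "0 \<le> r"
    and step: "\<And>s t. a \<le> s \<Longrightarrow> s \<le> t \<Longrightarrow> t \<le> b \<Longrightarrow> g t \<ge> g s - c * (t - s) * g s - r * (t - s)\<^sup>2"
  shows "g a * exp (- (c * (b - a))) \<le> g b"
proof -
  let ?L = "b - a"
  have ev: "eventually (\<lambda>N. g a * (1 + (- (c * ?L)) / real N) ^ N - r * ?L\<^sup>2 / real N \<le> g b) sequentially"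
  proof -
    \<comment> \<open>From \<open>N0\<close> on the factor 1 - c h is nonnegative, so the induction
      hypothesis may be multiplied by it.\<close>
    obtain N0 :: nat where N0: "c * ?L < real N0" using reals_Archimedean2 by blast
    show ?thesis
    proof (rule eventually_sequentiallyI[of "max 1 N0"])
      fix N assume N: "max 1 N0 \<le> N"
      then have Np: "real N > 0" by simp
      define h where "h = ?L / real N"
      have h0: "0 \<le> h" using ab by (simp add: h_def)
      have "c * ?L \<le> real N" using N N0 by linarith
      then have ch: "0 \<le> 1 - c * h" using Np by (simp add: h_def field_simps)
      have ch1: "1 - c * h \<le> 1" using c h0 by simp
      have "g (a + real i * h) \<ge> g a * (1 - c * h) ^ i - real i * (r * h\<^sup>2)" if "i \<le> N" for i
        using that
      proof (induction i)
        case (Suc i)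
        have le: "a + real (Suc i) * h \<le> b"
        proof -
          have "real (Suc i) * h \<le> real N * h" using Suc.prems h0 by (intro mult_right_mono) auto
          also have "\<dots> = ?L" using Np by (simp add: h_def)
          finally show ?thesis by simp
        qed
        have "g (a + real (Suc i) * h) \<ge> g (a + real i * h) - c * h * g (a + real i * h) - r * h\<^sup>2"
          using step[of "a + real i * h" "a + real (Suc i) * h"] le h0 by (simp add: algebra_simps)
        also have "g (a + real i * h) - c * h * g (a + real i * h) - r * h\<^sup>2 = (1 - c * h) * g (a + real i * h) - r * h\<^sup>2"
          by (simp add: algebra_simps)
        finally have 1: "(1 - c * h) * g (a + real i * h) - r * h\<^sup>2 \<le> g (a + real (Suc i) * h)" .
        have "(1 - c * h) * (g a * (1 - c * h) ^ i - real i * (r * h\<^sup>2)) \<le> (1 - c * h) * g (a + real i * h)"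
          using Suc ch by (intro mult_left_mono) auto
        moreover have "(1 - c * h) * (real i * (r * h\<^sup>2)) \<le> 1 * (real i * (r * h\<^sup>2))"
          using ch1 r by (intro mult_right_mono) auto
        ultimately have "g a * (1 - c * h) ^ Suc i - real i * (r * h\<^sup>2) - r * h\<^sup>2 \<le> g (a + real (Suc i) * h)"
          using 1 by (simp add: algebra_simps)
        then show ?case by (simp add: algebra_simps)
      qed simp
      from this[of N] have "g a * (1 - c * h) ^ N - real N * (r * h\<^sup>2) \<le> g (a + real N * h)" by simp
      moreover have "a + real N * h = b" using Np by (simp add: h_def)
      moreover have "1 - c * h = 1 + (- (c * ?L)) / real N" by (simp add: h_def)
      moreover have "real N * (r * h\<^sup>2) = r * ?L\<^sup>2 / real N" using Np by (simp add: h_def power2_eq_square field_simps)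
      ultimately show "g a * (1 + (- (c * ?L)) / real N) ^ N - r * ?L\<^sup>2 / real N \<le> g b" by simp
    qed
  qed
  have "(\<lambda>N. g a * (1 + (- (c * ?L)) / real N) ^ N - r * ?L\<^sup>2 / real N) \<longlonglongrightarrow> g a * exp (- (c * ?L)) - 0"
    by (intro tendsto_diff tendsto_mult tendsto_const tendsto_exp_limit_sequentially lim_const_over_n)
  from tendsto_upperbound[OF this ev] show ?thesis by simp
qed

lemma size_tuples_Suc: "size_tuples (Suc l) K = (\<lambda>(k, c). k # c) ` ({1..K} \<times> size_tuples l K)"
  unfolding size_tuples_def by (auto simp: image_iff length_Suc_conv)

text \<open>Expansion of a power of a sum. It reduces the total of all products to the mass up to
  \<open>K\<close>.\<close>

lemma sum_size_tuples_prod: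
  fixes f :: "nat \<Rightarrow> real"
  shows "(\<Sum>c\<in>size_tuples l K. prod_list (map f c)) = (\<Sum>k\<in>{1..K}. f k) ^ l"
proof (induction l)
  case 0
  have "size_tuples 0 K = {[]}" by (auto simp: size_tuples_def)
  then show ?case by simp
next
  case (Suc l)
  have "(\<Sum>c\<in>size_tuples (Suc l) K. prod_list (map f c)) = (\<Sum>(k, c)\<in>{1..K} \<times> size_tuples l K. f k * prod_list (map f c))"
    unfolding size_tuples_Suc by (subst sum.reindex) (auto simp: inj_on_def intro!: sum.cong)
  also have "\<dots> = (\<Sum>k\<in>{1..K}. f k) * (\<Sum>c\<in>size_tuples l K. prod_list (map f c))"
    by (simp only: sum.cartesian_product[symmetric] sum_product)
  finally show ?case by (simp add: Suc)
qed

text \<open>The limits of the path estimates, kept as finite difference inequalities;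
  differentiability is a conclusion. The reference time \<open>s\<close> in \<open>drift\<close> and
  \<open>drift_bound\<close> ranges over the whole interval.\<close>

locale limit_system =
  fixes l :: nat and d :: "nat \<Rightarrow> nat list \<Rightarrow> real" and \<rho> :: "nat \<Rightarrow> real \<Rightarrow> real" and ts :: real
  assumes l_pos: "l > 0" and ts_pos: "0 < ts"
    and rho_nonneg: "t \<in> {0..ts} \<Longrightarrow> 0 \<le> \<rho> k t"
    and rho_init: "\<rho> 1 0 = 1" "k \<ge> 2 \<Longrightarrow> \<rho> k 0 = 0"
    and R_le_1: "t \<in> {0..ts} \<Longrightarrow> (\<Sum>k\<in>{1..<K}. \<rho> k t) \<le> 1"
    and R_antimono: "0 \<le> t1 \<Longrightarrow> t1 \<le> t2 \<Longrightarrow> t2 \<le> ts \<Longrightarrow> (\<Sum>k\<in>{1..<K}. \<rho> k t2) \<le> (\<Sum>k\<in>{1..<K}. \<rho> k t1)"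
    and R_lipschitz: "0 \<le> t1 \<Longrightarrow> t1 \<le> t2 \<Longrightarrow> t2 \<le> ts \<Longrightarrow>
      (\<Sum>k\<in>{1..<K}. \<rho> k t1) \<le> (\<Sum>k\<in>{1..<K}. \<rho> k t2) + real l * real K * (t2 - t1)"
    and decay: "0 \<le> t1 \<Longrightarrow> t1 \<le> t2 \<Longrightarrow> t2 \<le> ts \<Longrightarrow>
      \<rho> k t1 - real l * real k * (real l * (t2 - t1) * (\<rho> k t1 + real l * real k * (t2 - t1))) \<le> \<rho> k t2"
    and keg: "K \<ge> 1 \<Longrightarrow> 0 \<le> t1 \<Longrightarrow> t1 \<le> t2 \<Longrightarrow> t2 \<le> ts \<Longrightarrow>
      (t2 - t1) * (1 - (\<Sum>k\<in>{1..<K}. \<rho> k t1)) ^ l \<le> 1 / real K"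
    and drift: "k \<ge> 1 \<Longrightarrow> 0 \<le> t1 \<Longrightarrow> t1 \<le> s \<Longrightarrow> s \<le> t2 \<Longrightarrow> t2 \<le> ts \<Longrightarrow>
      \<bar>\<rho> k t2 - \<rho> k t1 - (t2 - t1) * (\<Sum>c\<in>size_tuples l K. d k c * prod_list (map (\<lambda>j. \<rho> j s) c))\<bar> \<le>
      (\<Sum>c\<in>size_tuples l K. \<bar>d k c\<bar> * ((real l)\<^sup>2 * real K * (t2 - t1)\<^sup>2)) +
      real l * real k * ((t2 - t1) * (1 - (\<Sum>c\<in>size_tuples l K. prod_list (map (\<lambda>j. \<rho> j s) c))) +
         real (card (size_tuples l K)) * ((real l)\<^sup>2 * real K * (t2 - t1)\<^sup>2))"
    and drift_bound: "k \<ge> 1 \<Longrightarrow> c \<in> size_tuples l K \<Longrightarrow> real l * real k \<le> \<bar>d k c\<bar> \<Longrightarrow>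
      0 \<le> t1 \<Longrightarrow> t1 \<le> s \<Longrightarrow> s \<le> t2 \<Longrightarrow> t2 \<le> ts \<Longrightarrow>
      (\<bar>d k c\<bar> - real l * real k) * ((t2 - t1) * prod_list (map (\<lambda>j. \<rho> j s) c) - (real l)\<^sup>2 * real K * (t2 - t1)\<^sup>2) \<le> 0"
begin

text \<open>Expanded, \<open>decay\<close> is one Euler step with rate l^2 k and a quadratic
  error.\<close>

lemma decay_exp:
  assumes "0 \<le> t1" "t1 \<le> t2" "t2 \<le> ts"
  shows "\<rho> k t1 * exp (- ((real l)\<^sup>2 * real k * (t2 - t1))) \<le> \<rho> k t2"
proof (rule exp_decay_lower_bound[where r = "(real l) ^ 3 * (real k)\<^sup>2"])
  fix s t assume st: "t1 \<le> s" "s \<le> t" "t \<le> t2"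
  have "real l * real k * (real l * (t - s) * (\<rho> k s + real l * real k * (t - s))) =
     (real l)\<^sup>2 * real k * (t - s) * \<rho> k s + (real l) ^ 3 * (real k)\<^sup>2 * (t - s)\<^sup>2"
    by (simp add: power2_eq_square power3_eq_cube algebra_simps)
  then show "\<rho> k t \<ge> \<rho> k s - (real l)\<^sup>2 * real k * (t - s) * \<rho> k s - (real l) ^ 3 * (real k)\<^sup>2 * (t - s)\<^sup>2"
    using decay[of s t k] st assms by simp
qed (use assms in auto)

lemma sum_rho_Suc: "(\<Sum>k<K. \<rho> (Suc k) t) = (\<Sum>k\<in>{1..<Suc K}. \<rho> k t)"
  using sum.shift_bounds_Suc_ivl[of "\<lambda>k. \<rho> k t" 0 K] by (simp add: lessThan_atLeast0)

lemma summable_rho: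
  assumes "t \<in> {0..ts}" shows "summable (\<lambda>k. \<rho> (Suc k) t)"
proof (rule bounded_imp_summable[where B = 1])
  fix K
  show "(\<Sum>k\<le>K. \<rho> (Suc k) t) \<le> 1"
    unfolding lessThan_Suc_atMost[symmetric] sum_rho_Suc by (rule R_le_1[OF assms])
qed (rule rho_nonneg[OF assms])

lemma suminf_rho_le_1: "t \<in> {0..ts} \<Longrightarrow> (\<Sum>k. \<rho> (Suc k) t) \<le> 1"
  by (rule suminf_le_const[OF summable_rho]) (simp_all only: sum_rho_Suc R_le_1)

lemma R_le_suminf:
  assumes "t \<in> {0..ts}" shows "(\<Sum>k\<in>{1..<K}. \<rho> k t) \<le> (\<Sum>k. \<rho> (Suc k) t)"
proof (cases K)
  case 0
  then show ?thesis using suminf_nonneg[OF summable_rho[OF assms]] rho_nonneg[OF assms] by simp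
next
  case (Suc K')
  then show ?thesis
    using sum_le_suminf[OF summable_rho[OF assms], of "{..<K'}"] rho_nonneg[OF assms] by (simp add: sum_rho_Suc)
qed

text \<open>If mass were missing at the final time, then for every large $K$ a definite mass would sit, shortly
  before, in components of size between $K/B$ and $K$, and part of it would survive until the end;
  these size ranges are disjoint for infinitely many $K$, so the total mass would be infinite.\<close>

lemma suminf_rho_eq_1: "(\<Sum>k. \<rho> (Suc k) ts) = 1"
proof (rule ccontr)
  have ts: "ts \<in> {0..ts}" using ts_pos by simp
  define \<delta> where "\<delta> = 1 - (\<Sum>k. \<rho> (Suc k) ts)"
  assume "(\<Sum>k. \<rho> (Suc k) ts) \<noteq> 1"
  then have \<delta>: "\<delta> > 0" using suminf_rho_le_1[OF ts] by (simp add: \<delta>_def)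
  \<comment> \<open>With this value, a duration of A/K forces, by \<open>keg\<close>, the mass in
    sizes at least \<open>K\<close> at its start to be at most \<delta>/2.\<close>
  define A where "A = (2 / \<delta>) ^ l"
  have A: "A > 0" using \<delta> by (simp add: A_def)
  \<comment> \<open>During time A/K a mass of at most l K' A / K = l A / B can leave the sizes below
    K' = K/B; this choice makes it at most \<delta>/4.\<close>
  obtain B :: nat where B: "4 * real l * A / \<delta> < real B" using reals_Archimedean2 by blast
  have B0: "real B > 0" using B A \<delta> by (smt (verit) divide_nonneg_pos mult_nonneg_nonneg of_nat_0_le_iff)
  \<comment> \<open>The survival factor for sizes below \<open>K\<close> over time A/K, times the
    mass \<delta>/4 found between K/B and K.\<close>
  define \<beta> where "\<beta> = exp (- ((real l)\<^sup>2 * A)) * (\<delta> / 4)"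
  have \<beta>: "\<beta> > 0" using \<delta> by (simp add: \<beta>_def)
  \<comment> \<open>Beyond \<open>K0\<close> the starting time ts - A/K is nonnegative.\<close>
  obtain K0 :: nat where K0: "A / ts < real K0" using reals_Archimedean2 by blast
  have range_mass: "\<beta> \<le> (\<Sum>k\<in>{K'..<B * K'}. \<rho> k ts)" if K': "1 \<le> K'" "K0 \<le> K'" for K'
  proof -
    define K where "K = B * K'"
    have K1: "1 \<le> K" using B0 K' by (auto simp: K_def Suc_le_eq)
    have BK: "K' \<le> K" using B0 by (simp add: K_def)
    define s where "s = ts - A / real K"
    have Kp: "real K > 0" using K1 by simp
    have "A / ts < real K" using K0 K'(2) BK by linarith
    then have "A / real K < ts" using Kp ts_pos by (simp add: field_simps)
    then have s: "0 \<le> s" "s \<le> ts" using A Kp by (auto simp: s_def)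
    then have s': "s \<in> {0..ts}" by simp
    have "A / real K * (1 - (\<Sum>k\<in>{1..<K}. \<rho> k s)) ^ l \<le> 1 / real K"
      using keg[OF K1 s order_refl] by (simp add: s_def)
    then have "(1 - (\<Sum>k\<in>{1..<K}. \<rho> k s)) ^ l \<le> 1 / A" using A Kp by (simp add: field_simps)
    also have "\<dots> = (\<delta> / 2) ^ l" by (simp add: A_def power_divide)
    finally have "1 - (\<Sum>k\<in>{1..<K}. \<rho> k s) \<le> \<delta> / 2"
      using \<delta> l_pos by (meson less_eq_real_def half_gt_zero linorder_not_le power_strict_mono)
    moreover have "(\<Sum>k\<in>{1..<K'}. \<rho> k s) \<le> (\<Sum>k\<in>{1..<K'}. \<rho> k ts) + real l * real K' * (A / real K)"
      using R_lipschitz[OF s order_refl, of K'] by (simp add: s_def)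
    moreover have "real l * real K' * (A / real K) \<le> \<delta> / 4"
    proof -
      have "real l * real K' * (A / real K) = real l * A / real B" using K' B0 by (simp add: K_def)
      also have "\<dots> \<le> \<delta> / 4" using B B0 \<delta> by (simp add: field_simps)
      finally show ?thesis .
    qed
    moreover have "(\<Sum>k\<in>{1..<K'}. \<rho> k ts) \<le> 1 - \<delta>" using R_le_suminf[OF ts, of K'] by (simp add: \<delta>_def)
    moreover have "(\<Sum>k\<in>{1..<K}. \<rho> k s) = (\<Sum>k\<in>{1..<K'}. \<rho> k s) + (\<Sum>k\<in>{K'..<K}. \<rho> k s)"
      using K' BK by (simp add: sum.atLeastLessThan_concat)
    ultimately have mass: "\<delta> / 4 \<le> (\<Sum>k\<in>{K'..<K}. \<rho> k s)" by linarith
    have "\<beta> \<le> exp (- ((real l)\<^sup>2 * A)) * (\<Sum>k\<in>{K'..<K}. \<rho> k s)"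
      unfolding \<beta>_def by (intro mult_left_mono mass) simp
    also have "\<dots> \<le> (\<Sum>k\<in>{K'..<K}. \<rho> k ts)"
      unfolding sum_distrib_left
    proof (rule sum_mono)
      fix k assume k: "k \<in> {K'..<K}"
      have "(real l)\<^sup>2 * real k * (ts - s) \<le> (real l)\<^sup>2 * real K * (ts - s)"
        using k s by (intro mult_right_mono mult_left_mono) auto
      also have "\<dots> = (real l)\<^sup>2 * A" using Kp by (simp add: s_def)
      finally have "exp (- ((real l)\<^sup>2 * A)) * \<rho> k s \<le> exp (- ((real l)\<^sup>2 * real k * (ts - s))) * \<rho> k s"
        using rho_nonneg[OF s', of k] by (intro mult_right_mono) auto
      also have "\<dots> \<le> \<rho> k ts" using decay_exp[OF s order_refl, of k] by (simp add: mult.commute)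
      finally show "exp (- ((real l)\<^sup>2 * A)) * \<rho> k s \<le> \<rho> k ts" .
    qed
    finally show ?thesis by (simp add: K_def)
  qed
  \<comment> \<open>A single block beyond the Cauchy index already gives the contradiction.\<close>
  have "summable (\<lambda>k. \<rho> k ts)" using summable_rho[OF ts] summable_Suc_iff by blast
  then obtain N where N: "\<And>m n. m \<ge> N \<Longrightarrow> norm (\<Sum>k\<in>{m..<n}. \<rho> k ts) < \<beta>"
    using \<beta> unfolding summable_Cauchy by blast
  define K' where "K' = max 1 (max N K0)"
  have "\<beta> \<le> (\<Sum>k\<in>{K'..<B * K'}. \<rho> k ts)" by (rule range_mass) (auto simp: K'_def)
  moreover have "norm (\<Sum>k\<in>{K'..<B * K'}. \<rho> k ts) < \<beta>" by (rule N) (simp add: K'_def)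
  ultimately show False by (simp add: abs_less_iff)
qed

text \<open>The mass below a threshold decreases in time, so full mass at \<open>ts\<close> forces
  full mass at every earlier time.\<close>

lemma R_tendsto_1:
  assumes t: "t \<in> {0..ts}" shows "(\<lambda>K. \<Sum>k\<in>{1..K}. \<rho> k t) \<longlonglongrightarrow> 1"
proof -
  have lim: "(\<lambda>K. \<Sum>k<K. \<rho> (Suc k) ts) \<longlonglongrightarrow> 1"
    using summable_LIMSEQ[OF summable_rho[of ts]] suminf_rho_eq_1 ts_pos by simp
  have eq: "{1..<Suc K} = {1..K}" for K :: nat by auto
  show ?thesis
  proof (rule tendsto_sandwich[OF _ _ lim tendsto_const])
    show "\<forall>\<^sub>F K in sequentially. (\<Sum>k<K. \<rho> (Suc k) ts) \<le> (\<Sum>k\<in>{1..K}. \<rho> k t)"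
      unfolding sum_rho_Suc eq[symmetric] using t by (intro always_eventually allI R_antimono) auto
    show "\<forall>\<^sub>F K in sequentially. (\<Sum>k\<in>{1..K}. \<rho> k t) \<le> 1"
      unfolding eq[symmetric] using R_le_1[OF t] by (intro always_eventually allI)
  qed
qed

section \<open>Convergence of the drift series and the derivative of the limit\<close>

abbreviation pr :: "nat list \<Rightarrow> real \<Rightarrow> real" where "pr c t \<equiv> prod_list (map (\<lambda>j. \<rho> j t) c)"

abbreviation all_tuples :: "nat list set" where "all_tuples \<equiv> {c. length c = l \<and> (\<forall>j\<in>set c. j \<ge> 1)}"

lemma pr_nonneg: "t \<in> {0..ts} \<Longrightarrow> 0 \<le> pr c t"
  by (induction c) (auto simp: rho_nonneg)

lemma size_tuples_sub: "size_tuples l K \<subseteq> all_tuples"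
  by (auto simp: size_tuples_def)

lemma finite_sub_size_tuples:
  assumes "finite S" "S \<subseteq> all_tuples" shows "\<exists>K. S \<subseteq> size_tuples l K"
proof -
  define K where "K = (\<Sum>c\<in>S. sum_list c)"
  have "S \<subseteq> size_tuples l K"
  proof
    fix c assume c: "c \<in> S"
    have "j \<le> K" if "j \<in> set c" for j
    proof -
      have "j \<le> sum_list c" using that by (simp add: member_le_sum_list)
      also have "\<dots> \<le> K" unfolding K_def using c assms(1) by (intro member_le_sum) auto
      finally show ?thesis .
    qed
    then show "c \<in> size_tuples l K" using c assms(2) by (auto simp: size_tuples_def)
  qed
  then show ?thesis by blast
qed

lemma sum_pr_le_1:
  assumes t: "t \<in> {0..ts}" shows "(\<Sum>c\<in>size_tuples l K. pr c t) \<le> 1"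
proof -
  have eq: "{1..<Suc K} = {1..K}" by auto
  have "0 \<le> (\<Sum>k\<in>{1..K}. \<rho> k t)" by (intro sum_nonneg rho_nonneg t)
  then show ?thesis
    unfolding sum_size_tuples_prod using R_le_1[OF t, of "Suc K", unfolded eq] by (intro power_le_one)
qed

text \<open>Otherwise \<open>drift_bound\<close> on a window of length h around \<open>t\<close>
  would give \<open>pr c t\<close> \<le> Q h, which fails for small h.\<close>

lemma d_bounded:
  assumes k: "k \<ge> 1" and c: "c \<in> all_tuples" and t: "t \<in> {0..ts}" and p: "pr c t > 0"
  shows "\<bar>d k c\<bar> \<le> real l * real k"
proof (rule ccontr)
  assume "\<not> \<bar>d k c\<bar> \<le> real l * real k"
  then have gt: "real l * real k < \<bar>d k c\<bar>" by simp
  obtain K where K: "c \<in> size_tuples l K" using finite_sub_size_tuples[of "{c}"] c by auto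
  define Q where "Q = (real l)\<^sup>2 * real K"
  have Q: "0 \<le> Q" by (simp add: Q_def)
  \<comment> \<open>The first bound lets a window of length \<open>h\<close> fit on one side of
    \<open>t\<close> within the time interval; the second makes \<open>Q * h\<close> at most half of
    \<open>pr c t\<close>.\<close>
  define h where "h = min (ts / 2) (pr c t / (2 * (Q + 1)))"
  have h: "0 < h" using ts_pos p Q by (simp add: h_def)
  have h_le: "h \<le> ts / 2" "h \<le> pr c t / (2 * (Q + 1))" unfolding h_def by (rule min.cobounded1 min.cobounded2)+
  obtain t1 t2 where t12: "0 \<le> t1" "t1 \<le> t" "t \<le> t2" "t2 \<le> ts" "t2 - t1 = h"
  proof (cases "t + h \<le> ts")
    case True
    then show ?thesis using that[of t "t + h"] t h by auto
  next
    case False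
    then show ?thesis using that[of "t - h" t] t h h_le by auto
  qed
  have "(\<bar>d k c\<bar> - real l * real k) * (h * pr c t - Q * h\<^sup>2) \<le> 0"
    using drift_bound[OF k K _ t12(1-4)] gt t12(5) by (simp add: Q_def)
  then have "h * pr c t - Q * h\<^sup>2 \<le> 0" using gt by (simp add: mult_le_0_iff)
  then have "pr c t \<le> Q * h" using h by (simp add: power2_eq_square)
  also have "Q * h \<le> (Q + 1) * h" using h by simp
  also have "\<dots> \<le> (Q + 1) * (pr c t / (2 * (Q + 1)))" using h_le Q by (intro mult_left_mono) auto
  also have "\<dots> = pr c t / 2" using Q by (simp add: field_simps)
  finally show False using p by simp
qed

text \<open>Either the product vanishes or \<open>d_bounded\<close> applies, so the whole series is
  dominated by the products.\<close>

lemma d_pr_le: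
  assumes k: "k \<ge> 1" and c: "c \<in> all_tuples" and t: "t \<in> {0..ts}"
  shows "norm (d k c * pr c t) \<le> real l * real k * pr c t"
proof (cases "pr c t > 0")
  case True
  then show ?thesis using d_bounded[OF k c t True] by (simp add: abs_mult)
next
  case False
  then have "pr c t = 0" using pr_nonneg[OF t, of c] by simp
  then show ?thesis by simp
qed

text \<open>Every finite set of tuples lies in some box \<open>size_tuples l K\<close>, over which
  the products sum to a power of a partial mass, hence to at most 1.\<close>

lemma pr_summable:
  assumes t: "t \<in> {0..ts}" shows "(\<lambda>c. pr c t) summable_on all_tuples" "(\<Sum>\<^sub>\<infinity>c\<in>all_tuples. pr c t) \<le> 1"
proof -
  have fin: "sum (\<lambda>c. pr c t) S \<le> 1" if "finite S" "S \<subseteq> all_tuples" for S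
  proof -
    have "\<exists>K. S \<subseteq> size_tuples l K" by (rule finite_sub_size_tuples[OF that])
    then obtain K where "S \<subseteq> size_tuples l K" by blast
    then have "sum (\<lambda>c. pr c t) S \<le> (\<Sum>c\<in>size_tuples l K. pr c t)" using pr_nonneg[OF t] by (intro sum_mono2) auto
    then show ?thesis using sum_pr_le_1[OF t, of K] by linarith
  qed
  show 1: "(\<lambda>c. pr c t) summable_on all_tuples"
    by (rule nonneg_bounded_partial_sums_imp_summable_on[where C = 1])
       (use pr_nonneg[OF t] fin in \<open>auto intro!: eventually_finite_subsets_at_top_weakI\<close>)
  show "(\<Sum>\<^sub>\<infinity>c\<in>all_tuples. pr c t) \<le> 1" by (rule infsum_le_finite_sums[OF 1 fin])
qed

lemma d_summable:
  assumes k: "k \<ge> 1" and t: "t \<in> {0..ts}" shows "(\<lambda>c. norm (d k c * pr c t)) summable_on all_tuples"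
  by (rule Infinite_Sum.abs_summable_on_comparison_test'[where g = "\<lambda>c. real l * real k * pr c t"])
     (use d_pr_le[OF k _ t] pr_summable[OF t] in \<open>auto intro: summable_on_cmult_right\<close>)

text \<open>The tail is dominated by \<open>l * k\<close> times the tail of the products, and all
  products together sum to at most 1.\<close>

lemma infsum_tail:
  assumes k: "k \<ge> 1" and t: "t \<in> {0..ts}"
  shows "\<bar>(\<Sum>\<^sub>\<infinity>c\<in>all_tuples. d k c * pr c t) - (\<Sum>c\<in>size_tuples l K. d k c * pr c t)\<bar>
    \<le> real l * real k * (1 - (\<Sum>c\<in>size_tuples l K. pr c t))"
proof -
  let ?S = "size_tuples l K"
  let ?Q = "all_tuples - ?S"
  have sd: "(\<lambda>c. norm (d k c * pr c t)) summable_on ?Q"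
    by (rule summable_on_subset_banach[OF d_summable[OF k t]]) auto
  have sp: "(\<lambda>c. pr c t) summable_on ?Q" by (rule summable_on_subset_banach[OF pr_summable(1)[OF t]]) auto
  have 1: "(\<Sum>\<^sub>\<infinity>c\<in>?Q. d k c * pr c t) = (\<Sum>\<^sub>\<infinity>c\<in>all_tuples. d k c * pr c t) - (\<Sum>c\<in>?S. d k c * pr c t)"
    using infsum_Diff[OF Infinite_Sum.abs_summable_summable[OF d_summable[OF k t]] _ size_tuples_sub[of K]] by simp
  have 2: "(\<Sum>\<^sub>\<infinity>c\<in>?Q. pr c t) = (\<Sum>\<^sub>\<infinity>c\<in>all_tuples. pr c t) - (\<Sum>c\<in>?S. pr c t)"
    using infsum_Diff[OF pr_summable(1)[OF t] _ size_tuples_sub[of K]] by simp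
  have "norm (\<Sum>\<^sub>\<infinity>c\<in>?Q. d k c * pr c t) \<le> (\<Sum>\<^sub>\<infinity>c\<in>?Q. norm (d k c * pr c t))"
    by (rule norm_infsum_bound[OF sd])
  also have "\<dots> \<le> (\<Sum>\<^sub>\<infinity>c\<in>?Q. real l * real k * pr c t)"
    by (rule infsum_mono[OF sd summable_on_cmult_right[OF sp]]) (use d_pr_le[OF k _ t] in auto)
  also have "\<dots> = real l * real k * (\<Sum>\<^sub>\<infinity>c\<in>?Q. pr c t)" by (rule infsum_cmult_right[OF sp])
  also have "\<dots> \<le> real l * real k * (1 - (\<Sum>c\<in>?S. pr c t))"
    unfolding 2 using pr_summable(2)[OF t] by (intro mult_left_mono) auto
  finally show ?thesis unfolding 1 by simp
qed

lemma rho_derivative: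
  assumes k: "k \<ge> 1" and t: "t \<in> {0..ts}"
  shows "(\<rho> k has_real_derivative (\<Sum>\<^sub>\<infinity>c\<in>all_tuples. d k c * pr c t)) (at t within {0..ts})"
  unfolding has_field_derivative_iff
proof (rule tendstoI)
  define D where "D = (\<Sum>\<^sub>\<infinity>c\<in>all_tuples. d k c * pr c t)"
  fix \<eta> :: real assume \<eta>: "0 < \<eta>"
  \<comment> \<open>Conservation of mass enters here: it makes the contribution of tuples outside
    the box of size \<open>K\<close> arbitrarily small.\<close>
  have "(\<lambda>K. real l * real k * (1 - (\<Sum>k\<in>{1..K}. \<rho> k t) ^ l)) \<longlonglongrightarrow> real l * real k * (1 - 1 ^ l)"
    by (intro tendsto_intros R_tendsto_1 t)
  then have "\<forall>\<^sub>F K in sequentially. real l * real k * (1 - (\<Sum>k\<in>{1..K}. \<rho> k t) ^ l) < \<eta> / 4"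
    by (rule order_tendstoD) (use \<eta> in simp)
  then obtain K where K: "real l * real k * (1 - (\<Sum>k\<in>{1..K}. \<rho> k t) ^ l) < \<eta> / 4"
    using eventually_sequentially by auto
  define S where "S = size_tuples l K"
  define q where "q = real l * real k * (1 - (\<Sum>c\<in>S. pr c t))"
  have q: "q < \<eta> / 4" using K by (simp add: q_def S_def sum_size_tuples_prod)
  define Q where "Q = (\<Sum>c\<in>S. \<bar>d k c\<bar> * ((real l)\<^sup>2 * real K)) + real l * real k * (real (card S) * ((real l)\<^sup>2 * real K))"
  have Q: "0 \<le> Q" unfolding Q_def by (intro add_nonneg_nonneg sum_nonneg) auto
  \<comment> \<open>The point \<open>t\<close> may lie anywhere between \<open>t1\<close> and
    \<open>t2\<close>, which covers increments to either side of it.\<close>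
  have main: "\<bar>\<rho> k t2 - \<rho> k t1 - (t2 - t1) * D\<bar> \<le> (t2 - t1) * (Q * (t2 - t1) + 2 * q)"
    if t12: "0 \<le> t1" "t1 \<le> t" "t \<le> t2" "t2 \<le> ts" for t1 t2
  proof -
    let ?h = "t2 - t1"
    have 1: "\<bar>\<rho> k t2 - \<rho> k t1 - ?h * (\<Sum>c\<in>S. d k c * pr c t)\<bar> \<le> Q * ?h\<^sup>2 + ?h * q"
    proof -
      have "(\<Sum>c\<in>S. \<bar>d k c\<bar> * ((real l)\<^sup>2 * real K * ?h\<^sup>2)) = (\<Sum>c\<in>S. \<bar>d k c\<bar> * ((real l)\<^sup>2 * real K)) * ?h\<^sup>2"
        by (simp add: sum_distrib_right mult.assoc)
      then show ?thesis using drift[OF k t12, of K] unfolding S_def[symmetric] q_def Q_def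
        by (simp add: algebra_simps)
    qed
    have "\<bar>?h * (\<Sum>c\<in>S. d k c * pr c t) - ?h * D\<bar> = ?h * \<bar>D - (\<Sum>c\<in>S. d k c * pr c t)\<bar>"
      using t12 unfolding right_diff_distrib[symmetric] abs_mult by (simp add: abs_minus_commute)
    also have "\<dots> \<le> ?h * q"
      using infsum_tail[OF k t, of K] t12 unfolding D_def q_def S_def by (intro mult_left_mono) auto
    finally have 2: "\<bar>?h * (\<Sum>c\<in>S. d k c * pr c t) - ?h * D\<bar> \<le> ?h * q" .
    have "\<bar>\<rho> k t2 - \<rho> k t1 - ?h * D\<bar> \<le> Q * ?h\<^sup>2 + ?h * q + ?h * q" using 1 2 by linarith
    also have "\<dots> = ?h * (Q * ?h + 2 * q)" by (simp add: algebra_simps power2_eq_square)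
    finally show ?thesis .
  qed
  have quot: "\<bar>(\<rho> k y - \<rho> k t) / (y - t) - D\<bar> \<le> Q * \<bar>y - t\<bar> + 2 * q" if y: "y \<in> {0..ts}" "y \<noteq> t" for y
  proof -
    have "\<bar>\<rho> k y - \<rho> k t - (y - t) * D\<bar> \<le> \<bar>y - t\<bar> * (Q * \<bar>y - t\<bar> + 2 * q)"
    proof (cases "t \<le> y")
      case True
      then show ?thesis using main[of t y] y t by simp
    next
      case False
      have "\<rho> k y - \<rho> k t - (y - t) * D = - (\<rho> k t - \<rho> k y - (t - y) * D)" by (simp add: algebra_simps)
      then show ?thesis using main[of y t] y t False by (simp only: abs_minus_cancel) simp
    qed
    moreover have "(\<rho> k y - \<rho> k t) / (y - t) - D = (\<rho> k y - \<rho> k t - (y - t) * D) / (y - t)"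
      using y by (simp add: field_simps)
    ultimately show ?thesis using y by (simp add: abs_divide pos_divide_le_eq mult.commute)
  qed
  \<comment> \<open>The term with \<open>Q\<close> is then at most \<eta>/4, and
    \<open>2 * q\<close> is below \<eta>/2.\<close>
  define \<delta> where "\<delta> = \<eta> / (4 * (Q + 1))"
  have \<delta>: "\<delta> > 0" using \<eta> Q by (simp add: \<delta>_def)
  have Q\<delta>: "(Q + 1) * \<delta> = \<eta> / 4" using Q by (simp add: \<delta>_def field_simps)
  show "\<forall>\<^sub>F y in at t within {0..ts}. dist ((\<rho> k y - \<rho> k t) / (y - t)) (\<Sum>\<^sub>\<infinity>c\<in>all_tuples. d k c * pr c t) < \<eta>"
    unfolding eventually_at D_def[symmetric]
  proof (intro exI[of _ \<delta>] conjI ballI impI \<delta>)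
    fix y assume y: "y \<in> {0..ts}" "y \<noteq> t \<and> dist y t < \<delta>"
    have "Q * \<bar>y - t\<bar> \<le> (Q + 1) * \<delta>" using y Q by (intro mult_mono) (auto simp: dist_real_def)
    then show "dist ((\<rho> k y - \<rho> k t) / (y - t)) D < \<eta>"
      using quot[OF y(1)] y(2) q Q\<delta> \<eta> unfolding dist_real_def by linarith
  qed
qed

lemma ode_solution: "ode_solution l d ts \<rho>"
  unfolding ode_solution_def
proof (intro conjI ballI allI impI)
  fix t k assume t: "t \<in> {0..ts}" and k: "(1::nat) \<le> k"
  show "0 \<le> \<rho> k t" by (rule rho_nonneg[OF t])
  have "\<rho> k t \<le> (\<Sum>j\<in>{1..<Suc k}. \<rho> j t)" using k rho_nonneg[OF t] by (intro member_le_sum) auto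
  then show "\<rho> k t \<le> 1" using R_le_1[OF t, of "Suc k"] by linarith
  show "(\<lambda>cs. d k cs * prod_list (map (\<lambda>c. \<rho> c t) cs)) summable_on {cs. length cs = l \<and> (\<forall>c\<in>set cs. 1 \<le> c)}"
    by (rule Infinite_Sum.abs_summable_summable[OF d_summable[OF k t]])
  show "(\<rho> k has_real_derivative (\<Sum>\<^sub>\<infinity>cs\<in>{cs. length cs = l \<and> (\<forall>c\<in>set cs. 1 \<le> c)}. d k cs * prod_list (map (\<lambda>c. \<rho> c t) cs))) (at t within {0..ts})"
    by (rule rho_derivative[OF k t])
next
  fix t assume t: "t \<in> {0..ts}"
  show "summable (\<lambda>k. \<rho> (Suc k) t)" by (rule summable_rho[OF t])
  show "0 \<le> (\<Sum>k. \<rho> (Suc k) t)" by (rule suminf_nonneg[OF summable_rho[OF t] rho_nonneg[OF t]])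
  show "(\<Sum>k. \<rho> (Suc k) t) \<le> 1" by (rule suminf_rho_le_1[OF t])
qed (use rho_init in auto)

end

section \<open>Passage to the limit\<close>

lemma tendsto_prod_list_map:
  fixes f :: "'b \<Rightarrow> nat \<Rightarrow> real"
  assumes "\<And>c. c \<in> set cs \<Longrightarrow> f c \<longlonglongrightarrow> g c"
  shows "(\<lambda>i. prod_list (map (\<lambda>c. f c i) cs)) \<longlonglongrightarrow> prod_list (map g cs)"
  using assms by (induction cs) (auto intro: tendsto_mult)

text \<open>The size cutoff \<open>Suc j\<close> grows while the error 1/(j + 1) vanishes, so each
  fixed size is covered from some index on; \<open>n_gt\<close> sends the number of vertices to
  infinity.\<close>

locale path_sequence =
  fixes l :: nat and d :: "nat \<Rightarrow> nat list \<Rightarrow> real" and ts :: real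
    and n :: "nat \<Rightarrow> nat" and G :: "nat \<Rightarrow> nat \<Rightarrow> (nat \<times> nat) set" and w :: "nat \<Rightarrow> nat \<Rightarrow> nat list"
  assumes l_pos: "l > 0" and ts_pos: "ts > 0"
    and good: "good_path l (n j) (G j) (w j) d (nat \<lfloor>ts * real (n j)\<rfloor>) (Suc j) (1 / real (Suc j))"
    and n_gt: "j < n j"
begin

section \<open>The path estimates as functions of rescaled time\<close>

definition ix :: "nat \<Rightarrow> real \<Rightarrow> nat" where "ix j t = nat \<lfloor>t * real (n j)\<rfloor>"
definition dn :: "nat \<Rightarrow> nat \<Rightarrow> real \<Rightarrow> real" where "dn j k t = real (Nk (n j) k (G j (ix j t))) / real (n j)"
definition dt :: "nat \<Rightarrow> real \<Rightarrow> real \<Rightarrow> real" where "dt j t1 t2 = real (ix j t2 - ix j t1) / real (n j)"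
definition er :: "nat \<Rightarrow> real" where "er j = 1 / real (Suc j)"
definition nd :: "nat \<Rightarrow> real" where "nd j = real (ix j ts) / real (n j) * (real l)\<^sup>2 * er j + er j"

lemma n_pos_seq: "real (n j) > 0"
  using n_gt[of j] by simp

lemma ix_mono: "t1 \<le> t2 \<Longrightarrow> ix j t1 \<le> ix j t2"
  unfolding ix_def by (intro nat_mono floor_mono mult_right_mono) auto

lemma ix_approx:
  assumes "0 \<le> t" shows "\<bar>real (ix j t) / real (n j) - t\<bar> \<le> 1 / real (n j)"
proof -
  have "0 \<le> t * real (n j)" using assms by simp
  then have "\<bar>real (ix j t) - t * real (n j)\<bar> \<le> 1" unfolding ix_def by (simp add: abs_le_iff) linarith
  then have "\<bar>real (ix j t) - t * real (n j)\<bar> / real (n j) \<le> 1 / real (n j)"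
    by (intro divide_right_mono) auto
  moreover have "\<bar>real (ix j t) - t * real (n j)\<bar> / real (n j) = \<bar>real (ix j t) / real (n j) - t\<bar>"
    using n_pos_seq[of j] abs_divide[of "real (ix j t) - t * real (n j)" "real (n j)"] by (simp add: diff_divide_distrib)
  ultimately show ?thesis by simp
qed

lemma dt_eq: "t1 \<le> t2 \<Longrightarrow> dt j t1 t2 = real (ix j t2) / real (n j) - real (ix j t1) / real (n j)"
  unfolding dt_def using ix_mono[of t1 t2 j] by (simp add: of_nat_diff diff_divide_distrib)

lemma good_path_ix: "good_path l (n j) (G j) (w j) d (ix j ts) (Suc j) (er j)"
  using good[of j] by (simp add: ix_def er_def)

lemma dn_bounds: "0 \<le> dn j k t" "dn j k t \<le> 1"
proof -
  interpret good_path l "n j" "G j" "w j" d "ix j ts" "Suc j" "er j" by (rule good_path_ix)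
  show "0 \<le> dn j k t" "dn j k t \<le> 1" using dens_bounds[of k "ix j t"] by (simp_all add: dens_def dn_def)
qed

text \<open>The term 2/n is the rounding error of the two step indices: \<open>dn\<close> is a step
  function in time and Lipschitz only asymptotically.\<close>

lemma dn_lipschitz:
  assumes "0 \<le> t1" "t1 \<le> t2"
  shows "\<bar>dn j k t2 - dn j k t1\<bar> \<le> real l * real k * (t2 - t1 + 2 / real (n j))"
proof -
  interpret good_path l "n j" "G j" "w j" d "ix j ts" "Suc j" "er j" by (rule good_path_ix)
  have "\<bar>dn j k t2 - dn j k t1\<bar> \<le> real l * real k * dt j t1 t2"
    using dens_lipschitz[OF ix_mono[OF assms(2), of j], of k] by (simp add: dens_def dn_def dt_def)
  also have "\<dots> \<le> real l * real k * (t2 - t1 + 2 / real (n j))"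
    using ix_approx[of t1 j] ix_approx[of t2 j] assms
    by (intro mult_left_mono) (auto simp: dt_eq abs_le_iff)
  finally show ?thesis .
qed

lemma dn_0: "dn j k 0 = of_bool (k = 1)"
proof -
  interpret good_path l "n j" "G j" "w j" d "ix j ts" "Suc j" "er j" by (rule good_path_ix)
  have "comp {} y = {y}" for y by (simp add: comp_def)
  then show ?thesis using n_pos_seq[of j] by (cases "k = 1") (auto simp: dn_def ix_def G_0 Nk_def)
qed

lemma dn_sums:
  shows "(\<Sum>k\<in>{1..<K}. dn j k t) \<le> 1"
    and "t1 \<le> t2 \<Longrightarrow> (\<Sum>k\<in>{1..<K}. dn j k t2) \<le> (\<Sum>k\<in>{1..<K}. dn j k t1)"
    and "t1 \<le> t2 \<Longrightarrow> (\<Sum>k\<in>{1..<K}. dn j k t1) \<le> (\<Sum>k\<in>{1..<K}. dn j k t2) + real l * real K * dt j t1 t2"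
proof -
  interpret good_path l "n j" "G j" "w j" d "ix j ts" "Suc j" "er j" by (rule good_path_ix)
  show "(\<Sum>k\<in>{1..<K}. dn j k t) \<le> 1"
    using sum_dens_le_1[of "ix j t" K] unfolding dens_def dn_def .
  show "(\<Sum>k\<in>{1..<K}. dn j k t2) \<le> (\<Sum>k\<in>{1..<K}. dn j k t1)" if "t1 \<le> t2"
    using sum_dens_antimono[OF ix_mono[OF that]] unfolding dens_def dn_def .
  show "(\<Sum>k\<in>{1..<K}. dn j k t1) \<le> (\<Sum>k\<in>{1..<K}. dn j k t2) + real l * real K * dt j t1 t2" if "t1 \<le> t2"
    using sum_dens_lipschitz[OF ix_mono[OF that]] unfolding dens_def dn_def dt_def .
qed

lemma dn_decay:
  assumes "t1 \<le> t2" "t2 \<le> ts" "k \<le> Suc j"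
  shows "dn j k t1 - real l * real k * (real l * dt j t1 t2 * (dn j k t1 + real l * real k * dt j t1 t2) + 2 * er j) \<le> dn j k t2"
proof -
  interpret good_path l "n j" "G j" "w j" d "ix j ts" "Suc j" "er j" by (rule good_path_ix)
  show ?thesis using decay_path[OF assms(3) ix_mono[OF assms(1)] ix_mono[OF assms(2)]]
    unfolding dens_def dn_def dt_def .
qed

lemma dn_keg:
  assumes "t1 \<le> t2" "t2 \<le> ts" "K \<in> {1..Suc j}"
  shows "dt j t1 t2 * (1 - (\<Sum>k\<in>{1..<K}. dn j k t1)) ^ l \<le> 1 / real K + nd j + 2 * er j"
proof -
  interpret good_path l "n j" "G j" "w j" d "ix j ts" "Suc j" "er j" by (rule good_path_ix)
  show ?thesis using keg_path[OF assms(3) ix_mono[OF assms(1)] ix_mono[OF assms(2)]]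
    unfolding dens_def dn_def dt_def nd_def nderr_def .
qed

lemma dn_drift:
  assumes "t1 \<le> s" "s \<le> t2" "t2 \<le> ts" "K \<le> Suc j" "k \<in> {1..Suc j}"
  shows "\<bar>dn j k t2 - dn j k t1 - dt j t1 t2 * (\<Sum>c\<in>size_tuples l K. d k c * prod_list (map (\<lambda>a. dn j a s) c))\<bar> \<le>
     (\<Sum>c\<in>size_tuples l K. 2 * er j + \<bar>d k c\<bar> * (2 * er j + (real l)\<^sup>2 * real K * (dt j t1 t2)\<^sup>2 + nd j)) +
     real l * real k * (nd j + (dt j t1 t2 * (1 - (\<Sum>c\<in>size_tuples l K. prod_list (map (\<lambda>a. dn j a s) c))) +
        real (card (size_tuples l K)) * (2 * er j + (real l)\<^sup>2 * real K * (dt j t1 t2)\<^sup>2)))"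
proof -
  interpret good_path l "n j" "G j" "w j" d "ix j ts" "Suc j" "er j" by (rule good_path_ix)
  have s: "ix j s \<in> {ix j t1..ix j t2}" using ix_mono assms by auto
  have "t1 \<le> t2" using assms by simp
  show ?thesis using drift_path[OF assms(4) ix_mono[OF \<open>t1 \<le> t2\<close>] ix_mono[OF assms(3)] s assms(5)]
    unfolding dens_prod_def dens_def dn_def dt_def nd_def nderr_def elapsed_def .
qed

lemma dn_drift_bound:
  assumes "t1 \<le> s" "s \<le> t2" "t2 \<le> ts" "K \<le> Suc j" "k \<in> {1..Suc j}" "c \<in> size_tuples l K" "real l * real k \<le> \<bar>d k c\<bar>"
  shows "(\<bar>d k c\<bar> - real l * real k) * (dt j t1 t2 * prod_list (map (\<lambda>a. dn j a s) c) -
      (2 * er j + (real l)\<^sup>2 * real K * (dt j t1 t2)\<^sup>2 + nd j)) \<le> 2 * er j"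
proof -
  interpret good_path l "n j" "G j" "w j" d "ix j ts" "Suc j" "er j" by (rule good_path_ix)
  have s: "ix j s \<in> {ix j t1..ix j t2}" using ix_mono assms by auto
  have "t1 \<le> t2" using assms by simp
  show ?thesis using abs_drift_path[OF assms(4) ix_mono[OF \<open>t1 \<le> t2\<close>] ix_mono[OF assms(3)] s assms(6,5,7)]
    unfolding dens_prod_def dens_def dn_def dt_def nd_def nderr_def elapsed_def .
qed

lemma inverse_n_tendsto: "(\<lambda>j. 1 / real (n j)) \<longlonglongrightarrow> 0"
proof (rule tendsto_sandwich[OF _ _ tendsto_const])
  show "(\<lambda>j. 1 / real (Suc j)) \<longlonglongrightarrow> 0" by (rule LIMSEQ_Suc[OF lim_1_over_n])
  show "\<forall>\<^sub>F j in sequentially. 1 / real (n j) \<le> 1 / real (Suc j)"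
  proof (intro always_eventually allI divide_left_mono)
    fix j
    show "real (Suc j) \<le> real (n j)" using n_gt[of j] by (simp only: of_nat_le_iff Suc_le_eq)
    show "0 < real (n j) * real (Suc j)" using n_pos_seq[of j] by simp
  qed simp
qed simp

lemma ix_tendsto: 
  assumes "0 \<le> t" shows "(\<lambda>j. real (ix j t) / real (n j)) \<longlonglongrightarrow> t"
proof -
  have "(\<lambda>j. real (ix j t) / real (n j) - t) \<longlonglongrightarrow> 0"
    by (rule tendsto_rabs_zero_cancel, rule tendsto_sandwich[OF _ _ tendsto_const inverse_n_tendsto])
       (use ix_approx[OF assms] in auto)
  then show ?thesis by (simp add: LIM_zero_iff)
qed

lemma dt_tendsto: "0 \<le> t1 \<Longrightarrow> t1 \<le> t2 \<Longrightarrow> (\<lambda>j. dt j t1 t2) \<longlonglongrightarrow> t2 - t1"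
  by (simp add: dt_eq tendsto_diff ix_tendsto)

lemma er_tendsto: "er \<longlonglongrightarrow> 0"
  unfolding er_def[abs_def] by (rule LIMSEQ_Suc[OF lim_1_over_n])

lemma nd_tendsto: "nd \<longlonglongrightarrow> 0"
proof -
  have "(\<lambda>j. real (ix j ts) / real (n j) * (real l)\<^sup>2 * er j + er j) \<longlonglongrightarrow> ts * (real l)\<^sup>2 * 0 + 0"
    using ts_pos by (intro tendsto_intros ix_tendsto er_tendsto) simp
  then show ?thesis by (simp add: nd_def[abs_def])
qed

text \<open>Arzela-Ascoli by hand: a diagonal subsequence converges for all sizes at all rational
  times, and the Lipschitz bound, whose rounding term vanishes, carries the Cauchy property to every
  time.\<close>

lemma convergent_subsequence:
  obtains r :: "nat \<Rightarrow> nat" where "strict_mono r"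
    "\<And>k t. t \<in> {0..ts} \<Longrightarrow> convergent (\<lambda>i. dn (r i) k t)"
proof -
  define S where "S = (UNIV :: nat set) \<times> (\<rat> \<inter> {0..ts})"
  have "countable S" unfolding S_def by (intro countable_SIGMA countable_Int1 countable_rat) auto
  moreover have "norm ((\<lambda>j (k, t). dn j k t) j y) \<le> 1" for j y
    using dn_bounds[of j "fst y" "snd y"] by (cases y) auto
  ultimately obtain r where r: "strict_mono (r::nat\<Rightarrow>nat)"
    "\<And>y. y \<in> S \<Longrightarrow> \<exists>a. (\<lambda>i. (\<lambda>j (k, t). dn j k t) (r i) y) \<longlonglongrightarrow> a"
    using function_convergent_subsequence[of S "\<lambda>j (k, t). dn j k t" 1] by metis
  have rat: "Cauchy (\<lambda>i. dn (r i) k q)" if "q \<in> \<rat>" "q \<in> {0..ts}" for k q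
  proof -
    have "\<exists>a. (\<lambda>i. dn (r i) k q) \<longlonglongrightarrow> a" using r(2)[of "(k, q)"] that by (simp add: S_def)
    then show ?thesis using LIMSEQ_imp_Cauchy by blast
  qed
  have "convergent (\<lambda>i. dn (r i) k t)" if t: "t \<in> {0..ts}" for k t
  proof (rule Cauchy_convergent, rule CauchyI)
    fix \<eta> :: real assume \<eta>: "\<eta> > 0"
    \<comment> \<open>The added 1 keeps \<open>Q\<close> positive when \<open>k = 0\<close>.\<close>
    define Q where "Q = real l * real k + 1"
    have Q: "Q > 0" unfolding Q_def by (intro add_nonneg_pos) auto
    \<comment> \<open>A nearby rational time to the left of \<open>t\<close> inside the interval;
      for t = 0 it is \<open>t\<close> itself.\<close>
    obtain q where q: "q \<in> \<rat>" "q \<in> {0..ts}" "q \<le> t" "t - q \<le> \<eta> / (8 * Q)"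
    proof (cases "t = 0")
      case True
      then show ?thesis using that[of 0] t \<eta> Q by auto
    next
      case False
      then have "max 0 (t - \<eta> / (8 * Q)) < t" using t \<eta> Q by auto
      from Rats_dense_in_real[OF this] obtain q where "q \<in> \<rat>" "max 0 (t - \<eta> / (8 * Q)) < q" "q < t" by blast
      then show ?thesis using that[of q] t by auto
    qed
    have "\<forall>\<^sub>F j in sequentially. 2 * (1 / real (n j)) < \<eta> / (8 * Q)"
      using \<eta> Q tendsto_mult_right_zero[OF inverse_n_tendsto, of 2] by (intro order_tendstoD) auto
    then obtain N1 where N1: "\<And>j. j \<ge> N1 \<Longrightarrow> 2 / real (n j) < \<eta> / (8 * Q)"
      by (auto simp: eventually_sequentially)
    obtain N2 where N2: "\<And>a b. a \<ge> N2 \<Longrightarrow> b \<ge> N2 \<Longrightarrow> norm (dn (r a) k q - dn (r b) k q) < \<eta> / 4"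
      using CauchyD[OF rat[OF q(1,2)], of "\<eta> / 4" k] \<eta> by auto
    have near: "\<bar>dn (r a) k t - dn (r a) k q\<bar> \<le> \<eta> / 4" if "a \<ge> N1" for a
    proof -
      have "r a \<ge> N1" using seq_suble[OF r(1), of a] that by linarith
      have "\<bar>dn (r a) k t - dn (r a) k q\<bar> \<le> real l * real k * (t - q + 2 / real (n (r a)))"
        using q by (intro dn_lipschitz) auto
      also have "\<dots> \<le> Q * (\<eta> / (8 * Q) + \<eta> / (8 * Q))"
        using q N1[OF \<open>r a \<ge> N1\<close>] by (intro mult_mono add_mono) (auto simp: Q_def)
      also have "\<dots> = \<eta> / 4" using Q by (simp add: field_simps)
      finally show ?thesis .
    qed
    show "\<exists>M. \<forall>a\<ge>M. \<forall>b\<ge>M. norm (dn (r a) k t - dn (r b) k t) < \<eta>"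
    proof (intro exI[of _ "max N1 N2"] allI impI)
      fix a b assume "max N1 N2 \<le> a" "max N1 N2 \<le> b"
      then show "norm (dn (r a) k t - dn (r b) k t) < \<eta>"
        using near[of a] near[of b] N2[of a b] \<eta> unfolding real_norm_def max.bounded_iff by linarith
    qed
  qed
  with r(1) show ?thesis using that by blast
qed

text \<open>All path estimates are non-strict inequalities whose error terms tend to 0, so each of
  them passes to the pointwise limit.\<close>

lemma exists_limit_system: "\<exists>\<rho>. limit_system l d \<rho> ts"
proof -
  obtain r where r: "strict_mono r" and conv: "\<And>k t. t \<in> {0..ts} \<Longrightarrow> convergent (\<lambda>i. dn (r i) k t)"
    by (rule convergent_subsequence) blast
  define \<rho> where "\<rho> k t = lim (\<lambda>i. dn (r i) k t)" for k t
  have lim: "(\<lambda>i. dn (r i) k t) \<longlonglongrightarrow> \<rho> k t" if "0 \<le> t" "t \<le> ts" for k t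
    unfolding \<rho>_def using conv[of t k] that by (simp add: convergent_LIMSEQ_iff)
  have sub: "(\<lambda>i. f (r i)) \<longlonglongrightarrow> a" if "f \<longlonglongrightarrow> a" for f :: "nat \<Rightarrow> real" and a
    using LIMSEQ_subseq_LIMSEQ[OF that r] by (simp add: o_def)
  have dtl: "(\<lambda>i. dt (r i) t1 t2) \<longlonglongrightarrow> t2 - t1" if "0 \<le> t1" "t1 \<le> t2" for t1 t2
    by (rule sub[OF dt_tendsto[OF that]])
  have erl: "(\<lambda>i. er (r i)) \<longlonglongrightarrow> 0" by (rule sub[OF er_tendsto])
  have ndl: "(\<lambda>i. nd (r i)) \<longlonglongrightarrow> 0" by (rule sub[OF nd_tendsto])
  have prl: "(\<lambda>i. prod_list (map (\<lambda>a. dn (r i) a s) c)) \<longlonglongrightarrow> prod_list (map (\<lambda>a. \<rho> a s) c)"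
    if "0 \<le> s" "s \<le> ts" for s c
    by (rule tendsto_prod_list_map) (rule lim[OF that])
  \<comment> \<open>Estimates for sizes up to \<open>m\<close> hold only for indices with
    \<open>m \<le> Suc j\<close>; the subsequence satisfies \<open>r i \<ge> i\<close>, so they hold
    eventually along it.\<close>
  have large: "\<exists>N. \<forall>i\<ge>N. P (r i)" if "\<And>j. m \<le> Suc j \<Longrightarrow> P j" for P m
  proof (intro exI[of _ m] allI impI)
    fix i assume "m \<le> i"
    then show "P (r i)" using seq_suble[OF r, of i] by (intro that) linarith
  qed
  have "limit_system l d \<rho> ts"
  proof unfold_locales
    show "0 < l" "0 < ts" by (fact l_pos ts_pos)+
    show "0 \<le> \<rho> k t" if "t \<in> {0..ts}" for k t
      by (rule LIMSEQ_le_const[OF lim]) (use that dn_bounds in auto)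
    show "\<rho> 1 0 = 1" "k \<ge> 2 \<Longrightarrow> \<rho> k 0 = 0" for k
      unfolding \<rho>_def by (simp_all add: dn_0)
    show "(\<Sum>k\<in>{1..<K}. \<rho> k t) \<le> 1" if "t \<in> {0..ts}" for K t
      by (rule LIMSEQ_le_const2[where X = "\<lambda>i. \<Sum>k\<in>{1..<K}. dn (r i) k t"])
         (use that dn_sums(1) in \<open>auto intro!: tendsto_sum lim\<close>)
    fix t1 t2 :: real and K k :: nat
    assume t: "0 \<le> t1" "t2 \<le> ts"
    {
      assume t12: "t1 \<le> t2"
      have l1: "(\<lambda>i. dn (r i) a t1) \<longlonglongrightarrow> \<rho> a t1" and l2: "(\<lambda>i. dn (r i) a t2) \<longlonglongrightarrow> \<rho> a t2" for a
        by (rule lim; use t t12 in simp)+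
      show "(\<Sum>k\<in>{1..<K}. \<rho> k t2) \<le> (\<Sum>k\<in>{1..<K}. \<rho> k t1)"
        by (rule LIMSEQ_le[where X = "\<lambda>i. \<Sum>k\<in>{1..<K}. dn (r i) k t2" and Y = "\<lambda>i. \<Sum>k\<in>{1..<K}. dn (r i) k t1"])
           (use dn_sums(2)[OF t12] in \<open>auto intro!: tendsto_sum l1 l2\<close>)
      show "(\<Sum>k\<in>{1..<K}. \<rho> k t1) \<le> (\<Sum>k\<in>{1..<K}. \<rho> k t2) + real l * real K * (t2 - t1)"
        by (rule LIMSEQ_le[where X = "\<lambda>i. \<Sum>k\<in>{1..<K}. dn (r i) k t1" and
              Y = "\<lambda>i. (\<Sum>k\<in>{1..<K}. dn (r i) k t2) + real l * real K * dt (r i) t1 t2"])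
           (intro tendsto_intros l1 l2 dtl t t12, intro tendsto_intros l1 l2 dtl t t12, use dn_sums(3)[OF t12] in auto)
      have "\<rho> k t1 - real l * real k * (real l * (t2 - t1) * (\<rho> k t1 + real l * real k * (t2 - t1)) + 2 * 0) \<le> \<rho> k t2"
      proof (rule LIMSEQ_le)
        show "(\<lambda>i. dn (r i) k t1 - real l * real k * (real l * dt (r i) t1 t2 * (dn (r i) k t1 + real l * real k * dt (r i) t1 t2) + 2 * er (r i)))
          \<longlonglongrightarrow> \<rho> k t1 - real l * real k * (real l * (t2 - t1) * (\<rho> k t1 + real l * real k * (t2 - t1)) + 2 * 0)"
          by (intro tendsto_intros l1 l2 dtl t t12 erl)
        show "(\<lambda>i. dn (r i) k t2) \<longlonglongrightarrow> \<rho> k t2" by (rule l2)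
        show "\<exists>N. \<forall>i\<ge>N. dn (r i) k t1 - real l * real k * (real l * dt (r i) t1 t2 * (dn (r i) k t1 + real l * real k * dt (r i) t1 t2) + 2 * er (r i)) \<le> dn (r i) k t2"
          by (rule large[of k]) (rule dn_decay[OF t12 t(2)])
      qed
      then show "\<rho> k t1 - real l * real k * (real l * (t2 - t1) * (\<rho> k t1 + real l * real k * (t2 - t1))) \<le> \<rho> k t2"
        by simp
      show "(t2 - t1) * (1 - (\<Sum>k\<in>{1..<K}. \<rho> k t1)) ^ l \<le> 1 / real K" if K: "1 \<le> K"
      proof -
        have "(t2 - t1) * (1 - (\<Sum>k\<in>{1..<K}. \<rho> k t1)) ^ l \<le> 1 / real K + 0 + 2 * 0"
        proof (rule LIMSEQ_le)
          show "(\<lambda>i. dt (r i) t1 t2 * (1 - (\<Sum>k\<in>{1..<K}. dn (r i) k t1)) ^ l) \<longlonglongrightarrow> (t2 - t1) * (1 - (\<Sum>k\<in>{1..<K}. \<rho> k t1)) ^ l"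
            by (intro tendsto_intros l1 dtl t t12)
          show "(\<lambda>i. 1 / real K + nd (r i) + 2 * er (r i)) \<longlonglongrightarrow> 1 / real K + 0 + 2 * 0"
            by (intro tendsto_intros erl ndl)
          show "\<exists>N. \<forall>i\<ge>N. dt (r i) t1 t2 * (1 - (\<Sum>k\<in>{1..<K}. dn (r i) k t1)) ^ l \<le> 1 / real K + nd (r i) + 2 * er (r i)"
            by (rule large[of K]) (rule dn_keg[OF t12 t(2)], use K in auto)
        qed
        then show ?thesis by simp
      qed
    }
    fix s :: real assume s: "t1 \<le> s" "s \<le> t2" and k: "1 \<le> k"
    have t12: "t1 \<le> t2" using s by simp
    have s': "0 \<le> s" "s \<le> ts" using s t by auto
    have l1: "(\<lambda>i. dn (r i) a t1) \<longlonglongrightarrow> \<rho> a t1" and l2: "(\<lambda>i. dn (r i) a t2) \<longlonglongrightarrow> \<rho> a t2" for a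
      by (rule lim; use t t12 in simp)+
    have "\<bar>\<rho> k t2 - \<rho> k t1 - (t2 - t1) * (\<Sum>c\<in>size_tuples l K. d k c * prod_list (map (\<lambda>j. \<rho> j s) c))\<bar> \<le>
      (\<Sum>c\<in>size_tuples l K. 2 * 0 + \<bar>d k c\<bar> * (2 * 0 + (real l)\<^sup>2 * real K * (t2 - t1)\<^sup>2 + 0)) +
      real l * real k * (0 + ((t2 - t1) * (1 - (\<Sum>c\<in>size_tuples l K. prod_list (map (\<lambda>j. \<rho> j s) c))) +
         real (card (size_tuples l K)) * (2 * 0 + (real l)\<^sup>2 * real K * (t2 - t1)\<^sup>2)))"
    proof (rule LIMSEQ_le)
      show "(\<lambda>i. \<bar>dn (r i) k t2 - dn (r i) k t1 - dt (r i) t1 t2 * (\<Sum>c\<in>size_tuples l K. d k c * prod_list (map (\<lambda>a. dn (r i) a s) c))\<bar>)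
         \<longlonglongrightarrow> \<bar>\<rho> k t2 - \<rho> k t1 - (t2 - t1) * (\<Sum>c\<in>size_tuples l K. d k c * prod_list (map (\<lambda>j. \<rho> j s) c))\<bar>"
        by (intro tendsto_rabs tendsto_diff tendsto_mult tendsto_sum tendsto_const l1 l2 dtl t t12 prl s')
      show "(\<lambda>i. (\<Sum>c\<in>size_tuples l K. 2 * er (r i) + \<bar>d k c\<bar> * (2 * er (r i) + (real l)\<^sup>2 * real K * (dt (r i) t1 t2)\<^sup>2 + nd (r i))) +
         real l * real k * (nd (r i) + (dt (r i) t1 t2 * (1 - (\<Sum>c\<in>size_tuples l K. prod_list (map (\<lambda>a. dn (r i) a s) c))) +
           real (card (size_tuples l K)) * (2 * er (r i) + (real l)\<^sup>2 * real K * (dt (r i) t1 t2)\<^sup>2))))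
         \<longlonglongrightarrow> (\<Sum>c\<in>size_tuples l K. 2 * 0 + \<bar>d k c\<bar> * (2 * 0 + (real l)\<^sup>2 * real K * (t2 - t1)\<^sup>2 + 0)) +
          real l * real k * (0 + ((t2 - t1) * (1 - (\<Sum>c\<in>size_tuples l K. prod_list (map (\<lambda>j. \<rho> j s) c))) +
           real (card (size_tuples l K)) * (2 * 0 + (real l)\<^sup>2 * real K * (t2 - t1)\<^sup>2)))"
        by (intro tendsto_add tendsto_diff tendsto_mult tendsto_sum tendsto_power tendsto_const dtl t t12 prl s' erl ndl)
      show "\<exists>N. \<forall>i\<ge>N. \<bar>dn (r i) k t2 - dn (r i) k t1 - dt (r i) t1 t2 * (\<Sum>c\<in>size_tuples l K. d k c * prod_list (map (\<lambda>a. dn (r i) a s) c))\<bar>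
         \<le> (\<Sum>c\<in>size_tuples l K. 2 * er (r i) + \<bar>d k c\<bar> * (2 * er (r i) + (real l)\<^sup>2 * real K * (dt (r i) t1 t2)\<^sup>2 + nd (r i))) +
         real l * real k * (nd (r i) + (dt (r i) t1 t2 * (1 - (\<Sum>c\<in>size_tuples l K. prod_list (map (\<lambda>a. dn (r i) a s) c))) +
           real (card (size_tuples l K)) * (2 * er (r i) + (real l)\<^sup>2 * real K * (dt (r i) t1 t2)\<^sup>2)))"
        by (rule large[of "max k K"]) (rule dn_drift[OF s t(2)], use k in auto)
    qed
    then show "\<bar>\<rho> k t2 - \<rho> k t1 - (t2 - t1) * (\<Sum>c\<in>size_tuples l K. d k c * prod_list (map (\<lambda>j. \<rho> j s) c))\<bar> \<le>
      (\<Sum>c\<in>size_tuples l K. \<bar>d k c\<bar> * ((real l)\<^sup>2 * real K * (t2 - t1)\<^sup>2)) +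
      real l * real k * ((t2 - t1) * (1 - (\<Sum>c\<in>size_tuples l K. prod_list (map (\<lambda>j. \<rho> j s) c))) +
         real (card (size_tuples l K)) * ((real l)\<^sup>2 * real K * (t2 - t1)\<^sup>2))"
      by simp
    fix c assume c: "c \<in> size_tuples l K" and big: "real l * real k \<le> \<bar>d k c\<bar>"
    have "(\<bar>d k c\<bar> - real l * real k) * ((t2 - t1) * prod_list (map (\<lambda>j. \<rho> j s) c) - (2 * 0 + (real l)\<^sup>2 * real K * (t2 - t1)\<^sup>2 + 0)) \<le> 2 * 0"
    proof (rule LIMSEQ_le)
      show "(\<lambda>i. (\<bar>d k c\<bar> - real l * real k) * (dt (r i) t1 t2 * prod_list (map (\<lambda>a. dn (r i) a s) c) -
          (2 * er (r i) + (real l)\<^sup>2 * real K * (dt (r i) t1 t2)\<^sup>2 + nd (r i)))) \<longlonglongrightarrow>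
          (\<bar>d k c\<bar> - real l * real k) * ((t2 - t1) * prod_list (map (\<lambda>j. \<rho> j s) c) - (2 * 0 + (real l)\<^sup>2 * real K * (t2 - t1)\<^sup>2 + 0))"
        by (intro tendsto_add tendsto_diff tendsto_mult tendsto_power tendsto_const dtl t t12 prl s' erl ndl)
      show "(\<lambda>i. 2 * er (r i)) \<longlonglongrightarrow> 2 * 0" by (intro tendsto_mult tendsto_const erl)
      show "\<exists>N. \<forall>i\<ge>N. (\<bar>d k c\<bar> - real l * real k) * (dt (r i) t1 t2 * prod_list (map (\<lambda>a. dn (r i) a s) c) -
          (2 * er (r i) + (real l)\<^sup>2 * real K * (dt (r i) t1 t2)\<^sup>2 + nd (r i))) \<le> 2 * er (r i)"
        by (rule large[of "max k K"]) (rule dn_drift_bound[OF s t(2) _ _ c big], use k in auto)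
    qed
    then show "(\<bar>d k c\<bar> - real l * real k) * ((t2 - t1) * prod_list (map (\<lambda>j. \<rho> j s) c) - (real l)\<^sup>2 * real K * (t2 - t1)\<^sup>2) \<le> 0"
      by simp
  qed
  then show ?thesis by blast
qed

end

section \<open>The hypotheses on the rule, the case of time zero, and the conclusion\<close>

lemma rule_process_rule_proc:
  assumes "rule_process l n M F v E" "n > 0" shows "rule_proc M F l n v E"
proof -
  interpret prob_space M using assms by (simp add: rule_process_def)
  show ?thesis by unfold_locales (use assms in \<open>auto simp: rule_process_def\<close>)
qed

text \<open>On the degenerate interval {0} the derivative is taken along the trivial filter, so the
  equation holds for any right side and the initial data form a solution.\<close>

lemma ode_solution_at_0:
  assumes "l > 0" shows "ode_solution l d 0 (\<lambda>k t. of_bool (k = (1::nat)))"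
proof -
  have summ: "(\<lambda>cs. d k cs * prod_list (map (\<lambda>c. of_bool (c = (1::nat))) cs)) summable_on {cs. length cs = l \<and> (\<forall>c\<in>set cs. c \<ge> 1)}" for k
  proof -
    \<comment> \<open>Only the tuple consisting of ones has a nonzero product.\<close>
    have "(\<lambda>cs. d k cs * prod_list (map (\<lambda>c. of_bool (c = (1::nat))) cs)) summable_on {replicate l 1}" by simp
    then show ?thesis
    proof (rule summable_on_cong_neutral[THEN iffD1, rotated -1])
      fix cs :: "nat list" assume cs: "cs \<in> {cs. length cs = l \<and> (\<forall>c\<in>set cs. c \<ge> 1)} - {replicate l 1}"
      then obtain c where "c \<in> set cs" "c \<noteq> 1" using replicate_eqI[of cs l 1] by auto
      then have "0 \<in> set (map (\<lambda>c. of_bool (c = 1)) cs :: real list)" by force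
      then have "prod_list (map (\<lambda>c. of_bool (c = 1)) cs) = (0::real)" by (simp add: prod_list_zero_iff)
      then show "d k cs * prod_list (map (\<lambda>c. of_bool (c = 1)) cs) = 0" by simp
    qed auto
  qed
  have "(\<lambda>k. of_bool (Suc k = 1) :: real) sums (\<Sum>k\<in>{0}. of_bool (Suc k = 1))" by (rule sums_finite) auto
  then have s: "(\<lambda>k. of_bool (Suc k = 1) :: real) sums 1" by simp
  have bot: "at (0::real) within {0} = bot" by (simp add: at_within_eq_bot_iff)
  show ?thesis unfolding ode_solution_def
    using summ s[THEN sums_summable] s[THEN sums_unique]
    by (auto simp: has_field_derivative_iff bot)
qed

lemma suminf_of_bool_Suc: "(\<Sum>k. of_bool (Suc k = 1) :: real) = 1"
proof -
  have "(\<lambda>k. of_bool (Suc k = 1) :: real) sums (\<Sum>k\<in>{0}. of_bool (Suc k = 1))" by (rule sums_finite) auto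
  then show ?thesis by (simp add: sums_iff)
qed

theorem theorem8:
  fixes l :: nat
    and M :: "nat \<Rightarrow> 'a measure"
    and F :: "nat \<Rightarrow> nat \<Rightarrow> 'a measure"
    and v :: "nat \<Rightarrow> nat \<Rightarrow> 'a \<Rightarrow> nat list"
    and E :: "nat \<Rightarrow> nat \<Rightarrow> 'a \<Rightarrow> (nat \<times> nat) set"
    and d :: "nat \<Rightarrow> nat list \<Rightarrow> real"
    and tstar :: real
  assumes "l \<ge> 2"
    and "\<forall>n>0. rule_process l n (M n) (F n) (v n) (E n)"
    and "\<forall>n>0. merging l n (M n) (F n) (E n)"
    and "\<forall>n>0. drift_cond l n (M n) (F n) (v n) (E n) d"
    and "tstar \<ge> 0"
    and "\<forall>\<rho>. ode_solution l d tstar \<rho> \<longrightarrow> (\<Sum>k. \<rho> (Suc k) tstar) < 1"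
  shows "\<forall>t\<ge>tstar. \<forall>\<epsilon>>0. \<exists>\<alpha>>0. \<exists>n0>0. \<forall>n\<ge>n0.
           measure (M n) {\<omega> \<in> space (M n).
              real (L1 n (graph_at (E n) (nat \<lfloor>t * real n\<rfloor>) \<omega>)) \<ge> \<alpha> * real n}
           \<ge> 1 - \<epsilon>"
proof (intro allI impI, rule ccontr)
  fix t \<epsilon> :: real assume t: "t \<ge> tstar" and \<epsilon>: "\<epsilon> > 0"
  define Q where "Q \<alpha> n = measure (M n) {\<omega> \<in> space (M n).
              real (L1 n (graph_at (E n) (nat \<lfloor>t * real n\<rfloor>) \<omega>)) \<ge> \<alpha> * real n}" for \<alpha> n
  assume "\<not> (\<exists>\<alpha>>0. \<exists>n0>0. \<forall>n\<ge>n0. measure (M n) {\<omega> \<in> space (M n).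
              real (L1 n (graph_at (E n) (nat \<lfloor>t * real n\<rfloor>) \<omega>)) \<ge> \<alpha> * real n} \<ge> 1 - \<epsilon>)"
  then have "\<not> (\<exists>\<alpha>>0. \<exists>n0>0. \<forall>n\<ge>n0. Q \<alpha> n \<ge> 1 - \<epsilon>)" unfolding Q_def .
  then have bad: "\<exists>n\<ge>n0. Q \<alpha> n < 1 - \<epsilon>" if "\<alpha> > 0" "n0 > 0" for \<alpha> n0
    using that by (meson not_le)
  have l_pos: "l > 0" using assms(1) by simp
  have tstar: "tstar > 0"
  proof (rule ccontr)
    assume "\<not> tstar > 0"
    then have "tstar = 0" using assms(5) by simp
    then show False using assms(6) ode_solution_at_0[OF l_pos, of d] suminf_of_bool_Suc by fastforce
  qed
  have "\<exists>n G w. j < n \<and> good_path l n G w d (nat \<lfloor>tstar * real n\<rfloor>) (Suc j) (1 / real (Suc j))" for j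
  proof -
    define e where "e = 1 / real (Suc j)"
    have e: "e > 0" by (simp add: e_def)
    define I where "I = real (card (test_events l (Suc j) <+> {1..Suc j} \<times> size_tuples l (Suc j)))"
    \<comment> \<open>A sum over finitely many pairs serves as the common bound; the 1 covers the
      test events.\<close>
    define C where "C = 1 + (\<Sum>(k, c)\<in>{1..Suc j} \<times> size_tuples l (Suc j). real (l * k) + \<bar>d k c\<bar>)"
    have C1: "1 \<le> C" unfolding C_def by (auto intro!: sum_nonneg)
    have C: "real (l * k) + \<bar>d k c\<bar> \<le> C" if "k \<in> {1..Suc j}" "c \<in> size_tuples l (Suc j)" for k c
    proof -
      have "(case (k, c) of (k, c) \<Rightarrow> real (l * k) + \<bar>d k c\<bar>) \<le> (\<Sum>(k, c)\<in>{1..Suc j} \<times> size_tuples l (Suc j). real (l * k) + \<bar>d k c\<bar>)"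
        using that by (intro member_le_sum) (auto simp del: of_nat_mult)
      then show ?thesis by (simp add: C_def)
    qed
    \<comment> \<open>The union bound is of order 1/n; from \<open>N\<close> on it falls below
      \<epsilon>.\<close>
    obtain N :: nat where N: "I * tstar * C\<^sup>2 / (e\<^sup>2 * \<epsilon>) < real N" using reals_Archimedean2 by blast
    \<comment> \<open>The negated conclusion with \<alpha> = \<open>e\<close>; the threshold
      \<open>Suc j\<close> also makes \<open>n\<close> exceed \<open>j\<close>.\<close>
    obtain n where n: "n \<ge> max (Suc j) N" and prob: "measure (M n) {\<omega> \<in> space (M n).
              real (L1 n (graph_at (E n) (nat \<lfloor>t * real n\<rfloor>) \<omega>)) \<ge> e * real n} < 1 - \<epsilon>"
    proof -
      have "0 < max (Suc j) N" by simp
      from bad[OF e this] show ?thesis using that unfolding Q_def by blast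
    qed
    have n_pos: "n > 0" and nj: "j < n" and nN: "N \<le> n" using n by auto
    interpret rule_proc "M n" "F n" l n "v n" "E n"
      by (rule rule_process_rule_proc) (use assms(2) n_pos in auto)
    let ?m = "nat \<lfloor>t * real n\<rfloor>"
    let ?T = "nat \<lfloor>tstar * real n\<rfloor>"
    have Tm: "?T \<le> ?m" using t by (intro nat_mono floor_mono mult_right_mono) auto
    have TS: "simple_function (M n) (\<lambda>\<omega>. graph_at (E n) i \<omega>)" for i by (rule simple_F_M[OF simple_G])
    let ?A = "{\<omega> \<in> space (M n). real (L1 n (graph_at (E n) ?T \<omega>)) \<le> e * real n}"
    let ?B = "{\<omega> \<in> space (M n). real (L1 n (graph_at (E n) ?m \<omega>)) \<ge> e * real n}"
    have A: "?A \<in> events" by (rule simple_function_Collect[OF TS, where P = "\<lambda>g. real (L1 n g) \<le> e * real n"])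
    have B: "?B \<in> events" by (rule simple_function_Collect[OF TS, where P = "\<lambda>g. real (L1 n g) \<ge> e * real n"])
    \<comment> \<open>Smallness is given at time t but the path is followed up to t* \<le> t. The
      largest component only grows, so it is small at t* as well.\<close>
    have "space (M n) - ?B \<subseteq> ?A"
    proof
      fix \<omega> assume w: "\<omega> \<in> space (M n) - ?B"
      then interpret p: rule_path l n "\<lambda>i. graph_at (E n) i \<omega>" "\<lambda>i. v n (Suc i) \<omega>" by (intro rule_path) simp
      have "L1 n (graph_at (E n) ?T \<omega>) \<le> L1 n (graph_at (E n) ?m \<omega>)"
        by (rule L1_mono[OF n_pos p.G_mono[OF Tm] p.G_sub])
      then show "\<omega> \<in> ?A" using w by auto
    qed
    then have "prob (space (M n) - ?B) \<le> prob ?A" by (rule finite_measure_mono[OF _ A])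
    then have pA: "\<epsilon> < prob ?A" using prob prob_compl[OF B] by simp
    have "I * (real ?T * C\<^sup>2 / (e * real n)\<^sup>2) \<le> I * ((tstar * real n) * C\<^sup>2 / (e * real n)\<^sup>2)"
      using tstar by (intro mult_left_mono divide_right_mono mult_right_mono) (auto simp: I_def)
    also have "\<dots> = I * tstar * C\<^sup>2 / e\<^sup>2 / real n" using n_pos e by (simp add: field_simps power2_eq_square)
    also have "\<dots> < \<epsilon>"
    proof -
      have "I * tstar * C\<^sup>2 / (e\<^sup>2 * \<epsilon>) < real n" using N nN by linarith
      then show ?thesis using e \<epsilon> n_pos by (simp add: field_simps)
    qed
    also note pA
    finally have small: "I * (real ?T * C\<^sup>2 / (e * real n)\<^sup>2) < prob ?A" .
    have drift: "drift_cond l n (M n) (F n) (v n) (E n) d" using assms(4) n_pos by blast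
    have "\<exists>G w. good_path l n G w d ?T (Suc j) e"
      by (rule exists_good_path[OF drift e C1 C small[unfolded I_def]])
    then show ?thesis using nj unfolding e_def by blast
  qed
  then obtain n G w where ngw: "\<And>j. j < n j \<and> good_path l (n j) (G j) (w j) d (nat \<lfloor>tstar * real (n j)\<rfloor>) (Suc j) (1 / real (Suc j))"
    by metis
  interpret path_sequence l d tstar n G w
    by (rule path_sequence.intro) (use l_pos tstar ngw in blast)+
  obtain \<rho> where "limit_system l d \<rho> tstar" using exists_limit_system by blast
  then interpret limit_system l d \<rho> tstar .
  show False using assms(6) ode_solution suminf_rho_eq_1 by fastforce
qed

end
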